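(* For any $n\ge3$ we have $\beta_1^{(2)}(\mathcal{A}_o(I_n),\delta)=0$.
   Context: $\mathcal{S}=\mathcal{A}_o(I_n)$ is the unital $*$-algebra generated by $n^2$ self-adjoint elements $u_{ij}$ subject to the relations making the matrix $(u_{ij})$ unitary; it is a Hopf $*$-algebra with coproduct $\delta(u_{ij})=\sum_k u_{ik}\otimes u_{kj}$ and counit $\epsilon(u_{ij})=\delta_{ij}$. Its unique Haar state $h$ is a trace; let $\lambda:\mathcal{S}\to B(H)$ be the GNS representation of $h$ and $M=\lambda(\mathcal{S})''$, a finite von Neumann algebra with trace extending $h$. The $L^2$-Betti numbers of such a unimodular discrete quantum group are $$\beta_k^{(2)}(\mathcal{S},\delta)=\dim_M H_k(\mathcal{S},M)=\dim_{M^\circ}H^k(\mathcal{S},M),$$ where $H_k$, $H^k$ denote Hochschild homology and cohomology of $\mathcal{S}$ with coefficients in $M$, the two $\mathcal{S}$-actions on $M$ being multiplication via $\lambda$ on one side and the trivial action via $\epsilon$ on the other (for $H^k$: left action $\lambda(x)m$, right action $m\epsilon(x)$), $\dim$ is Lück's extended dimension function, and the action of the opposite algebra $M^\circ$ on $H^k(\mathcal{S},M)$ comes from right multiplication of $M$ on the coefficient module $M$. (The equality of the two expressions is known and may be taken as the definition.) *)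

theory Defs
  imports "HOL-Analysis.Analysis" "HOL-Library.Poly_Mapping"
begin

section \<open>Complex algebras and complex Hilbert spaces\<close>

class complex_vector = ab_group_add +
  fixes scaleC :: "complex \<Rightarrow> 'a \<Rightarrow> 'a"  (infixr \<open>*\<^sub>C\<close> 75)
  assumes scaleC_add_right: "c *\<^sub>C (x + y) = c *\<^sub>C x + c *\<^sub>C y"
    and scaleC_add_left: "(c + d) *\<^sub>C x = c *\<^sub>C x + d *\<^sub>C x"
    and scaleC_scaleC: "c *\<^sub>C (d *\<^sub>C x) = (c * d) *\<^sub>C x"
    and scaleC_one: "1 *\<^sub>C x = x"

global_interpretation complex_vector: vector_space "scaleC :: complex \<Rightarrow> 'a \<Rightarrow> 'a :: complex_vector"
  by standard (simp_all add: scaleC_add_right scaleC_add_left scaleC_scaleC scaleC_one)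

abbreviation clinear :: "('a::complex_vector \<Rightarrow> 'b::complex_vector) \<Rightarrow> bool"
  where "clinear \<equiv> Vector_Spaces.linear scaleC scaleC"

lemma clinear_iff:
  "clinear f \<longleftrightarrow> (\<forall>x y. f (x + y) = f x + f y) \<and> (\<forall>c x. f (c *\<^sub>C x) = c *\<^sub>C f x)"
  by (simp add: Vector_Spaces.linear_iff complex_vector.vector_space_axioms)

text \<open>\<open>monoid_mult\<close> rather than \<open>ring_1\<close>: the zero algebra is not excluded by the class.\<close>

class complex_algebra_1 = complex_vector + ring + monoid_mult +
  assumes mult_scaleC_left: "(c *\<^sub>C x) * y = c *\<^sub>C (x * y)"
    and mult_scaleC_right: "x * (c *\<^sub>C y) = c *\<^sub>C (x * y)"

class star_algebra_1 = complex_algebra_1 +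
  fixes star :: "'a \<Rightarrow> 'a"
  assumes star_add: "star (x + y) = star x + star y"
    and star_scaleC: "star (c *\<^sub>C x) = cnj c *\<^sub>C star x"
    and star_mult: "star (x * y) = star y * star x"
    and star_star: "star (star x) = x"

instantiation complex :: star_algebra_1
begin
definition scaleC_complex :: "complex \<Rightarrow> complex \<Rightarrow> complex" where "scaleC_complex = (*)"
definition star_complex :: "complex \<Rightarrow> complex" where "star_complex = cnj"
instance by standard (simp_all add: scaleC_complex_def star_complex_def algebra_simps)
end

definition unital_algebra_hom :: "('a::complex_algebra_1 \<Rightarrow> 'b::complex_algebra_1) \<Rightarrow> bool" where
  "unital_algebra_hom f \<longleftrightarrow> clinear f \<and> f 1 = 1 \<and> (\<forall>x y. f (x * y) = f x * f y)"

text \<open>The inner product is linear in the second argument.\<close>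

class complex_hilbert_space = complex_vector + banach +
  fixes cinner :: "'a \<Rightarrow> 'a \<Rightarrow> complex"
  assumes scaleR_eq_scaleC: "r *\<^sub>R x = complex_of_real r *\<^sub>C x"
    and cinner_commute: "cinner x y = cnj (cinner y x)"
    and cinner_add_right: "cinner x (y + z) = cinner x y + cinner x z"
    and cinner_scaleC_right: "cinner x (c *\<^sub>C y) = c * cinner x y"
    and cinner_nonneg: "0 \<le> Re (cinner x x)"
    and norm_eq_sqrt_cinner: "norm x = sqrt (Re (cinner x x))"


section \<open>The algebra of bounded operators on a complex Hilbert space\<close>

typedef (overloaded) 'h bop =
  "{T :: 'h::complex_hilbert_space \<Rightarrow> 'h. clinear T \<and> (\<exists>K. \<forall>x. norm (T x) \<le> K * norm x)}"
  morphisms apply_op Bop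
proof
  show "(\<lambda>_. 0) \<in> {T :: 'h \<Rightarrow> 'h. clinear T \<and> (\<exists>K. \<forall>x. norm (T x) \<le> K * norm x)}"
    by (auto simp: clinear_iff intro: exI[of _ 0])
qed

setup_lifting type_definition_bop

lemma norm_scaleC: "norm (c *\<^sub>C x) = cmod c * norm (x :: 'h::complex_hilbert_space)"
proof -
  have sc: "cinner (c *\<^sub>C x) y = cnj c * cinner x y" for y
    by (metis cinner_commute cinner_scaleC_right complex_cnj_mult)
  have "Im (cinner x x) = 0"
    by (metis cinner_commute add.inverse_neutral cnj.simps(2) neg_equal_zero)
  then have "Re (cinner (c *\<^sub>C x) (c *\<^sub>C x)) = (cmod c)\<^sup>2 * Re (cinner x x)"
    by (simp only: cmod_power2) (simp add: sc cinner_scaleC_right algebra_simps power2_eq_square)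
  then show ?thesis
    by (simp add: norm_eq_sqrt_cinner real_sqrt_mult)
qed

instantiation bop :: (complex_hilbert_space) complex_algebra_1
begin

lift_definition zero_bop :: "'a bop" is "\<lambda>_. 0"
  by (auto simp: clinear_iff intro: exI[of _ 0])

lift_definition one_bop :: "'a bop" is "\<lambda>x. x"
  by (auto simp: clinear_iff intro: exI[of _ 1])

lift_definition plus_bop :: "'a bop \<Rightarrow> 'a bop \<Rightarrow> 'a bop" is "\<lambda>S T x. S x + T x"
proof -
  fix S T :: "'a \<Rightarrow> 'a"
  assume S: "clinear S \<and> (\<exists>K. \<forall>x. norm (S x) \<le> K * norm x)"
    and T: "clinear T \<and> (\<exists>K. \<forall>x. norm (T x) \<le> K * norm x)"
  then obtain K L where "\<forall>x. norm (S x) \<le> K * norm x" "\<forall>x. norm (T x) \<le> L * norm x" by blast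
  then have "\<forall>x. norm (S x + T x) \<le> (K + L) * norm x"
    by (metis add_mono distrib_right norm_triangle_le)
  with S T show "clinear (\<lambda>x. S x + T x) \<and> (\<exists>K. \<forall>x. norm (S x + T x) \<le> K * norm x)"
    by (auto simp: clinear_iff scaleC_add_right)
qed

lift_definition scaleC_bop :: "complex \<Rightarrow> 'a bop \<Rightarrow> 'a bop" is "\<lambda>c T x. c *\<^sub>C T x"
proof -
  fix c and T :: "'a \<Rightarrow> 'a"
  assume T: "clinear T \<and> (\<exists>K. \<forall>x. norm (T x) \<le> K * norm x)"
  then obtain K where "\<forall>x. norm (T x) \<le> K * norm x" by blast
  then have "\<exists>K. \<forall>x. norm (c *\<^sub>C T x) \<le> K * norm x"
    by (intro exI[of _ "cmod c * K"]) (simp add: norm_scaleC mult.assoc mult_left_mono)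
  with T show "clinear (\<lambda>x. c *\<^sub>C T x) \<and> (\<exists>K. \<forall>x. norm (c *\<^sub>C T x) \<le> K * norm x)"
    by (auto simp: clinear_iff scaleC_add_right scaleC_scaleC mult.commute)
qed

lift_definition uminus_bop :: "'a bop \<Rightarrow> 'a bop" is "\<lambda>T x. - T x"
  by (auto simp: clinear_iff)

lift_definition times_bop :: "'a bop \<Rightarrow> 'a bop \<Rightarrow> 'a bop" is "\<lambda>S T x. S (T x)"
proof -
  fix S T :: "'a \<Rightarrow> 'a"
  assume S: "clinear S \<and> (\<exists>K. \<forall>x. norm (S x) \<le> K * norm x)"
    and T: "clinear T \<and> (\<exists>K. \<forall>x. norm (T x) \<le> K * norm x)"
  then obtain K L where K: "\<forall>x. norm (S x) \<le> K * norm x" and L: "\<forall>x. norm (T x) \<le> L * norm x"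
    by blast
  have "norm (S (T x)) \<le> (\<bar>K\<bar> * L) * norm x" for x
  proof -
    have "norm (S (T x)) \<le> \<bar>K\<bar> * norm (T x)"
      using K by (metis abs_ge_self mult_right_mono norm_ge_zero order_trans)
    also have "\<dots> \<le> \<bar>K\<bar> * (L * norm x)"
      using L by (simp add: mult_left_mono)
    finally show ?thesis by (simp add: mult.assoc)
  qed
  with S T show "clinear (\<lambda>x. S (T x)) \<and> (\<exists>K. \<forall>x. norm (S (T x)) \<le> K * norm x)"
    by (auto simp: clinear_iff)
qed

definition minus_bop :: "'a bop \<Rightarrow> 'a bop \<Rightarrow> 'a bop" where "minus_bop S T = S + - T"

instance
proof
  fix S T U :: "'a bop" and c d :: complex
  show "S + T + U = S + (T + U)" by transfer (simp add: add.assoc)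
  show "S + T = T + S" by transfer (simp add: add.commute)
  show "0 + S = S" by transfer simp
  show "- S + S = 0" by transfer simp
  show "S - T = S + - T" by (simp add: minus_bop_def)
  show "c *\<^sub>C (S + T) = c *\<^sub>C S + c *\<^sub>C T" by transfer (simp add: scaleC_add_right)
  show "(c + d) *\<^sub>C S = c *\<^sub>C S + d *\<^sub>C S" by transfer (simp add: scaleC_add_left)
  show "c *\<^sub>C d *\<^sub>C S = (c * d) *\<^sub>C S" by transfer (simp add: scaleC_scaleC)
  show "1 *\<^sub>C S = S" by transfer (simp add: scaleC_one)
  show "S * T * U = S * (T * U)" by transfer simp
  show "(S + T) * U = S * U + T * U" by transfer simp
  show "S * (T + U) = S * T + S * U" by transfer (auto simp: clinear_iff)
  show "1 * S = S" by transfer simp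
  show "S * 1 = S" by transfer simp
  show "(c *\<^sub>C S) * T = c *\<^sub>C (S * T)" by transfer simp
  show "S * (c *\<^sub>C T) = c *\<^sub>C (S * T)" by transfer (auto simp: clinear_iff)
qed

end

definition commutant :: "'h::complex_hilbert_space bop set \<Rightarrow> 'h bop set" where
  "commutant A = {T. \<forall>S\<in>A. T * S = S * T}"


section \<open>Free vector spaces\<close>

instantiation poly_mapping :: (type, complex_vector) complex_vector
begin

lift_definition scaleC_poly_mapping :: "complex \<Rightarrow> ('a \<Rightarrow>\<^sub>0 'b) \<Rightarrow> ('a \<Rightarrow>\<^sub>0 'b)"
  is "\<lambda>c f x. c *\<^sub>C f x"
proof -
  fix c :: complex and f :: "'a \<Rightarrow> 'b"
  assume "finite {x. f x \<noteq> 0}"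
  then show "finite {x. c *\<^sub>C f x \<noteq> 0}"
    by (rule rev_finite_subset) auto
qed

instance
  by standard (transfer, simp add: fun_eq_iff scaleC_add_right scaleC_add_left scaleC_scaleC scaleC_one)+

end

lemma lookup_scaleC: "Poly_Mapping.lookup (c *\<^sub>C f) x = c *\<^sub>C Poly_Mapping.lookup f x"
  by transfer simp

definition linear_ext :: "('x \<Rightarrow> 'v::complex_vector) \<Rightarrow> ('x \<Rightarrow>\<^sub>0 complex) \<Rightarrow> 'v" where
  "linear_ext g f = (\<Sum>x\<in>Poly_Mapping.keys f. Poly_Mapping.lookup f x *\<^sub>C g x)"

lemma linear_ext_superset:
  assumes "finite A" "Poly_Mapping.keys f \<subseteq> A"
  shows "linear_ext g f = (\<Sum>x\<in>A. Poly_Mapping.lookup f x *\<^sub>C g x)"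
  unfolding linear_ext_def
  by (rule sum.mono_neutral_left) (use assms in \<open>auto simp: in_keys_iff\<close>)

lemma linear_ext_add: "linear_ext g (f + f') = linear_ext g f + linear_ext g f'"
proof -
  let ?A = "Poly_Mapping.keys f \<union> Poly_Mapping.keys f'"
  have "Poly_Mapping.keys (f + f') \<subseteq> ?A" by (rule keys_add)
  then show ?thesis
    by (simp add: linear_ext_superset[of ?A] lookup_add scaleC_add_left sum.distrib)
qed

lemma linear_ext_scaleC: "linear_ext g (c *\<^sub>C f) = c *\<^sub>C linear_ext g f"
proof -
  have "Poly_Mapping.keys (c *\<^sub>C f) \<subseteq> Poly_Mapping.keys f"
    by (auto simp: in_keys_iff lookup_scaleC)
  then show ?thesis
    by (simp add: linear_ext_superset[of "Poly_Mapping.keys f"] lookup_scaleC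
        complex_vector.scale_sum_right scaleC_complex_def)
qed

lemma clinear_linear_ext: "clinear (linear_ext g)"
  by (simp add: clinear_iff linear_ext_add linear_ext_scaleC)

lemma linear_ext_single [simp]: "linear_ext g (Poly_Mapping.single x c) = c *\<^sub>C g x"
  by (cases "c = 0") (simp_all add: linear_ext_def)

lemma linear_ext_zero [simp]: "linear_ext g 0 = 0"
  by (simp add: linear_ext_def)

lemma linear_ext_diff: "linear_ext g (f - f') = linear_ext g f - linear_ext g f'"
  by (metis add_diff_cancel diff_add_cancel linear_ext_add)

lemma linear_ext_fun_add: "linear_ext (\<lambda>x. g x + g' x) f = linear_ext g f + linear_ext g' f"
  by (simp add: linear_ext_def scaleC_add_right sum.distrib)

lemma linear_ext_fun_scaleC: "linear_ext (\<lambda>x. c *\<^sub>C g x) f = c *\<^sub>C linear_ext g f"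
  by (simp add: linear_ext_def scaleC_scaleC complex_vector.scale_sum_right mult.commute)

lemma free_induct [case_names single add]:
  fixes f :: "'x \<Rightarrow>\<^sub>0 'b::comm_monoid_add"
  assumes s: "\<And>x c. P (Poly_Mapping.single x c)" and a: "\<And>f g. P f \<Longrightarrow> P g \<Longrightarrow> P (f + g)"
  shows "P f"
proof -
  have z: "P 0" using s[of undefined 0] by simp
  have "P (\<Sum>x\<in>A. Poly_Mapping.single x (Poly_Mapping.lookup f x))" if "finite A" for A
    using that by (induction A rule: finite_induct) (auto intro: s a z)
  moreover have "(\<Sum>x\<in>Poly_Mapping.keys f. Poly_Mapping.single x (Poly_Mapping.lookup f x)) = f"
    by (rule poly_mapping_eqI) (simp add: lookup_sum lookup_single when_def in_keys_iff)
  ultimately show ?thesis by (metis finite_keys)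
qed

lemma scaleC_single: "c *\<^sub>C Poly_Mapping.single x d = Poly_Mapping.single x (c *\<^sub>C d)"
  by (rule poly_mapping_eqI) (simp add: lookup_scaleC lookup_single when_def)


section \<open>Tensor products of complex algebras\<close>

definition bilinear_relations :: "(('a::complex_vector \<times> 'b::complex_vector) \<Rightarrow>\<^sub>0 complex) set" where
  "bilinear_relations =
     {Poly_Mapping.single (a + a', b) 1 - Poly_Mapping.single (a, b) 1
        - Poly_Mapping.single (a', b) 1 | a a' b. True} \<union>
     {Poly_Mapping.single (a, b + b') 1 - Poly_Mapping.single (a, b) 1
        - Poly_Mapping.single (a, b') 1 | a b b'. True} \<union>
     {Poly_Mapping.single (c *\<^sub>C a, b) 1 - c *\<^sub>C Poly_Mapping.single (a, b) 1 | c a b. True} \<union>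
     {Poly_Mapping.single (a, c *\<^sub>C b) 1 - c *\<^sub>C Poly_Mapping.single (a, b) 1 | c a b. True}"

definition tensor_eq ::
    "(('a::complex_vector \<times> 'b::complex_vector) \<Rightarrow>\<^sub>0 complex) \<Rightarrow> (('a \<times> 'b) \<Rightarrow>\<^sub>0 complex) \<Rightarrow> bool"
  where "tensor_eq f g \<longleftrightarrow> f - g \<in> complex_vector.span bilinear_relations"

lemma equivp_diff_span: "equivp (\<lambda>f g. f - g \<in> complex_vector.span R)"
proof (rule equivpI)
  show "reflp (\<lambda>f g. f - g \<in> complex_vector.span R)"
    by (simp add: reflp_def complex_vector.span_zero)
  show "symp (\<lambda>f g. f - g \<in> complex_vector.span R)"
    by (rule sympI) (metis complex_vector.span_neg minus_diff_eq)
  show "transp (\<lambda>f g. f - g \<in> complex_vector.span R)"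
  proof (rule transpI)
    fix f g h :: 'a
    assume "f - g \<in> complex_vector.span R" "g - h \<in> complex_vector.span R"
    then have "(f - g) + (g - h) \<in> complex_vector.span R" by (rule complex_vector.span_add)
    then show "f - h \<in> complex_vector.span R" by simp
  qed
qed

quotient_type (overloaded) ('a, 'b) tensor =
    "('a::complex_vector \<times> 'b::complex_vector) \<Rightarrow>\<^sub>0 complex" / tensor_eq
  unfolding tensor_eq_def[abs_def] by (rule equivp_diff_span)

instantiation tensor :: (complex_vector, complex_vector) complex_vector
begin

lift_definition zero_tensor :: "('a, 'b) tensor" is 0 .

lift_definition plus_tensor :: "('a, 'b) tensor \<Rightarrow> ('a, 'b) tensor \<Rightarrow> ('a, 'b) tensor" is "(+)"
  unfolding tensor_eq_def by (metis add_diff_add complex_vector.span_add)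

lift_definition minus_tensor :: "('a, 'b) tensor \<Rightarrow> ('a, 'b) tensor \<Rightarrow> ('a, 'b) tensor" is "(-)"
  unfolding tensor_eq_def
proof -
  fix f f' g g' :: "('a \<times> 'b) \<Rightarrow>\<^sub>0 complex"
  assume "f - f' \<in> complex_vector.span bilinear_relations"
    "g - g' \<in> complex_vector.span bilinear_relations"
  then have "(f - f') - (g - g') \<in> complex_vector.span bilinear_relations"
    by (rule complex_vector.span_diff)
  then show "f - g - (f' - g') \<in> complex_vector.span bilinear_relations"
    by (simp add: algebra_simps)
qed

lift_definition uminus_tensor :: "('a, 'b) tensor \<Rightarrow> ('a, 'b) tensor" is uminus
  unfolding tensor_eq_def by (metis complex_vector.span_neg minus_diff_minus)

lift_definition scaleC_tensor :: "complex \<Rightarrow> ('a, 'b) tensor \<Rightarrow> ('a, 'b) tensor" is "scaleC"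
  unfolding tensor_eq_def
  by (metis complex_vector.scale_right_diff_distrib complex_vector.span_scale)

instance
proof
  fix r s t :: "('a, 'b) tensor" and c d :: complex
  have eq: "tensor_eq f f" for f :: "('a \<times> 'b) \<Rightarrow>\<^sub>0 complex"
    by (rule equivp_reflp[OF tensor_equivp])
  show "r + s + t = r + (s + t)" by transfer (simp add: add.assoc eq)
  show "r + s = s + r" by transfer (simp add: add.commute eq)
  show "0 + r = r" by transfer (simp add: eq)
  show "- r + r = 0" by transfer (simp add: eq)
  show "r - s = r + - s" by transfer (simp add: eq)
  show "c *\<^sub>C (r + s) = c *\<^sub>C r + c *\<^sub>C s" by transfer (simp add: scaleC_add_right eq)
  show "(c + d) *\<^sub>C r = c *\<^sub>C r + d *\<^sub>C r" by transfer (simp add: scaleC_add_left eq)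
  show "c *\<^sub>C d *\<^sub>C r = (c * d) *\<^sub>C r" by transfer (simp add: scaleC_scaleC eq)
  show "1 *\<^sub>C r = r" by transfer (simp add: scaleC_one eq)
qed

end

lift_definition pure_tensor :: "'a::complex_vector \<Rightarrow> 'b::complex_vector \<Rightarrow> ('a, 'b) tensor"
    (infixr \<open>\<otimes>\<^sub>t\<close> 72)
  is "\<lambda>a b. Poly_Mapping.single (a, b) 1" .

lemma pure_tensor_add_left: "(a + a') \<otimes>\<^sub>t b = a \<otimes>\<^sub>t b + a' \<otimes>\<^sub>t b"
  by transfer (unfold tensor_eq_def diff_diff_add[symmetric],
      rule complex_vector.span_base, unfold bilinear_relations_def, blast)

lemma pure_tensor_add_right: "a \<otimes>\<^sub>t (b + b') = a \<otimes>\<^sub>t b + a \<otimes>\<^sub>t b'"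
  by transfer (unfold tensor_eq_def diff_diff_add[symmetric],
      rule complex_vector.span_base, unfold bilinear_relations_def, blast)

lemma pure_tensor_scaleC_left: "(c *\<^sub>C a) \<otimes>\<^sub>t b = c *\<^sub>C (a \<otimes>\<^sub>t b)"
  by transfer (unfold tensor_eq_def, rule complex_vector.span_base,
      unfold bilinear_relations_def, blast)

lemma pure_tensor_scaleC_right: "a \<otimes>\<^sub>t (c *\<^sub>C b) = c *\<^sub>C (a \<otimes>\<^sub>t b)"
  by transfer (unfold tensor_eq_def, rule complex_vector.span_base,
      unfold bilinear_relations_def, blast)

text \<open>The linear map on the tensor product induced by \<open>g\<close>. It is only meaningful for bilinear \<open>g\<close>,
  when the choice of representative does not matter.\<close>

definition tensor_lift ::
    "('a::complex_vector \<Rightarrow> 'b::complex_vector \<Rightarrow> 'v::complex_vector) \<Rightarrow> ('a, 'b) tensor \<Rightarrow> 'v"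
  where "tensor_lift g t = linear_ext (\<lambda>(a, b). g a b) (rep_tensor t)"

lemma tensor_lift_abs:
  assumes l: "\<And>b. clinear (\<lambda>a. g a b)" and r: "\<And>a. clinear (g a)"
  shows "tensor_lift g (abs_tensor f) = linear_ext (\<lambda>(a, b). g a b) f"
proof -
  let ?L = "linear_ext (\<lambda>(a, b). g a b)"
  have "?L x = 0" if "x \<in> complex_vector.span bilinear_relations" for x
    using that
  proof (induction rule: complex_vector.span_induct)
    case base
    show ?case
      by (auto simp: complex_vector.subspace_def linear_ext_add linear_ext_scaleC)
  next
    case (step x)
    with l r show ?case
      unfolding bilinear_relations_def
      by (auto simp: linear_ext_diff linear_ext_scaleC scaleC_one clinear_iff)
  qed
  moreover have "tensor_eq (rep_tensor (abs_tensor f)) f"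
    by (rule Quotient_rep_abs[OF Quotient_tensor equivp_reflp[OF tensor_equivp]])
  ultimately have "?L (rep_tensor (abs_tensor f) - f) = 0"
    unfolding tensor_eq_def by blast
  then show ?thesis by (simp add: tensor_lift_def linear_ext_diff)
qed

lemma tensor_lift_pure:
  assumes "\<And>b. clinear (\<lambda>a. g a b)" "\<And>a. clinear (g a)"
  shows "tensor_lift g (a \<otimes>\<^sub>t b) = g a b"
  unfolding pure_tensor_def by (simp add: tensor_lift_abs[OF assms] scaleC_one)

lemma clinear_tensor_lift:
  assumes "\<And>b. clinear (\<lambda>a. g a b)" "\<And>a. clinear (g a)"
  shows "clinear (tensor_lift g)"
proof -
  have "tensor_lift g (s + t) = tensor_lift g s + tensor_lift g t" for s t
    by (induction s; induction t)
      (simp add: plus_tensor.abs_eq tensor_lift_abs[OF assms] linear_ext_add)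
  moreover have "tensor_lift g (c *\<^sub>C s) = c *\<^sub>C tensor_lift g s" for c s
    by (induction s) (simp add: scaleC_tensor.abs_eq tensor_lift_abs[OF assms] linear_ext_scaleC)
  ultimately show ?thesis by (simp add: clinear_iff)
qed

text \<open>The product on representatives, determined by \<open>(a, b) (c, d) = (a c, b d)\<close>.\<close>

definition pair_mult :: "(('a::complex_algebra_1 \<times> 'b::complex_algebra_1) \<Rightarrow>\<^sub>0 complex)
    \<Rightarrow> (('a \<times> 'b) \<Rightarrow>\<^sub>0 complex) \<Rightarrow> (('a \<times> 'b) \<Rightarrow>\<^sub>0 complex)" where
  "pair_mult f g =
     linear_ext (\<lambda>(a, b). linear_ext (\<lambda>(c, d). Poly_Mapping.single (a * c, b * d) 1) g) f"

lemma pair_mult_add_left: "pair_mult (f + f') g = pair_mult f g + pair_mult f' g"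
  by (simp add: pair_mult_def linear_ext_add)

lemma pair_mult_scaleC_left: "pair_mult (c *\<^sub>C f) g = c *\<^sub>C pair_mult f g"
  by (simp add: pair_mult_def linear_ext_scaleC)

lemma pair_mult_add_right: "pair_mult f (g + g') = pair_mult f g + pair_mult f g'"
  by (simp add: pair_mult_def linear_ext_add case_prod_unfold linear_ext_fun_add)

lemma pair_mult_scaleC_right: "pair_mult f (c *\<^sub>C g) = c *\<^sub>C pair_mult f g"
  by (simp add: pair_mult_def linear_ext_scaleC case_prod_unfold linear_ext_fun_scaleC)

lemma pair_mult_diff_left: "pair_mult (f - f') g = pair_mult f g - pair_mult f' g"
  by (metis add_diff_cancel diff_add_cancel pair_mult_add_left)

lemma pair_mult_diff_right: "pair_mult f (g - g') = pair_mult f g - pair_mult f g'"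
  by (metis add_diff_cancel diff_add_cancel pair_mult_add_right)

lemma pair_mult_single:
  "pair_mult (Poly_Mapping.single (a, b) x) (Poly_Mapping.single (c, d) y) =
     Poly_Mapping.single (a * c, b * d) (x * y)"
  by (simp add: pair_mult_def scaleC_single scaleC_complex_def)

lemma pair_mult_assoc: "pair_mult (pair_mult f g) h = pair_mult f (pair_mult g h)"
proof (induction f rule: free_induct)
  case (single p x)
  show ?case
  proof (induction g rule: free_induct)
    case (single q y)
    show ?case
    proof (induction h rule: free_induct)
      case (single r z)
      show ?case by (cases p; cases q; cases r) (simp add: pair_mult_single mult.assoc)
    qed (simp add: pair_mult_add_right)
  qed (simp add: pair_mult_add_right pair_mult_add_left)
qed (simp add: pair_mult_add_left)

lemma pair_mult_one_left: "pair_mult (Poly_Mapping.single (1, 1) 1) f = f"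
proof (induction f rule: free_induct)
  case (single p x)
  show ?case by (cases p) (simp add: pair_mult_single)
qed (simp add: pair_mult_add_right)

lemma pair_mult_one_right: "pair_mult f (Poly_Mapping.single (1, 1) 1) = f"
proof (induction f rule: free_induct)
  case (single p x)
  show ?case by (cases p) (simp add: pair_mult_single)
qed (simp add: pair_mult_add_left)

lemma bilinear_relations_intros:
  "Poly_Mapping.single (a + a', b) 1 - Poly_Mapping.single (a, b) 1
        - Poly_Mapping.single (a', b) 1 \<in> bilinear_relations"
  "Poly_Mapping.single (a, b + b') 1 - Poly_Mapping.single (a, b) 1
        - Poly_Mapping.single (a, b') 1 \<in> bilinear_relations"
  "Poly_Mapping.single (c *\<^sub>C a, b) 1 - c *\<^sub>C Poly_Mapping.single (a, b) 1 \<in> bilinear_relations"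
  "Poly_Mapping.single (a, c *\<^sub>C b) 1 - c *\<^sub>C Poly_Mapping.single (a, b) 1 \<in> bilinear_relations"
  unfolding bilinear_relations_def by blast+

lemma bilinear_relations_cases:
  assumes "r \<in> bilinear_relations"
  obtains a a' b where "r = Poly_Mapping.single (a + a', b) 1 - Poly_Mapping.single (a, b) 1
        - Poly_Mapping.single (a', b) 1"
  | a b b' where "r = Poly_Mapping.single (a, b + b') 1 - Poly_Mapping.single (a, b) 1
        - Poly_Mapping.single (a, b') 1"
  | c a b where "r = Poly_Mapping.single (c *\<^sub>C a, b) 1 - c *\<^sub>C Poly_Mapping.single (a, b) 1"
  | c a b where "r = Poly_Mapping.single (a, c *\<^sub>C b) 1 - c *\<^sub>C Poly_Mapping.single (a, b) 1"
  using assms unfolding bilinear_relations_def by blast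

lemma single_eq_scaleC: "Poly_Mapping.single p (z::complex) = z *\<^sub>C Poly_Mapping.single p 1"
  by (simp add: scaleC_single scaleC_complex_def)

lemma pair_mult_span_left:
  assumes "r \<in> complex_vector.span bilinear_relations"
  shows "pair_mult r g \<in> complex_vector.span bilinear_relations"
  using assms
proof (induction rule: complex_vector.span_induct)
  case base
  show ?case
    by (auto simp: complex_vector.subspace_def pair_mult_add_left pair_mult_scaleC_left
        complex_vector.span_add complex_vector.span_scale)
      (simp add: pair_mult_def complex_vector.span_zero)
next
  case (step r)
  show ?case
  proof (induction g rule: free_induct)
    case (single p z)
    obtain c d where p: "p = (c, d)" by (cases p)
    have "pair_mult r (Poly_Mapping.single (c, d) 1) \<in> bilinear_relations"
      using step
      by (cases rule: bilinear_relations_cases)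
        (simp_all add: pair_mult_diff_left pair_mult_scaleC_left pair_mult_single distrib_right
          mult_scaleC_left bilinear_relations_intros)
    then show ?case
      unfolding p by (subst single_eq_scaleC, unfold pair_mult_scaleC_right)
        (intro complex_vector.span_scale complex_vector.span_base)
  qed (simp add: pair_mult_add_right complex_vector.span_add)
qed

lemma pair_mult_span_right:
  assumes "r \<in> complex_vector.span bilinear_relations"
  shows "pair_mult g r \<in> complex_vector.span bilinear_relations"
  using assms
proof (induction rule: complex_vector.span_induct)
  case base
  show ?case
    by (auto simp: complex_vector.subspace_def pair_mult_add_right pair_mult_scaleC_right
        complex_vector.span_add complex_vector.span_scale)
      (metis complex_vector.scale_zero_left pair_mult_scaleC_right complex_vector.span_zero)
next
  case (step r)
  show ?case
  proof (induction g rule: free_induct)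
    case (single p z)
    obtain c d where p: "p = (c, d)" by (cases p)
    have "pair_mult (Poly_Mapping.single (c, d) 1) r \<in> bilinear_relations"
      using step
      by (cases rule: bilinear_relations_cases)
        (simp_all add: pair_mult_diff_right pair_mult_scaleC_right pair_mult_single distrib_left
          mult_scaleC_right bilinear_relations_intros)
    then show ?case
      unfolding p by (subst single_eq_scaleC, unfold pair_mult_scaleC_left)
        (intro complex_vector.span_scale complex_vector.span_base)
  qed (simp add: pair_mult_add_left complex_vector.span_add)
qed

instantiation tensor :: (complex_algebra_1, complex_algebra_1) complex_algebra_1
begin

lift_definition one_tensor :: "('a, 'b) tensor" is "Poly_Mapping.single (1, 1) 1" .

lift_definition times_tensor :: "('a, 'b) tensor \<Rightarrow> ('a, 'b) tensor \<Rightarrow> ('a, 'b) tensor" is pair_mult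
  unfolding tensor_eq_def
proof -
  fix f f' g g' :: "('a \<times> 'b) \<Rightarrow>\<^sub>0 complex"
  assume "f - f' \<in> complex_vector.span bilinear_relations"
    "g - g' \<in> complex_vector.span bilinear_relations"
  then have "pair_mult (f - f') g + pair_mult f' (g - g') \<in> complex_vector.span bilinear_relations"
    by (intro complex_vector.span_add pair_mult_span_left pair_mult_span_right)
  then show "pair_mult f g - pair_mult f' g' \<in> complex_vector.span bilinear_relations"
    by (simp add: pair_mult_diff_left pair_mult_diff_right)
qed

instance
proof
  fix r s t :: "('a, 'b) tensor" and c :: complex
  have eq: "tensor_eq f f" for f :: "('a \<times> 'b) \<Rightarrow>\<^sub>0 complex"
    by (rule equivp_reflp[OF tensor_equivp])
  show "r * s * t = r * (s * t)" by transfer (simp add: pair_mult_assoc eq)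
  show "(r + s) * t = r * t + s * t" by transfer (simp add: pair_mult_add_left eq)
  show "r * (s + t) = r * s + r * t" by transfer (simp add: pair_mult_add_right eq)
  show "1 * r = r" by transfer (simp add: pair_mult_one_left eq)
  show "r * 1 = r" by transfer (simp add: pair_mult_one_right eq)
  show "(c *\<^sub>C r) * s = c *\<^sub>C (r * s)" by transfer (simp add: pair_mult_scaleC_left eq)
  show "r * (c *\<^sub>C s) = c *\<^sub>C (r * s)" by transfer (simp add: pair_mult_scaleC_right eq)
qed

end

lemma pure_tensor_mult: "(a \<otimes>\<^sub>t b) * (c \<otimes>\<^sub>t d) = (a * c) \<otimes>\<^sub>t (b * d)"
  by transfer (simp add: pair_mult_single equivp_reflp[OF tensor_equivp])

lemma pure_tensor_one: "1 \<otimes>\<^sub>t 1 = (1 :: ('a::complex_algebra_1, 'b::complex_algebra_1) tensor)"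
  by transfer (simp add: equivp_reflp[OF tensor_equivp])


section \<open>The algebra \<open>A\<^sub>o(I\<^sub>n)\<close>\<close>

text \<open>Words form a monoid under concatenation. The wrapper keeps \<^typ>\<open>'x list\<close> free of algebraic
  class instances; the monoid operation has to be called \<open>+\<close> for the monoid algebra
  \<open>'x word \<Rightarrow>\<^sub>0 complex\<close> to become the free unital algebra on \<open>'x\<close>.\<close>

datatype 'x word = Word (letters: "'x list")

instantiation word :: (type) monoid_add
begin
definition zero_word :: "'a word" where "zero_word = Word []"
definition plus_word :: "'a word \<Rightarrow> 'a word \<Rightarrow> 'a word"
  where "plus_word v w = Word (letters v @ letters w)"
instance by standard (simp_all add: zero_word_def plus_word_def)
end

type_synonym 'x free_algebra = "'x word \<Rightarrow>\<^sub>0 complex"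

abbreviation free_gen :: "'x \<Rightarrow> 'x free_algebra"
  where "free_gen x \<equiv> Poly_Mapping.single (Word [x]) 1"

text \<open>The involution of the free algebra for which the generators are self-adjoint: it reverses
  words and conjugates coefficients.\<close>

lift_definition free_star :: "'x free_algebra \<Rightarrow> 'x free_algebra"
  is "\<lambda>f w. cnj (f (Word (rev (letters w))))"
proof -
  fix f :: "'x word \<Rightarrow> complex"
  assume "finite {w. f w \<noteq> 0}"
  moreover have "{w. cnj (f (Word (rev (letters w)))) \<noteq> 0}
      \<subseteq> (\<lambda>w. Word (rev (letters w))) ` {w. f w \<noteq> 0}" (is "?A \<subseteq> ?r ` _")
  proof
    fix w assume "w \<in> ?A"
    then have "?r (?r w) \<in> ?r ` {w. f w \<noteq> 0}" by (intro imageI) simp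
    then show "w \<in> ?r ` {w. f w \<noteq> 0}" by simp
  qed
  ultimately show "finite ?A"
    by (metis finite_imageI finite_subset)
qed

lemma free_star_add: "free_star (f + g) = free_star f + free_star g"
  by transfer (simp add: fun_eq_iff)

lemma free_star_diff: "free_star (f - g) = free_star f - free_star g"
  by transfer (simp add: fun_eq_iff)

lemma free_star_scaleC: "free_star (c *\<^sub>C f) = cnj c *\<^sub>C free_star f"
  by transfer (simp add: fun_eq_iff scaleC_complex_def)

lemma free_star_star: "free_star (free_star f) = f"
  by transfer (simp add: fun_eq_iff)

lemma free_star_single:
  "free_star (Poly_Mapping.single w c) = Poly_Mapping.single (Word (rev (letters w))) (cnj c)"
  by transfer (auto simp: fun_eq_iff when_def)

lemma free_star_mult: "free_star (f * g) = free_star g * free_star f"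
proof (induction f rule: free_induct)
  case (single v x)
  show ?case
  proof (induction g rule: free_induct)
    case (single w y)
    show ?case by (simp add: mult_single free_star_single plus_word_def mult.commute)
  qed (simp add: free_star_add distrib_left distrib_right)
qed (simp add: free_star_add distrib_left distrib_right)

lemma free_scaleC_mult:
  fixes f g :: "'x free_algebra"
  shows "(c *\<^sub>C f) * g = c *\<^sub>C (f * g)" "f * (c *\<^sub>C g) = c *\<^sub>C (f * g)"
proof -
  have c: "c *\<^sub>C f = Poly_Mapping.single 0 c * f" "c *\<^sub>C f = f * Poly_Mapping.single 0 c"
    for f :: "'x free_algebra"
  proof (induction f rule: free_induct)
    case (single w x)
    {
      case 1 show ?case by (simp add: mult_single scaleC_single scaleC_complex_def)
    next
      case 2 show ?case by (simp add: mult_single scaleC_single scaleC_complex_def mult.commute)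
    }
  qed (simp_all add: scaleC_add_right distrib_left distrib_right)
  show "(c *\<^sub>C f) * g = c *\<^sub>C (f * g)" by (simp add: c(1) mult.assoc)
  show "f * (c *\<^sub>C g) = c *\<^sub>C (f * g)" by (simp add: c(2) mult.assoc)
qed

text \<open>The entries of \<open>u u\<^sup>* - 1\<close> and of \<open>u\<^sup>* u - 1\<close>, where \<open>(u\<^sup>*)\<^sub>i\<^sub>j = (u\<^sub>j\<^sub>i)\<^sup>*\<close>.\<close>

definition Ao_relations :: "('n::finite \<times> 'n) free_algebra set" where
  "Ao_relations =
     (\<Union>i j. {(\<Sum>k\<in>UNIV. free_gen (i, k) * free_star (free_gen (j, k))) - of_bool (i = j),
             (\<Sum>k\<in>UNIV. free_star (free_gen (k, i)) * free_gen (k, j)) - of_bool (i = j)})"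

definition Ao_ideal :: "('n::finite \<times> 'n) free_algebra set" where
  "Ao_ideal = complex_vector.span {f * r * g | f r g. r \<in> Ao_relations}"

definition Ao_eq :: "('n::finite \<times> 'n) free_algebra \<Rightarrow> ('n \<times> 'n) free_algebra \<Rightarrow> bool" where
  "Ao_eq f g \<longleftrightarrow> f - g \<in> Ao_ideal"

quotient_type (overloaded) 'n Ao = "('n::finite \<times> 'n) free_algebra" / Ao_eq
  unfolding Ao_eq_def[abs_def] Ao_ideal_def by (rule equivp_diff_span)

lemma Ao_ideal_mult_left: "r \<in> Ao_ideal \<Longrightarrow> h * r \<in> Ao_ideal"
  unfolding Ao_ideal_def
proof (induction rule: complex_vector.span_induct)
  case base
  show ?case
    by (auto simp: complex_vector.subspace_def distrib_left free_scaleC_mult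
        complex_vector.span_add complex_vector.span_scale complex_vector.span_zero)
next
  case (step r)
  then obtain f s g where "r = f * s * g" "s \<in> Ao_relations" by blast
  then have "h * r = (h * f) * s * g" "s \<in> Ao_relations" by (simp_all add: mult.assoc)
  then show ?case by (blast intro: complex_vector.span_base)
qed

lemma Ao_ideal_mult_right: "r \<in> Ao_ideal \<Longrightarrow> r * h \<in> Ao_ideal"
  unfolding Ao_ideal_def
proof (induction rule: complex_vector.span_induct)
  case base
  show ?case
    by (auto simp: complex_vector.subspace_def distrib_right free_scaleC_mult
        complex_vector.span_add complex_vector.span_scale complex_vector.span_zero)
next
  case (step r)
  then obtain f s g where "r = f * s * g" "s \<in> Ao_relations" by blast
  then have "r * h = f * s * (g * h)" "s \<in> Ao_relations" by (simp_all add: mult.assoc)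
  then show ?case by (blast intro: complex_vector.span_base)
qed

lemma free_star_one: "free_star 1 = 1"
  by (metis free_star_mult free_star_star mult.right_neutral mult.left_neutral)

lemma free_star_zero: "free_star 0 = 0"
  by (metis diff_self free_star_diff)

lemma free_star_sum: "free_star (\<Sum>x\<in>A. f x) = (\<Sum>x\<in>A. free_star (f x))"
  by (induction A rule: infinite_finite_induct) (simp_all add: free_star_zero free_star_add)

lemma free_star_relations: "r \<in> Ao_relations \<Longrightarrow> free_star r \<in> Ao_relations"
proof -
  have *: "free_star (of_bool b) = of_bool b" for b
    by (cases b) (simp_all add: free_star_zero free_star_one)
  assume "r \<in> Ao_relations"
  then obtain i j where
    "r = (\<Sum>k\<in>UNIV. free_gen (i, k) * free_star (free_gen (j, k))) - of_bool (i = j) \<or>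
     r = (\<Sum>k\<in>UNIV. free_star (free_gen (k, i)) * free_gen (k, j)) - of_bool (i = j)"
    unfolding Ao_relations_def by blast
  then have
    "free_star r = (\<Sum>k\<in>UNIV. free_gen (j, k) * free_star (free_gen (i, k))) - of_bool (j = i) \<or>
     free_star r = (\<Sum>k\<in>UNIV. free_star (free_gen (k, j)) * free_gen (k, i)) - of_bool (j = i)"
    by (elim disjE)
      (simp_all only: free_star_diff free_star_sum free_star_mult free_star_star * eq_commute[of i j],
        simp_all)
  then show "free_star r \<in> Ao_relations"
    unfolding Ao_relations_def by blast
qed

lemma Ao_ideal_star: "r \<in> Ao_ideal \<Longrightarrow> free_star r \<in> Ao_ideal"
  unfolding Ao_ideal_def
proof (induction rule: complex_vector.span_induct)
  case base
  show ?case
    by (auto simp: complex_vector.subspace_def free_star_add free_star_zero free_star_scaleC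
        complex_vector.span_add complex_vector.span_scale complex_vector.span_zero)
next
  case (step r)
  then obtain f s g where r: "r = f * s * g" and s: "s \<in> Ao_relations" by blast
  have "free_star r = free_star g * free_star s * free_star f"
    by (simp add: r free_star_mult mult.assoc)
  with free_star_relations[OF s] show ?case by (blast intro: complex_vector.span_base)
qed

instantiation Ao :: (finite) star_algebra_1
begin

lift_definition zero_Ao :: "'a Ao" is 0 .
lift_definition one_Ao :: "'a Ao" is 1 .

lift_definition plus_Ao :: "'a Ao \<Rightarrow> 'a Ao \<Rightarrow> 'a Ao" is "(+)"
  unfolding Ao_eq_def Ao_ideal_def add_diff_add by (rule complex_vector.span_add)

lift_definition uminus_Ao :: "'a Ao \<Rightarrow> 'a Ao" is uminus
  unfolding Ao_eq_def Ao_ideal_def minus_diff_minus by (rule complex_vector.span_neg)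

definition minus_Ao :: "'a Ao \<Rightarrow> 'a Ao \<Rightarrow> 'a Ao" where "minus_Ao x y = x + - y"

lift_definition scaleC_Ao :: "complex \<Rightarrow> 'a Ao \<Rightarrow> 'a Ao" is scaleC
  unfolding Ao_eq_def Ao_ideal_def complex_vector.scale_right_diff_distrib[symmetric]
  by (rule complex_vector.span_scale)

lift_definition times_Ao :: "'a Ao \<Rightarrow> 'a Ao \<Rightarrow> 'a Ao" is "(*)"
  unfolding Ao_eq_def
proof -
  fix f f' g g' :: "('a \<times> 'a) free_algebra"
  assume "f - f' \<in> Ao_ideal" "g - g' \<in> Ao_ideal"
  then have "(f - f') * g \<in> Ao_ideal" "f' * (g - g') \<in> Ao_ideal"
    by (simp_all add: Ao_ideal_mult_left Ao_ideal_mult_right)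
  then have "(f - f') * g + f' * (g - g') \<in> Ao_ideal"
    unfolding Ao_ideal_def by (rule complex_vector.span_add)
  moreover have "(f - f') * g + f' * (g - g') = f * g - f' * g'"
    by (simp only: left_diff_distrib right_diff_distrib) simp
  ultimately show "f * g - f' * g' \<in> Ao_ideal" by (simp only:)
qed

lift_definition star_Ao :: "'a Ao \<Rightarrow> 'a Ao" is free_star
  unfolding Ao_eq_def free_star_diff[symmetric] by (rule Ao_ideal_star)

instance
proof
  fix x y z :: "'a Ao" and c d :: complex
  have eq: "Ao_eq f f" for f :: "('a \<times> 'a) free_algebra"
    by (rule equivp_reflp[OF Ao_equivp])
  show "x + y + z = x + (y + z)" by transfer (simp add: add.assoc eq)
  show "x + y = y + x" by transfer (simp add: add.commute eq)
  show "0 + x = x" by transfer (simp add: eq)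
  show "- x + x = 0" by transfer (simp add: eq)
  show "x - y = x + - y" by (simp add: minus_Ao_def)
  show "c *\<^sub>C (x + y) = c *\<^sub>C x + c *\<^sub>C y" by transfer (simp add: scaleC_add_right eq)
  show "(c + d) *\<^sub>C x = c *\<^sub>C x + d *\<^sub>C x" by transfer (simp add: scaleC_add_left eq)
  show "c *\<^sub>C d *\<^sub>C x = (c * d) *\<^sub>C x" by transfer (simp add: scaleC_scaleC eq)
  show "1 *\<^sub>C x = x" by transfer (simp add: scaleC_one eq)
  show "x * y * z = x * (y * z)" by transfer (simp add: mult.assoc eq)
  show "(x + y) * z = x * z + y * z" by transfer (simp add: distrib_right eq)
  show "x * (y + z) = x * y + x * z" by transfer (simp add: distrib_left eq)
  show "1 * x = x" by transfer (simp add: eq)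
  show "x * 1 = x" by transfer (simp add: eq)
  show "(c *\<^sub>C x) * y = c *\<^sub>C (x * y)" by transfer (simp add: free_scaleC_mult eq)
  show "x * (c *\<^sub>C y) = c *\<^sub>C (x * y)" by transfer (simp add: free_scaleC_mult eq)
  show "star (x + y) = star x + star y" by transfer (simp add: free_star_add eq)
  show "star (c *\<^sub>C x) = cnj c *\<^sub>C star x" by transfer (simp add: free_star_scaleC eq)
  show "star (x * y) = star y * star x" by transfer (simp add: free_star_mult eq)
  show "star (star x) = x" by transfer (simp add: free_star_star eq)
qed

end

lift_definition u_gen :: "'n::finite \<Rightarrow> 'n \<Rightarrow> 'n Ao" is "\<lambda>i j. free_gen (i, j)" .

lemma star_u: "star (u_gen i j) = u_gen i j"
  by transfer (simp add: free_star_single equivp_reflp[OF Ao_equivp])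

lemma abs_Ao_sum: "(\<Sum>k\<in>A. abs_Ao (f k)) = abs_Ao (\<Sum>k\<in>A. f k)"
  by (induction A rule: infinite_finite_induct) (simp_all add: zero_Ao_def plus_Ao.abs_eq)

lemma Ao_relations_vanish: "r \<in> Ao_relations \<Longrightarrow> r \<in> Ao_ideal"
  unfolding Ao_ideal_def
  by (intro complex_vector.span_base CollectI exI[of _ 1] exI[of _ r]) simp

lemma u_unitary:
  "(\<Sum>k\<in>UNIV. u_gen i k * star (u_gen j k)) = (if i = j then 1 else 0)"
  "(\<Sum>k\<in>UNIV. star (u_gen k i) * u_gen k j) = (if i = j then 1 else 0)"
proof -
  have 1: "(if i = j then 1 else 0) = abs_Ao (of_bool (i = j))"
    by (simp add: of_bool_def zero_Ao_def one_Ao_def)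
  show "(\<Sum>k\<in>UNIV. u_gen i k * star (u_gen j k)) = (if i = j then 1 else 0)"
    unfolding 1 u_gen_def map_fun_def comp_def id_def star_Ao.abs_eq times_Ao.abs_eq abs_Ao_sum
      Ao.abs_eq_iff Ao_eq_def
    by (rule Ao_relations_vanish) (auto simp: Ao_relations_def)
  show "(\<Sum>k\<in>UNIV. star (u_gen k i) * u_gen k j) = (if i = j then 1 else 0)"
    unfolding 1 u_gen_def map_fun_def comp_def id_def star_Ao.abs_eq times_Ao.abs_eq abs_Ao_sum
      Ao.abs_eq_iff Ao_eq_def
    by (rule Ao_relations_vanish) (auto simp: Ao_relations_def)
qed

subsection \<open>Counit and coproduct\<close>

definition free_eval :: "('x \<Rightarrow> 'b::complex_algebra_1) \<Rightarrow> 'x free_algebra \<Rightarrow> 'b" where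
  "free_eval v = linear_ext (\<lambda>w. prod_list (map v (letters w)))"

lemma free_eval_gen [simp]: "free_eval v (free_gen x) = v x"
  by (simp add: free_eval_def scaleC_one)

lemma free_eval_one [simp]: "free_eval v 1 = 1"
proof -
  have "free_eval v (Poly_Mapping.single 0 1) = 1"
    unfolding free_eval_def linear_ext_single by (simp add: zero_word_def scaleC_one)
  then show ?thesis by simp
qed

lemma free_eval_add: "free_eval v (f + g) = free_eval v f + free_eval v g"
  by (simp add: free_eval_def linear_ext_add)

lemma free_eval_diff: "free_eval v (f - g) = free_eval v f - free_eval v g"
  by (simp add: free_eval_def linear_ext_diff)

lemma free_eval_zero [simp]: "free_eval v 0 = 0"
  by (simp add: free_eval_def)

lemma free_eval_scaleC: "free_eval v (c *\<^sub>C f) = c *\<^sub>C free_eval v f"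
  by (simp add: free_eval_def linear_ext_scaleC)

lemma free_eval_sum: "free_eval v (\<Sum>x\<in>A. f x) = (\<Sum>x\<in>A. free_eval v (f x))"
  by (induction A rule: infinite_finite_induct) (simp_all add: free_eval_add)

lemma free_eval_mult: "free_eval v (f * g) = free_eval v f * free_eval v g"
proof (induction f rule: free_induct)
  case (single w x)
  show ?case
  proof (induction g rule: free_induct)
    case (single w' y)
    show ?case
      by (simp add: free_eval_def mult_single plus_word_def mult_scaleC_left mult_scaleC_right
          scaleC_scaleC)
  qed (simp add: free_eval_add distrib_left)
qed (simp add: free_eval_add distrib_right)

lemma free_eval_Ao_eq:
  fixes v :: "'n::finite \<times> 'n \<Rightarrow> 'b::complex_algebra_1"
  assumes r: "\<And>i j. (\<Sum>k\<in>UNIV. v (i, k) * v (j, k)) = (if i = j then 1 else 0)"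
    and c: "\<And>i j. (\<Sum>k\<in>UNIV. v (k, i) * v (k, j)) = (if i = j then 1 else 0)"
    and "Ao_eq f g"
  shows "free_eval v f = free_eval v g"
proof -
  have rel: "free_eval v s = 0" if "s \<in> Ao_relations" for s
    using that r c unfolding Ao_relations_def
    by (auto simp: free_eval_diff free_eval_sum free_eval_mult free_star_single of_bool_def)
  have "free_eval v h = 0" if "h \<in> Ao_ideal" for h
    using that unfolding Ao_ideal_def
  proof (induction rule: complex_vector.span_induct)
    case base
    show ?case by (auto simp: complex_vector.subspace_def free_eval_add free_eval_scaleC)
  next
    case (step x)
    then obtain f s g where "x = f * s * g" "s \<in> Ao_relations" by blast
    then show ?case by (simp add: free_eval_mult rel)
  qed
  with \<open>Ao_eq f g\<close> have "free_eval v f - free_eval v g = 0"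
    unfolding Ao_eq_def free_eval_diff[symmetric] by blast
  then show ?thesis by simp
qed

lift_definition counit :: "'n::finite Ao \<Rightarrow> complex"
  is "free_eval (\<lambda>(i, j). if i = j then 1 else 0)"
proof (rule free_eval_Ao_eq, unfold prod.case)
  fix i j :: 'n
  have "(if i = k then 1 else 0) * (if j = k then 1 else 0) =
      (if i = k then if i = j then 1 else 0 else 0 :: complex)" for k
    by simp
  then show "(\<Sum>k\<in>UNIV. (if i = k then 1 else 0) * (if j = k then 1 else 0)) =
      (if i = j then 1 else 0 :: complex)"
    by (simp only: sum.delta' finite UNIV_I if_True)
  have "(if k = i then 1 else 0) * (if k = j then 1 else 0) =
      (if k = i then if i = j then 1 else 0 else 0 :: complex)" for k
    by simp
  then show "(\<Sum>k\<in>UNIV. (if k = i then 1 else 0) * (if k = j then 1 else 0)) =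
      (if i = j then 1 else 0 :: complex)"
    by (simp only: sum.delta finite UNIV_I if_True)
qed

lemma pure_tensor_zero_left: "0 \<otimes>\<^sub>t b = 0"
  by (metis complex_vector.scale_zero_left pure_tensor_scaleC_left)

lemma pure_tensor_zero_right: "a \<otimes>\<^sub>t 0 = 0"
  by (metis complex_vector.scale_zero_left pure_tensor_scaleC_right)

lemma pure_tensor_sum_left: "(\<Sum>x\<in>A. f x) \<otimes>\<^sub>t b = (\<Sum>x\<in>A. f x \<otimes>\<^sub>t b)"
  by (induction A rule: infinite_finite_induct)
    (simp_all add: pure_tensor_zero_left pure_tensor_add_left)

lemma pure_tensor_sum_right: "a \<otimes>\<^sub>t (\<Sum>x\<in>A. f x) = (\<Sum>x\<in>A. a \<otimes>\<^sub>t f x)"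
  by (induction A rule: infinite_finite_induct)
    (simp_all add: pure_tensor_zero_right pure_tensor_add_right)

lemma pure_tensor_if:
  "a \<otimes>\<^sub>t (if Q then 1 else 0) = (if Q then a \<otimes>\<^sub>t 1 else 0)"
  "(if Q then 1 else 0) \<otimes>\<^sub>t a = (if Q then 1 \<otimes>\<^sub>t a else 0)"
  by (simp_all add: pure_tensor_zero_left pure_tensor_zero_right)

lemma u_orthogonal:
  "(\<Sum>k\<in>UNIV. u_gen i k * u_gen j k) = (if i = j then 1 else 0)"
  "(\<Sum>k\<in>UNIV. u_gen k i * u_gen k j) = (if i = j then 1 else 0)"
  using u_unitary[of i j] by (simp_all add: star_u)

lift_definition coproduct :: "'n::finite Ao \<Rightarrow> ('n Ao, 'n Ao) tensor"
  is "free_eval (\<lambda>(i, j). \<Sum>k\<in>UNIV. u_gen i k \<otimes>\<^sub>t u_gen k j)"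
proof (rule free_eval_Ao_eq, unfold prod.case)
  fix i j :: 'n
  have "(\<Sum>k\<in>UNIV. (\<Sum>a\<in>UNIV. u_gen i a \<otimes>\<^sub>t u_gen a k) * (\<Sum>b\<in>UNIV. u_gen j b \<otimes>\<^sub>t u_gen b k)) =
      (\<Sum>k\<in>UNIV. \<Sum>a\<in>UNIV. \<Sum>b\<in>UNIV. (u_gen i a * u_gen j b) \<otimes>\<^sub>t (u_gen a k * u_gen b k))"
    by (simp only: sum_product pure_tensor_mult)
  also have "\<dots> = (\<Sum>a\<in>UNIV. \<Sum>b\<in>UNIV. (u_gen i a * u_gen j b) \<otimes>\<^sub>t (\<Sum>k\<in>UNIV. u_gen a k * u_gen b k))"
    by (subst sum.swap, rule sum.cong[OF refl], subst sum.swap)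
      (simp only: pure_tensor_sum_right)
  also have "\<dots> = (\<Sum>a\<in>UNIV. (u_gen i a * u_gen j a) \<otimes>\<^sub>t 1)"
    by (simp only: u_orthogonal(1) pure_tensor_if pure_tensor_sum_left sum.delta' finite UNIV_I if_True)
  also have "\<dots> = (if i = j then 1 else 0)"
    by (simp only: u_orthogonal(1) pure_tensor_if pure_tensor_one pure_tensor_sum_left[symmetric])
  finally show "(\<Sum>k\<in>UNIV. (\<Sum>a\<in>UNIV. u_gen i a \<otimes>\<^sub>t u_gen a k) * (\<Sum>b\<in>UNIV. u_gen j b \<otimes>\<^sub>t u_gen b k)) =
      (if i = j then 1 else 0)" .
  have "(\<Sum>k\<in>UNIV. (\<Sum>a\<in>UNIV. u_gen k a \<otimes>\<^sub>t u_gen a i) * (\<Sum>b\<in>UNIV. u_gen k b \<otimes>\<^sub>t u_gen b j)) =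
      (\<Sum>k\<in>UNIV. \<Sum>a\<in>UNIV. \<Sum>b\<in>UNIV. (u_gen k a * u_gen k b) \<otimes>\<^sub>t (u_gen a i * u_gen b j))"
    by (simp only: sum_product pure_tensor_mult)
  also have "\<dots> = (\<Sum>a\<in>UNIV. \<Sum>b\<in>UNIV. (\<Sum>k\<in>UNIV. u_gen k a * u_gen k b) \<otimes>\<^sub>t (u_gen a i * u_gen b j))"
    by (subst sum.swap, rule sum.cong[OF refl], subst sum.swap)
      (simp only: pure_tensor_sum_left)
  also have "\<dots> = (\<Sum>a\<in>UNIV. 1 \<otimes>\<^sub>t (u_gen a i * u_gen a j))"
    by (simp only: u_orthogonal(2) pure_tensor_if pure_tensor_sum_right sum.delta' finite UNIV_I if_True)
  also have "\<dots> = (if i = j then 1 else 0)"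
    by (simp only: u_orthogonal(2) pure_tensor_if pure_tensor_one pure_tensor_sum_right[symmetric])
  finally show "(\<Sum>k\<in>UNIV. (\<Sum>a\<in>UNIV. u_gen k a \<otimes>\<^sub>t u_gen a i) * (\<Sum>b\<in>UNIV. u_gen k b \<otimes>\<^sub>t u_gen b j)) =
      (if i = j then 1 else 0)" .
qed

lemma counit_u: "counit (u_gen i j) = (if i = j then 1 else 0)"
  by (subst u_gen.abs_eq, subst counit.abs_eq) simp

lemma coproduct_u: "coproduct (u_gen i j) = (\<Sum>k\<in>UNIV. u_gen i k \<otimes>\<^sub>t u_gen k j)"
  by (subst u_gen.abs_eq, subst coproduct.abs_eq) simp

lemma unital_algebra_hom_counit: "unital_algebra_hom (counit :: 'n::finite Ao \<Rightarrow> complex)"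
  unfolding unital_algebra_hom_def clinear_iff
proof (intro conjI allI)
  fix x y :: "'n Ao" and c :: complex
  obtain f g where xy: "x = abs_Ao f" "y = abs_Ao g" 
    by (metis Quotient_abs_rep[OF Quotient_Ao])
  show "counit (x + y) = counit x + counit y"
    by (simp only: xy plus_Ao.abs_eq counit.abs_eq free_eval_add)
  show "counit (c *\<^sub>C x) = c *\<^sub>C counit x"
    by (simp only: xy scaleC_Ao.abs_eq counit.abs_eq free_eval_scaleC)
  show "counit (x * y) = counit x * counit y"
    by (simp only: xy times_Ao.abs_eq counit.abs_eq free_eval_mult)
  show "counit (1 :: 'n Ao) = 1"
    by (simp only: one_Ao.abs_eq counit.abs_eq free_eval_one)
qed

lemma unital_algebra_hom_coproduct: "unital_algebra_hom (coproduct :: 'n::finite Ao \<Rightarrow> _)"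
  unfolding unital_algebra_hom_def clinear_iff
proof (intro conjI allI)
  fix x y :: "'n Ao" and c :: complex
  obtain f g where xy: "x = abs_Ao f" "y = abs_Ao g" 
    by (metis Quotient_abs_rep[OF Quotient_Ao])
  show "coproduct (x + y) = coproduct x + coproduct y"
    by (simp only: xy plus_Ao.abs_eq coproduct.abs_eq free_eval_add)
  show "coproduct (c *\<^sub>C x) = c *\<^sub>C coproduct x"
    by (simp only: xy scaleC_Ao.abs_eq coproduct.abs_eq free_eval_scaleC)
  show "coproduct (x * y) = coproduct x * coproduct y"
    by (simp only: xy times_Ao.abs_eq coproduct.abs_eq free_eval_mult)
  show "coproduct (1 :: 'n Ao) = 1"
    by (simp only: one_Ao.abs_eq coproduct.abs_eq free_eval_one)
qed


section \<open>Haar state and GNS representation\<close>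

definition is_state :: "('s::star_algebra_1 \<Rightarrow> complex) \<Rightarrow> bool" where
  "is_state h \<longleftrightarrow> clinear h \<and> h 1 = 1 \<and> (\<forall>x. h (star x * x) \<in> \<real> \<and> 0 \<le> Re (h (star x * x)))"

text \<open>The invariance conditions are \<open>(id \<otimes> h) \<Delta>(x) = h(x) 1 = (h \<otimes> id) \<Delta>(x)\<close>.\<close>

definition haar_state ::
    "('s::star_algebra_1 \<Rightarrow> ('s, 's) tensor) \<Rightarrow> ('s \<Rightarrow> complex) \<Rightarrow> bool" where
  "haar_state \<Delta> h \<longleftrightarrow> is_state h \<and>
     (\<forall>x. tensor_lift (\<lambda>a b. h b *\<^sub>C a) (\<Delta> x) = h x *\<^sub>C 1) \<and>
     (\<forall>x. tensor_lift (\<lambda>a b. h a *\<^sub>C b) (\<Delta> x) = h x *\<^sub>C 1)"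

definition gns_representation ::
    "('s::star_algebra_1 \<Rightarrow> complex) \<Rightarrow> ('s \<Rightarrow> 'h::complex_hilbert_space bop) \<Rightarrow> 'h \<Rightarrow> bool" where
  "gns_representation h \<pi> \<xi> \<longleftrightarrow>
     unital_algebra_hom \<pi> \<and>
     (\<forall>x v w. cinner (apply_op (\<pi> (star x)) v) w = cinner v (apply_op (\<pi> x) w)) \<and>
     closure (range (\<lambda>x. apply_op (\<pi> x) \<xi>)) = UNIV \<and>
     (\<forall>x. h x = cinner \<xi> (apply_op (\<pi> x) \<xi>))"


section \<open>Modules and extended dimension\<close>

text \<open>Right modules over a subring \<open>M\<close> of an ambient ring, i.e. left modules over the opposite
  ring of \<open>M\<close>.\<close>

record ('r, 'x) right_module =
  elems :: "'x set"
  madd :: "'x \<Rightarrow> 'x \<Rightarrow> 'x"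
  mact :: "'x \<Rightarrow> 'r \<Rightarrow> 'x"

definition is_submodule :: "'r set \<Rightarrow> ('r, 'x) right_module \<Rightarrow> 'x set \<Rightarrow> bool" where
  "is_submodule M N P \<longleftrightarrow> P \<subseteq> elems N \<and> P \<noteq> {} \<and>
     (\<forall>x\<in>P. \<forall>y\<in>P. madd N x y \<in> P) \<and> (\<forall>x\<in>P. \<forall>m\<in>M. mact N x m \<in> P)"

definition module_iso ::
    "'r set \<Rightarrow> ('r, 'x) right_module \<Rightarrow> ('r, 'y) right_module \<Rightarrow> ('x \<Rightarrow> 'y) \<Rightarrow> bool" where
  "module_iso M N N' \<phi> \<longleftrightarrow> bij_betw \<phi> (elems N) (elems N') \<and>
     (\<forall>x\<in>elems N. \<forall>y\<in>elems N. \<phi> (madd N x y) = madd N' (\<phi> x) (\<phi> y)) \<and>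
     (\<forall>x\<in>elems N. \<forall>m\<in>M. \<phi> (mact N x m) = mact N' (\<phi> x) m)"

definition quotient_module ::
    "('r, 'x) right_module \<Rightarrow> 'x set \<Rightarrow> ('r, 'x set) right_module" where
  "quotient_module N B =
     \<lparr>elems = {{madd N x b | b. b \<in> B} | x. x \<in> elems N},
      madd = (\<lambda>X Y. {madd N x y | x y. x \<in> X \<and> y \<in> Y}),
      mact = (\<lambda>X m. {madd N (mact N x m) b | x b. x \<in> X \<and> b \<in> B})\<rparr>"

text \<open>Columns of length \<open>k\<close> with entries in \<open>M\<close> are functions vanishing outside \<open>{..<k}\<close>.\<close>

definition columns :: "'r::zero set \<Rightarrow> nat \<Rightarrow> (nat \<Rightarrow> 'r) set" where
  "columns M k = {x. (\<forall>i<k. x i \<in> M) \<and> (\<forall>i\<ge>k. x i = 0)}"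

definition idempotent_matrix :: "'r::ring set \<Rightarrow> nat \<Rightarrow> (nat \<Rightarrow> nat \<Rightarrow> 'r) \<Rightarrow> bool" where
  "idempotent_matrix M k p \<longleftrightarrow>
     (\<forall>i<k. \<forall>j<k. p i j \<in> M \<and> (\<Sum>l<k. p i l * p l j) = p i j)"

text \<open>The range \<open>p M\<^sup>k\<close> of the right \<open>M\<close>-linear endomorphism of \<open>M\<^sup>k\<close> given by \<open>p\<close>; a module is
  finitely generated projective iff it is isomorphic to such a range with \<open>p\<close> idempotent.\<close>

definition matrix_range ::
    "'r::ring set \<Rightarrow> nat \<Rightarrow> (nat \<Rightarrow> nat \<Rightarrow> 'r) \<Rightarrow> ('r, nat \<Rightarrow> 'r) right_module" where
  "matrix_range M k p =
     \<lparr>elems = (\<lambda>x i. if i < k then \<Sum>j<k. p i j * x j else 0) ` columns M k,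
      madd = (\<lambda>x y i. x i + y i),
      mact = (\<lambda>x m i. x i * m)\<rparr>"

text \<open>Lueck's extended dimension with respect to a trace \<open>\<tau>\<close>: the supremum of the von Neumann
  dimensions \<open>\<Sum>\<^sub>i \<tau>(p\<^sub>i\<^sub>i)\<close> of the finitely generated projective submodules \<open>P \<cong> p M\<^sup>k\<close>.\<close>

definition extended_dim ::
    "'r::ring set \<Rightarrow> ('r \<Rightarrow> complex) \<Rightarrow> ('r, 'x) right_module \<Rightarrow> ennreal" where
  "extended_dim M \<tau> N =
     Sup {ennreal (Re (\<Sum>i<k. \<tau> (p i i))) | P k p.
            is_submodule M N P \<and> idempotent_matrix M k p \<and>
            (\<exists>\<phi>. module_iso M (N\<lparr>elems := P\<rparr>) (matrix_range M k p) \<phi>)}"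


section \<open>Hochschild cohomology\<close>

text \<open>The coefficient bimodule is a subspace \<open>M\<close> with left action \<open>l\<close> and right action \<open>r\<close> of the
  algebra \<open>'s\<close>. Cochains of degree \<open>k\<close> are \<open>k\<close>-linear maps, encoded as functions of lists that
  vanish on lists of any other length.\<close>

definition cochains :: "'m::complex_vector set \<Rightarrow> nat \<Rightarrow> ('s::complex_algebra_1 list \<Rightarrow> 'm) set" where
  "cochains M k = {f.
     (\<forall>xs. length xs = k \<longrightarrow> f xs \<in> M) \<and>
     (\<forall>xs. length xs \<noteq> k \<longrightarrow> f xs = 0) \<and>
     (\<forall>xs i. length xs = k \<and> i < k \<longrightarrow> clinear (\<lambda>x. f (xs[i := x])))}"

definition coboundary ::
    "('s::complex_algebra_1 \<Rightarrow> 'm \<Rightarrow> 'm::complex_vector) \<Rightarrow> ('m \<Rightarrow> 's \<Rightarrow> 'm) \<Rightarrow> nat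
      \<Rightarrow> ('s list \<Rightarrow> 'm) \<Rightarrow> ('s list \<Rightarrow> 'm)" where
  "coboundary l r k f xs = (if length xs \<noteq> Suc k then 0 else
     l (hd xs) (f (tl xs))
     + (\<Sum>i<k. (-1) ^ Suc i *\<^sub>C f (take i xs @ (xs ! i * xs ! Suc i) # drop (i + 2) xs))
     + (-1) ^ Suc k *\<^sub>C r (f (butlast xs)) (last xs))"

definition cocycles where
  "cocycles M l r k = {f \<in> cochains M k. coboundary l r k f = (\<lambda>_. 0)}"

definition coboundaries where
  "coboundaries M l r k =
     (case k of 0 \<Rightarrow> {\<lambda>_. 0} | Suc j \<Rightarrow> coboundary l r j ` cochains M j)"

text \<open>\<open>H\<^sup>k\<close> with the right \<open>M\<close>-module structure induced by right multiplication of \<open>M\<close> on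
  coefficients.\<close>

definition hochschild_cohomology ::
    "'m::complex_algebra_1 set \<Rightarrow> ('s::complex_algebra_1 \<Rightarrow> 'm \<Rightarrow> 'm) \<Rightarrow> ('m \<Rightarrow> 's \<Rightarrow> 'm) \<Rightarrow> nat
      \<Rightarrow> ('m, ('s list \<Rightarrow> 'm) set) right_module" where
  "hochschild_cohomology M l r k =
     quotient_module
       \<lparr>elems = cocycles M l r k,
        madd = (\<lambda>f g xs. f xs + g xs),
        mact = (\<lambda>f m xs. f xs * m)\<rparr>
       (coboundaries M l r k)"


section \<open>L2-Betti numbers\<close>

text \<open>Here \<open>\<epsilon>\<close> is the counit and \<open>(\<pi>, \<xi>)\<close> the GNS representation of the Haar state; the vector
  state of \<open>\<xi>\<close> is the trace on \<open>M = \<pi>(S)''\<close> extending it. The dimension is that of cohomology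
  over the opposite algebra of \<open>M\<close>.\<close>

definition l2_betti ::
    "('s::star_algebra_1 \<Rightarrow> complex) \<Rightarrow> ('s \<Rightarrow> 'h::complex_hilbert_space bop) \<Rightarrow> 'h \<Rightarrow> nat
      \<Rightarrow> ennreal" where
  "l2_betti \<epsilon> \<pi> \<xi> k =
     (let M = commutant (commutant (range \<pi>));
          \<tau> = (\<lambda>T. cinner \<xi> (apply_op T \<xi>))
      in extended_dim M \<tau>
           (hochschild_cohomology M (\<lambda>x m. \<pi> x * m) (\<lambda>m x. \<epsilon> x *\<^sub>C m) k))"

end

theory Submission
  imports Defs
begin

text \<open>A derivation \<open>c\<close> with values in \<open>M\<close> gives a map \<open>\<eta> x = c x \<xi>\<close> into \<open>H\<close>, hence a functional
  \<open>\<phi> x = \<langle>\<xi>, \<eta> x\<rangle>\<close> that determines \<open>\<eta>\<close>. If \<open>v k\<close> denotes the \<open>k\<close>-th irreducible corepresentation, of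
  dimension \<open>d k\<close>, then \<open>\<phi>\<close> amounts to the matrices \<open>\<phi> (v k)\<close>, and by the orthogonality relations the
  vectors \<open>\<eta> u\<^sub>a\<^sub>b\<close> say that the gradient of this sequence, which by the fusion rules compares \<open>\<phi> (v k)\<close>
  with \<open>\<phi> (v (k - 1))\<close> and \<open>\<phi> (v (k + 1))\<close>, is square summable with weights \<open>d k\<close>. Normalized partial
  traces have a spectral gap of order \<open>1 / (d k)\<^sup>2\<close> on traceless matrices. The exponential growth of
  \<open>d k\<close> for \<open>n \<ge> 3\<close> then forces \<open>\<phi>\<close> to differ from a multiple of the counit by a functional \<open>\<langle>\<xi>, \<sqdot> \<zeta>\<rangle>\<close>,
  so \<open>\<eta>\<close> is inner, implemented by \<open>\<zeta> \<in> H\<close>. Finally \<open>\<zeta>\<close> is replaced by elements of \<open>M\<close> at the price of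
  multiplying the class of \<open>c\<close> by an injective element of \<open>M\<close>, so this class vanishes in every finitely
  generated projective submodule.\<close>

section \<open>Hilbert space geometry\<close>

text \<open>The presentation of the algebra does not show that 1 is independent of the coefficients
  \<open>v k\<close> with k > 0, so a model satisfying the relations has to be built, in which all
  admissible families of values occur. The trace property of the Haar state is not part of its
  definition either; it is derived from invariance, and it makes right multiplication on the GNS
  space bounded. The spectral gap closes like 1 / (d k)^2, so there is no uniform Poincare
  inequality. It suffices nevertheless: level k of the gradient has weight d k in the norm, and
  against the normalization by d k the loss of (d k)^2 leaves a bound d k * G k, the term of a
  summable series. This only gives convergence to 0. Square summability comes from running a
  first-order inequality from infinity downwards, where d (k + 1) \<ge> 2 * d k turns it into a
  convolution with a geometric sequence. For n = 2 one would have d k = k + 1, without this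
  doubling.\<close>

lemma cinner_add_left: "cinner (x + y) z = cinner x z + cinner (y::'h::complex_hilbert_space) z"
  by (metis cinner_add_right cinner_commute complex_cnj_add)

lemma cinner_scaleC_left: "cinner (c *\<^sub>C x) y = cnj c * cinner (x::'h::complex_hilbert_space) y"
  by (metis cinner_commute cinner_scaleC_right complex_cnj_mult)

lemma cinner_zero_right [simp]: "cinner (x::'h::complex_hilbert_space) 0 = 0"
  using cinner_add_right[of x 0 0] by simp

lemma cinner_zero_left [simp]: "cinner 0 (x::'h::complex_hilbert_space) = 0"
  using cinner_add_left[of 0 0 x] by simp

lemma cinner_minus_right: "cinner x (- y) = - cinner (x::'h::complex_hilbert_space) y"
  using cinner_add_right[of x y "- y"] by (simp add: eq_neg_iff_add_eq_0 add.commute)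

lemma cinner_minus_left: "cinner (- x) y = - cinner (x::'h::complex_hilbert_space) y"
  using cinner_add_left[of x "- x" y] by (simp add: eq_neg_iff_add_eq_0 add.commute)

lemma cinner_diff_right: "cinner x (y - z) = cinner x y - cinner (x::'h::complex_hilbert_space) z"
  using cinner_add_right[of x y "- z"] by (simp add: cinner_minus_right)

lemma cinner_diff_left: "cinner (x - y) z = cinner x z - cinner (y::'h::complex_hilbert_space) z"
  using cinner_add_left[of x "- y" z] by (simp add: cinner_minus_left)

lemma cinner_sum_right: "cinner x (\<Sum>i\<in>A. f i) = (\<Sum>i\<in>A. cinner (x::'h::complex_hilbert_space) (f i))"
  by (induction A rule: infinite_finite_induct) (simp_all add: cinner_add_right)

lemma cinner_sum_left: "cinner (\<Sum>i\<in>A. f i) x = (\<Sum>i\<in>A. cinner (f i) (x::'h::complex_hilbert_space))"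
  by (induction A rule: infinite_finite_induct) (simp_all add: cinner_add_left)

lemma norm_power2_cinner: "(norm (x::'h::complex_hilbert_space))\<^sup>2 = Re (cinner x x)"
  by (simp add: norm_eq_sqrt_cinner cinner_nonneg)

lemma cinner_self: "cinner x x = complex_of_real ((norm (x::'h::complex_hilbert_space))\<^sup>2)"
proof -
  have "Im (cinner x x) = 0"
    by (metis cinner_commute add.inverse_neutral cnj.simps(2) neg_equal_zero)
  then show ?thesis by (simp add: complex_eq_iff norm_power2_cinner)
qed

text \<open>The subtracted vector is the projection of y onto the line through x. The formula serves
  both the Cauchy-Schwarz inequality and the orthogonality of nearest points; for x = 0 it holds
  because division by 0 gives 0.\<close>

lemma norm_diff_scaleC_power2:
  "(norm (y - (cinner x y / complex_of_real ((norm x)\<^sup>2)) *\<^sub>C x))\<^sup>2 =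
     (norm (y::'h::complex_hilbert_space))\<^sup>2 - (cmod (cinner x y))\<^sup>2 / (norm x)\<^sup>2"
proof (cases "x = 0")
  case False
  define t where "t = cinner x y / complex_of_real ((norm x)\<^sup>2)"
  have c: "cinner y x = cnj (cinner x y)" by (rule cinner_commute)
  have "cinner (y - t *\<^sub>C x) (y - t *\<^sub>C x) =
    cinner y y - t * cnj (cinner x y) - cnj t * cinner x y + cnj t * t * cinner x x"
    by (simp add: cinner_diff_left cinner_diff_right cinner_scaleC_left cinner_scaleC_right c
        algebra_simps)
  also have "\<dots> = complex_of_real ((norm y)\<^sup>2 - (cmod (cinner x y))\<^sup>2 / (norm x)\<^sup>2)"
    using False unfolding t_def cinner_self
    by (simp add: complex_norm_square[symmetric] field_simps)
  finally have "complex_of_real ((norm (y - t *\<^sub>C x))\<^sup>2) = complex_of_real ((norm y)\<^sup>2 - (cmod (cinner x y))\<^sup>2 / (norm x)\<^sup>2)"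
    by (simp only: cinner_self)
  then show ?thesis unfolding t_def[symmetric] of_real_eq_iff .
qed simp

lemma Cauchy_Schwarz_cinner: "cmod (cinner x y) \<le> norm x * norm (y::'h::complex_hilbert_space)"
proof (cases "x = 0")
  case False
  have "0 \<le> (norm y)\<^sup>2 - (cmod (cinner x y))\<^sup>2 / (norm x)\<^sup>2"
    unfolding norm_diff_scaleC_power2[symmetric] by simp
  then have "(cmod (cinner x y))\<^sup>2 \<le> (norm x * norm y)\<^sup>2"
    using False by (simp add: field_simps)
  then show ?thesis by (rule power2_le_imp_le) simp
qed simp

lemma bounded_linear_cinner: "bounded_linear (cinner (x::'h::complex_hilbert_space))"
  by (rule bounded_linear_intro[where K = "norm x"])
    (simp_all add: cinner_add_right scaleR_eq_scaleC cinner_scaleC_right scaleR_conv_of_real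
      Cauchy_Schwarz_cinner[of x] mult.commute[of _ "norm x"])

lemma tendsto_cinner_right:
  "(f \<longlongrightarrow> l) F \<Longrightarrow> ((\<lambda>i. cinner x (f i)) \<longlongrightarrow> cinner (x::'h::complex_hilbert_space) l) F"
  by (rule bounded_linear.tendsto[OF bounded_linear_cinner])

lemma tendsto_cinner_left:
  assumes "(f \<longlongrightarrow> l) F"
  shows "((\<lambda>i. cinner (f i) (x::'h::complex_hilbert_space)) \<longlongrightarrow> cinner l x) F"
  using tendsto_cnj[OF tendsto_cinner_right[OF assms, of x]]
  by (simp only: cinner_commute[symmetric])

lemma parallelogram_law:
  "(norm (x + y))\<^sup>2 + (norm (x - y))\<^sup>2 = 2 * (norm x)\<^sup>2 + 2 * (norm (y::'h::complex_hilbert_space))\<^sup>2"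
  by (simp add: norm_power2_cinner cinner_add_left cinner_add_right cinner_diff_left cinner_diff_right)

lemma cinner_all_zero_dense:
  assumes d: "closure A = (UNIV::'h::complex_hilbert_space set)" and z: "\<And>a. a \<in> A \<Longrightarrow> cinner a x = 0"
  shows "x = 0"
proof -
  have "x \<in> closure A" using d by simp
  then obtain f where f: "\<And>n. f n \<in> A" "f \<longlonglongrightarrow> x" unfolding closure_sequential by blast
  have "(\<lambda>n. cinner (f n) x) \<longlonglongrightarrow> cinner x x" by (rule tendsto_cinner_left[OF f(2)])
  then have "cinner x x = 0" using z[OF f(1)] by (simp add: LIMSEQ_const_iff)
  then show ?thesis by (simp add: cinner_self)
qed

lemma closure_seqE:
  fixes x :: "'a::metric_space"
  assumes "x \<in> closure S"
  obtains f where "\<And>n. f n \<in> S" "f \<longlonglongrightarrow> x"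
  using assms closure_sequential[of x S] by blast

lemma closure_seqI:
  fixes x :: "'a::metric_space"
  assumes "\<And>n. f n \<in> S" "f \<longlonglongrightarrow> x"
  shows "x \<in> closure S"
  using assms closure_sequential[of x S] by blast

text \<open>A minimizing sequence for the distance is Cauchy by the parallelogram law, since
  midpoints stay in K. If the residual had a nonzero inner product with some k in K, moving along k
  would shorten the distance.\<close>

lemma orthogonal_projection_exists:
  fixes K :: "'h::complex_hilbert_space set"
  assumes K: "closed K" "complex_vector.subspace K"
  shows "\<exists>p\<in>K. \<forall>k\<in>K. cinner k (x - p) = 0"
proof -
  let ?d = "infdist x K"
  have K0: "0 \<in> K" using K(2) by (rule complex_vector.subspace_0)
  then have ne: "K \<noteq> {}" by auto
  have low: "?d \<le> norm (x - k)" if "k \<in> K" for k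
    using infdist_le[OF that, of x] by (simp add: dist_norm)
  have "\<exists>k\<in>K. norm (x - k) < ?d + inverse (real (Suc n))" for n
  proof -
    have "(INF a\<in>K. dist x a) < ?d + inverse (real (Suc n))"
      using ne by (simp add: infdist_def)
    then obtain k where "k \<in> K" "dist x k < ?d + inverse (real (Suc n))"
      using ne by (subst (asm) cINF_less_iff) (auto intro: bdd_belowI2[of _ 0])
    then show ?thesis by (auto simp: dist_norm)
  qed
  then obtain f where fK: "\<And>n. f n \<in> K" and f: "\<And>n. norm (x - f n) < ?d + inverse (real (Suc n))"
    by metis
  have lim: "(\<lambda>n. norm (x - f n)) \<longlonglongrightarrow> ?d"
  proof (rule real_tendsto_sandwich[where f = "\<lambda>_. ?d" and h = "\<lambda>n. ?d + inverse (real (Suc n))"])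
    show "(\<lambda>n. ?d + inverse (real (Suc n))) \<longlonglongrightarrow> ?d"
      using tendsto_add[OF tendsto_const LIMSEQ_inverse_real_of_nat, of ?d] by simp
    show "\<forall>\<^sub>F n in sequentially. ?d \<le> norm (x - f n)"
      by (intro always_eventually allI low fK)
    show "\<forall>\<^sub>F n in sequentially. norm (x - f n) \<le> ?d + inverse (real (Suc n))"
      by (intro always_eventually allI less_imp_le f)
  qed (rule tendsto_const)
  have par: "(norm (f m - f n))\<^sup>2 \<le> 2 * (norm (x - f m))\<^sup>2 + 2 * (norm (x - f n))\<^sup>2 - 4 * ?d\<^sup>2" for m n
  proof -
    have mid: "(1/2) *\<^sub>C (f m + f n) \<in> K"
      using fK K(2) by (simp add: complex_vector.subspace_def)
    have "(x - f m) + (x - f n) = 2 *\<^sub>C (x - (1/2) *\<^sub>C (f m + f n))"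
      using scaleC_add_left[of 1 1 x]
      by (simp add: complex_vector.scale_right_diff_distrib scaleC_scaleC scaleC_one)
    then have "norm ((x - f m) + (x - f n)) = 2 * norm (x - (1/2) *\<^sub>C (f m + f n))"
      by (simp add: norm_scaleC)
    then have "norm ((x - f m) + (x - f n)) \<ge> 2 * ?d" using low[OF mid] by simp
    then have "(norm ((x - f m) + (x - f n)))\<^sup>2 \<ge> (2 * ?d)\<^sup>2"
      by (rule power_mono) (simp add: infdist_nonneg)
    moreover have "norm ((x - f m) - (x - f n)) = norm (f m - f n)"
      by (simp add: norm_minus_commute)
    ultimately show ?thesis
      using parallelogram_law[of "x - f m" "x - f n"] by (simp add: power_mult_distrib)
  qed
  have "Cauchy f"
    unfolding Cauchy_def
  proof (intro allI impI)
    fix e :: real assume e: "e > 0"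
    have "(\<lambda>n. (norm (x - f n))\<^sup>2) \<longlonglongrightarrow> ?d\<^sup>2" by (intro tendsto_intros lim)
    moreover have "?d\<^sup>2 < ?d\<^sup>2 + e\<^sup>2 / 4" using e by simp
    ultimately have "eventually (\<lambda>n. (norm (x - f n))\<^sup>2 < ?d\<^sup>2 + e\<^sup>2 / 4) sequentially"
      by (metis order_tendstoD(2))
    then obtain N where N: "\<And>n. n \<ge> N \<Longrightarrow> (norm (x - f n))\<^sup>2 < ?d\<^sup>2 + e\<^sup>2 / 4"
      by (auto simp: eventually_sequentially)
    have "dist (f m) (f n) < e" if "m \<ge> N" "n \<ge> N" for m n
    proof -
      have "(norm (f m - f n))\<^sup>2 < e\<^sup>2" using par[of m n] N[OF that(1)] N[OF that(2)] by simp
      then show ?thesis using e by (simp add: dist_norm power_less_imp_less_base)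
    qed
    then show "\<exists>M. \<forall>m\<ge>M. \<forall>n\<ge>M. dist (f m) (f n) < e" by blast
  qed
  then obtain p where p: "f \<longlonglongrightarrow> p" using Cauchy_convergent convergent_def by blast
  have pK: "p \<in> K" using K(1) p fK closed_sequentially by blast
  have np: "norm (x - p) = ?d"
    by (rule LIMSEQ_unique[OF _ lim]) (intro tendsto_intros p)
  have "cinner k (x - p) = 0" if k: "k \<in> K" for k
  proof (cases "k = 0")
    case False
    let ?t = "cinner k (x - p) / complex_of_real ((norm k)\<^sup>2)"
    have "p + ?t *\<^sub>C k \<in> K" using K(2) pK k by (simp add: complex_vector.subspace_def)
    then have "?d \<le> norm (x - (p + ?t *\<^sub>C k))" by (rule low)
    then have "norm (x - p) \<le> norm ((x - p) - ?t *\<^sub>C k)"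
      unfolding np diff_diff_eq .
    then have "(norm (x - p))\<^sup>2 \<le> (norm ((x - p) - ?t *\<^sub>C k))\<^sup>2"
      by (rule power_mono) simp
    then have "(cmod (cinner k (x - p)))\<^sup>2 / (norm k)\<^sup>2 \<le> 0"
      unfolding norm_diff_scaleC_power2 by simp
    then show ?thesis using False by (simp add: divide_le_0_iff power2_less_eq_zero_iff)
  qed simp
  then show ?thesis using pK by blast
qed

lemma subspace_closure:
  fixes K :: "'h::complex_hilbert_space set"
  assumes "complex_vector.subspace K"
  shows "complex_vector.subspace (closure K)"
  unfolding complex_vector.subspace_def
proof (intro conjI ballI allI)
  show "0 \<in> closure K" using assms closure_subset complex_vector.subspace_0 by blast
next
  fix x y assume "x \<in> closure K" "y \<in> closure K"
  then obtain f g where "\<And>n. f n \<in> K" "f \<longlonglongrightarrow> x" "\<And>n. g n \<in> K" "g \<longlonglongrightarrow> y"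
    unfolding closure_sequential by blast
  then show "x + y \<in> closure K"
    unfolding closure_sequential using assms
    by (intro exI[of _ "\<lambda>n. f n + g n"]) (auto intro: tendsto_add complex_vector.subspace_add)
next
  fix c x assume "x \<in> closure K"
  then obtain f where f: "\<And>n. f n \<in> K" "f \<longlonglongrightarrow> x" unfolding closure_sequential by blast
  have "bounded_linear ((*\<^sub>C) c :: 'h \<Rightarrow> 'h)"
    by (rule bounded_linear_intro[where K = "cmod c"])
      (simp_all add: scaleC_add_right scaleR_eq_scaleC norm_scaleC scaleC_scaleC mult.commute)
  then have "(\<lambda>n. c *\<^sub>C f n) \<longlonglongrightarrow> c *\<^sub>C x" using f(2) by (rule bounded_linear.tendsto)
  then show "c *\<^sub>C x \<in> closure K"
    unfolding closure_sequential using assms f(1)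
    by (intro exI[of _ "\<lambda>n. c *\<^sub>C f n"]) (auto intro: complex_vector.subspace_scale)
qed

text \<open>Let w be the part orthogonal to the kernel of a vector outside it. Then x - (f x / f w)
  w lies in the kernel, so pairing x with w determines f x.\<close>

lemma Riesz_representation:
  fixes f :: "'h::complex_hilbert_space \<Rightarrow> complex"
  assumes f: "clinear f" and b: "\<And>x. cmod (f x) \<le> C * norm x"
  shows "\<exists>z. \<forall>x. f x = cinner z x"
proof (cases "\<forall>x. f x = 0")
  case True then show ?thesis by (intro exI[of _ 0]) simp
next
  case False
  then obtain x0 where x0: "f x0 \<noteq> 0" by blast
  have add: "f (x + y) = f x + f y" and sc: "f (c *\<^sub>C x) = c * f x" for x y c
    using f unfolding clinear_iff by (simp_all add: scaleC_complex_def)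
  have diff: "f (x - y) = f x - f y" for x y
    using add[of "x - y" y] by simp
  have "bounded_linear f"
    by (rule bounded_linear_intro[where K = C])
      (simp_all add: add sc scaleR_eq_scaleC scaleR_conv_of_real b mult.commute)
  then have cont: "continuous_on UNIV f"
    by (simp add: linear_continuous_on)
  let ?K = "{x. f x = 0}"
  have "closed ?K" using cont by (intro closed_Collect_eq continuous_intros) auto
  moreover have "complex_vector.subspace ?K"
    using sc[of 0 0] by (auto simp: complex_vector.subspace_def add sc)
  ultimately obtain p where p: "f p = 0" "\<And>k. f k = 0 \<Longrightarrow> cinner k (x0 - p) = 0"
    using orthogonal_projection_exists[of ?K x0] by auto
  define w where "w = x0 - p"
  have fw: "f w \<noteq> 0" using x0 p(1) by (simp add: w_def diff)
  have w0: "w \<noteq> 0" using fw sc[of 0 0] by auto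
  have orth: "cinner w k = 0" if "f k = 0" for k
    using p(2)[OF that] cinner_commute[of w k] by (simp add: w_def)
  have "f x = cinner ((cnj (f w) / of_real ((norm w)\<^sup>2)) *\<^sub>C w) x" for x
  proof -
    have "f (x - (f x / f w) *\<^sub>C w) = 0" using fw by (simp add: diff sc)
    from orth[OF this] have "cinner w x = (f x / f w) * of_real ((norm w)\<^sup>2)"
      by (simp add: cinner_diff_right cinner_scaleC_right cinner_self)
    then show ?thesis using w0 fw by (simp add: cinner_scaleC_left)
  qed
  then show ?thesis by blast
qed

section \<open>Bounded operators, adjoints and orthogonal series\<close>

lemma apply_op_clinear: "clinear (apply_op T)"
  using apply_op[of T] by simp

lemma apply_op_add_right: "apply_op T (x + y) = apply_op T x + apply_op T y"
  using apply_op_clinear[of T] by (simp add: clinear_iff)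

lemma apply_op_scaleC_right: "apply_op T (c *\<^sub>C x) = c *\<^sub>C apply_op T x"
  using apply_op_clinear[of T] by (simp add: clinear_iff)

lemma apply_op_zero_right [simp]: "apply_op T 0 = 0"
  using apply_op_add_right[of T 0 0] by simp

lemma apply_op_diff_right: "apply_op T (x - y) = apply_op T x - apply_op T y"
  using apply_op_add_right[of T "x - y" y] by simp

lemma apply_op_bounded:
  obtains K where "K \<ge> 0" "\<And>x. norm (apply_op T x) \<le> K * norm x"
proof -
  obtain K where K: "\<And>x. norm (apply_op T x) \<le> K * norm x"
    using apply_op[of T] by auto
  have "norm (apply_op T x) \<le> \<bar>K\<bar> * norm x" for x
    using K[of x] by (meson abs_ge_self mult_right_mono norm_ge_zero order_trans)
  then show ?thesis using that[of "\<bar>K\<bar>"] by simp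
qed

lemma bounded_linear_apply_op: "bounded_linear (apply_op T)"
proof -
  obtain K where "\<And>x. norm (apply_op T x) \<le> K * norm x" using apply_op_bounded by blast
  then show ?thesis
    by (intro bounded_linear_intro[where K = K])
      (simp_all add: apply_op_add_right scaleR_eq_scaleC apply_op_scaleC_right mult.commute)
qed

lemmas tendsto_apply_op = bounded_linear.tendsto[OF bounded_linear_apply_op]

lemma bop_eqI: "(\<And>x. apply_op S x = apply_op T x) \<Longrightarrow> S = T"
  by (metis apply_op_inject ext)

lemma apply_op_Bop:
  assumes "clinear f" "\<And>x. norm (f x) \<le> K * norm x"
  shows "apply_op (Bop f) = f"
  using assms by (intro Bop_inverse) auto

lemma apply_op_diff_left: "apply_op (S - T) x = apply_op S x - apply_op T x"
  by (simp only: minus_bop_def plus_bop.rep_eq uminus_bop.rep_eq diff_conv_add_uminus)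

text \<open>Riesz representation of y \<mapsto> <x, T y>. The type of operators carries no star, so
  adjoints are used through their existence.\<close>

lemma adjoint_exists: "\<exists>S. \<forall>x y. cinner (apply_op S x) y = cinner x (apply_op T y)"
proof -
  obtain K where K0: "K \<ge> 0" and K: "\<And>x. norm (apply_op T x) \<le> K * norm x" using apply_op_bounded by blast
  have "\<exists>z. \<forall>y. cinner x (apply_op T y) = cinner z y" for x
  proof (rule Riesz_representation)
    show "clinear (\<lambda>y. cinner x (apply_op T y))"
      unfolding clinear_iff by (simp add: apply_op_add_right apply_op_scaleC_right cinner_add_right
          cinner_scaleC_right scaleC_complex_def)
    show "cmod (cinner x (apply_op T y)) \<le> (norm x * K) * norm y" for y
    proof -
      have "cmod (cinner x (apply_op T y)) \<le> norm x * norm (apply_op T y)"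
        by (rule Cauchy_Schwarz_cinner)
      also have "\<dots> \<le> norm x * (K * norm y)" by (intro mult_left_mono K) simp
      finally show ?thesis by (simp add: mult.assoc)
    qed
  qed
  then obtain g where g: "\<And>x y. cinner (g x) y = cinner x (apply_op T y)" by metis
  have eqI: "u = v" if "\<And>y. cinner u y = cinner v y" for u v :: 'a
  proof -
    have "cinner (u - v) (u - v) = 0" using that by (simp only: cinner_diff_left) simp
    then show ?thesis by (simp add: cinner_self)
  qed
  have "clinear g"
    unfolding clinear_iff
    by (auto intro!: eqI simp: g cinner_add_left cinner_scaleC_left)
  moreover have "norm (g x) \<le> K * norm x" for x
  proof (cases "g x = 0")
    case False
    have "(norm (g x))\<^sup>2 = cmod (cinner (g x) (g x))" by (simp only: cinner_self norm_of_real) simp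
    also have "\<dots> = cmod (cinner x (apply_op T (g x)))" by (simp add: g)
    also have "\<dots> \<le> norm x * (K * norm (g x))"
      by (rule order_trans[OF Cauchy_Schwarz_cinner]) (intro mult_left_mono K, simp)
    finally have "norm (g x) * norm (g x) \<le> (K * norm x) * norm (g x)"
      by (simp add: power2_eq_square algebra_simps)
    then show ?thesis using False by simp
  qed (simp add: K0)
  ultimately have "apply_op (Bop g) = g" by (rule apply_op_Bop)
  then show ?thesis using g by metis
qed

lemma norm_sum_orthogonal:
  fixes f :: "'i \<Rightarrow> 'h::complex_hilbert_space"
  assumes "finite A" "\<And>i j. i \<in> A \<Longrightarrow> j \<in> A \<Longrightarrow> i \<noteq> j \<Longrightarrow> cinner (f i) (f j) = 0"
  shows "(norm (\<Sum>i\<in>A. f i))\<^sup>2 = (\<Sum>i\<in>A. (norm (f i))\<^sup>2)"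
proof -
  have "cinner (\<Sum>i\<in>A. f i) (\<Sum>i\<in>A. f i) = (\<Sum>i\<in>A. \<Sum>j\<in>A. cinner (f i) (f j))"
    by (subst cinner_sum_left) (simp only: cinner_sum_right)
  also have "\<dots> = (\<Sum>i\<in>A. \<Sum>j\<in>A. if i = j then cinner (f i) (f i) else 0)"
    by (intro sum.cong) (auto simp: assms(2))
  also have "\<dots> = (\<Sum>i\<in>A. cinner (f i) (f i))" using assms(1) by simp
  finally have "complex_of_real ((norm (\<Sum>i\<in>A. f i))\<^sup>2) = complex_of_real (\<Sum>i\<in>A. (norm (f i))\<^sup>2)"
    by (simp add: cinner_self)
  then show ?thesis by (simp only: of_real_eq_iff)
qed

lemma summable_orthogonal:
  fixes f :: "nat \<Rightarrow> 'h::complex_hilbert_space"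
  assumes o: "\<And>i j. i \<noteq> j \<Longrightarrow> cinner (f i) (f j) = 0" and s: "summable (\<lambda>i. (norm (f i))\<^sup>2)"
  shows "summable f"
  unfolding summable_Cauchy
proof (intro allI impI)
  fix e :: real assume e: "e > 0"
  then have "e\<^sup>2 > 0" by simp
  then obtain N where N: "\<And>m n. m \<ge> N \<Longrightarrow> norm (\<Sum>i\<in>{m..<n}. (norm (f i))\<^sup>2) < e\<^sup>2"
    using s unfolding summable_Cauchy by blast
  have "norm (sum f {m..<n}) < e" if "m \<ge> N" for m n
  proof -
    have "(norm (sum f {m..<n}))\<^sup>2 < e\<^sup>2"
      using N[OF that, of n] by (simp add: norm_sum_orthogonal o sum_nonneg)
    then show ?thesis using e by (simp add: power_less_imp_less_base)
  qed
  then show "\<exists>N. \<forall>m\<ge>N. \<forall>n. norm (sum f {m..<n}) < e" by blast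
qed

section \<open>The direct sum of two Hilbert spaces, in which operator graphs live\<close>

instantiation prod :: (complex_vector, complex_vector) complex_vector
begin
definition scaleC_prod :: "complex \<Rightarrow> 'a \<times> 'b \<Rightarrow> 'a \<times> 'b"
  where "scaleC_prod c x = (c *\<^sub>C fst x, c *\<^sub>C snd x)"
instance
  by standard (simp_all add: scaleC_prod_def scaleC_add_right scaleC_add_left scaleC_scaleC scaleC_one)
end

instantiation prod :: (complex_hilbert_space, complex_hilbert_space) complex_hilbert_space
begin
definition cinner_prod :: "'a \<times> 'b \<Rightarrow> 'a \<times> 'b \<Rightarrow> complex"
  where "cinner_prod x y = cinner (fst x) (fst y) + cinner (snd x) (snd y)"
instance
proof
  fix x y z :: "'a \<times> 'b" and c r
  show "r *\<^sub>R x = complex_of_real r *\<^sub>C x"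
    by (simp add: scaleC_prod_def prod_eq_iff scaleR_eq_scaleC)
  show "cinner x y = cnj (cinner y x)"
    unfolding cinner_prod_def by (metis cinner_commute complex_cnj_add)
  show "cinner x (y + z) = cinner x y + cinner x z"
    by (simp add: cinner_prod_def cinner_add_right)
  show "cinner x (c *\<^sub>C y) = c * cinner x y"
    by (simp add: cinner_prod_def scaleC_prod_def cinner_scaleC_right distrib_left)
  show "0 \<le> Re (cinner x x)" by (simp add: cinner_prod_def cinner_nonneg)
  show "norm x = sqrt (Re (cinner x x))"
    by (simp add: cinner_prod_def norm_prod_def norm_power2_cinner)
qed
end

section \<open>Jones--Wenzl projections and irreducible coefficients\<close>

locale large_Ao =
  fixes T :: "'n::finite itself" and N :: real
  assumes card: "3 \<le> CARD('n)" and N_eq: "N = real CARD('n)"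
begin

text \<open>\<open>d k\<close> is the dimension of the \<open>k\<close>-th irreducible corepresentation and
  \<open>s k = d (k - 1) / d k\<close>, with \<open>d (- 1) = 0\<close>.\<close>

primrec s :: "nat \<Rightarrow> real" where "s 0 = 0" | "s (Suc k) = 1 / (N - s k)"

primrec d :: "nat \<Rightarrow> real" where "d 0 = 1" | "d (Suc k) = d k * (N - s k)"

lemma N_ge: "N \<ge> 3" using card by (simp add: N_eq)

lemma of_real_N: "complex_of_real N = of_nat CARD('n)" by (simp add: N_eq)

text \<open>The bound 1/2 reproduces itself because N - 1/2 \<ge> 2. This is where n \<ge> 3 enters,
  and it makes \<open>d\<close> at least double at every step.\<close>

lemma s_bounds: "0 \<le> s k" "s k \<le> 1/2"
proof -
  have "0 \<le> s k \<and> s k \<le> 1/2"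
  proof (induction k)
    case (Suc k)
    then have "N - s k \<ge> 2" using N_ge by linarith
    then show ?case by (simp add: field_simps)
  qed simp
  then show "0 \<le> s k" "s k \<le> 1/2" by auto
qed

lemma N_minus_s: "N - s k \<ge> 2" using N_ge s_bounds[of k] by linarith

lemma s_Suc_pos: "s (Suc k) > 0" using N_minus_s[of k] by simp

lemma s_Suc_mult: "s (Suc k) * (N - s k) = 1" using N_minus_s[of k] by simp

lemma d_pos: "d k > 0"
  by (induction k) (use N_minus_s in \<open>auto intro!: mult_pos_pos simp del: diff_gt_0_iff_gt simp: less_le_trans[of 0 2]\<close>)

lemma d_Suc_ge: "d (Suc k) \<ge> 2 * d k"
  using mult_left_mono[OF N_minus_s[of k] less_imp_le[OF d_pos[of k]]] by (simp add: mult.commute)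

lemma s_Suc_eq: "s (Suc k) = d k / d (Suc k)"
  using d_pos[of k] by simp

declare s.simps(2) [simp del] d.simps(2) [simp del]

definition idx :: "nat \<Rightarrow> 'n list set" where "idx k = {i. length i = k}"

text \<open>The lists of length \<open>k - 1\<close>; there are none for \<open>k = 0\<close>.\<close>

definition idxp :: "nat \<Rightarrow> 'n list set" where "idxp k = {i. Suc (length i) = k}"

lemma finite_idx [simp]: "finite (idx k)"
  using finite_lists_length_eq[of "UNIV :: 'n set" k] by (simp add: idx_def)

lemma idxp_0 [simp]: "idxp 0 = {}" and idxp_Suc [simp]: "idxp (Suc k) = idx k"
  by (auto simp: idxp_def idx_def)

lemma finite_idxp [simp]: "finite (idxp k)" by (cases k) auto

lemma idx_0 [simp]: "idx 0 = {[]}" by (auto simp: idx_def)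

lemma Cons_idx [simp]: "a # i \<in> idx (Suc k) \<longleftrightarrow> i \<in> idx k" by (simp add: idx_def)

lemma idx_SucE: assumes "i \<in> idx (Suc k)" obtains a i' where "i = a # i'" "i' \<in> idx k"
  using assms by (cases i) (auto simp: idx_def)

lemma sum_idx_Suc: "(\<Sum>i\<in>idx (Suc k). f i) = (\<Sum>a\<in>UNIV. \<Sum>i\<in>idx k. f (a # i))"
proof -
  have "idx (Suc k) = (\<lambda>(a, i). a # i) ` (UNIV \<times> idx k)"
    by (auto simp: idx_def image_iff length_Suc_conv)
  then have "(\<Sum>i\<in>idx (Suc k). f i) = (\<Sum>(a, i)\<in>UNIV \<times> idx k. f (a # i))"
    by (simp add: sum.reindex inj_on_def case_prod_unfold)
  then show ?thesis by (simp add: sum.cartesian_product)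
qed

text \<open>The Jones--Wenzl projection on \<open>(\<complex>\<^sup>n)\<^sup>\<otimes>\<^sup>k\<close>, by Wenzl's recursion.\<close>

fun jw :: "nat \<Rightarrow> 'n list \<Rightarrow> 'n list \<Rightarrow> complex" where
  "jw 0 i j = of_bool (i = [] \<and> j = [])"
| "jw (Suc k) (a # i) (b # j) = of_bool (a = b) * jw k i j
     - of_real (s k) * (\<Sum>m\<in>idxp k. jw k i (a # m) * jw k (b # m) j)"
| "jw (Suc k) _ _ = 0"

lemma jw_outside: "i \<notin> idx k \<or> j \<notin> idx k \<Longrightarrow> jw k i j = 0"
proof (induction k arbitrary: i j)
  case (Suc k)
  show ?case
  proof (cases i)
    case (Cons a i')
    show ?thesis
    proof (cases j)
      case Cons': (Cons b j')
      show ?thesis using Suc by (auto simp: Cons Cons')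
    qed (simp add: Cons)
  qed simp
qed simp

lemma jw_sym: "jw k i j = jw k j i"
proof (induction k arbitrary: i j)
  case (Suc k)
  show ?case
  proof (cases i)
    case (Cons a i')
    show ?thesis
    proof (cases j)
      case Cons': (Cons b j')
      have "(\<Sum>m\<in>idxp k. jw k i' (a # m) * jw k (b # m) j') = (\<Sum>m\<in>idxp k. jw k j' (b # m) * jw k (a # m) i')"
        by (rule sum.cong[OF refl]) (metis Suc mult.commute)
      then show ?thesis using Suc[of i' j'] by (simp add: Cons Cons' eq_commute[of a b])
    qed (simp add: Cons)
  next
    case Nil then show ?thesis by (cases j) auto
  qed
qed auto

lemma cnj_jw [simp]: "cnj (jw k i j) = jw k i j"
  by (induction k i j rule: jw.induct) simp_all

text \<open>Splitting off the first letter fails at k = 0, where the left sum is empty and the right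
  one is not. The factor \<open>s 0 = 0\<close> repairs this and avoids case distinctions
  later.\<close>

lemma sum_idxp: "of_real (s k) * (\<Sum>a\<in>UNIV. \<Sum>m\<in>idxp k. f (a # m)) = of_real (s k) * (\<Sum>l\<in>idx k. f l :: complex)"
  by (cases k) (simp_all add: sum_idx_Suc)

text \<open>Idempotency of p_k = \<open>jw k\<close> is named so that absorption, partial trace and
  cap can be derived from it at lower levels inside one strong induction.\<close>

definition idem :: "nat \<Rightarrow> bool" where
  "idem k \<longleftrightarrow> (\<forall>i j. (\<Sum>l\<in>idx k. jw k i l * jw k l j) = jw k i j)"

lemma idemD: "idem k \<Longrightarrow> (\<Sum>l\<in>idx k. jw k i l * jw k l j) = jw k i j"
  by (simp add: idem_def)

text \<open>This is p_{k+1} (1 \<otimes> p_k) = p_{k+1}: both terms of Wenzl's recursion end in p_k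
  on the trailing letters, and p_k is idempotent.\<close>

lemma jw_sub_aux:
  assumes "idem k"
  shows "(\<Sum>l\<in>idx k. jw (Suc k) x (b # l) * jw k l j) = jw (Suc k) x (b # j)"
proof (cases x)
  case (Cons a i)
  have "(\<Sum>l\<in>idx k. jw (Suc k) x (b # l) * jw k l j) =
      of_bool (a = b) * (\<Sum>l\<in>idx k. jw k i l * jw k l j)
      - (\<Sum>l\<in>idx k. \<Sum>m\<in>idxp k. of_real (s k) * jw k i (a # m) * (jw k (b # m) l * jw k l j))"
    by (simp add: Cons left_diff_distrib sum_subtractf sum_distrib_left sum_distrib_right mult.assoc)
  also have "(\<Sum>l\<in>idx k. \<Sum>m\<in>idxp k. of_real (s k) * jw k i (a # m) * (jw k (b # m) l * jw k l j))
     = (\<Sum>m\<in>idxp k. of_real (s k) * jw k i (a # m) * (\<Sum>l\<in>idx k. jw k (b # m) l * jw k l j))"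
    by (subst sum.swap) (simp add: sum_distrib_left)
  finally show ?thesis by (simp add: Cons idemD[OF assms] sum_distrib_left mult.assoc)
qed simp

text \<open>The identity term contributes N; in the correction term the traced letter joins the two
  factors p_k into p_k p_k. The resulting factor is the quotient of successive dimensions.\<close>

lemma jw_ptrace_aux:
  assumes "idem k"
  shows "(\<Sum>a\<in>UNIV. jw (Suc k) (a # i) (a # j)) = of_real (N - s k) * jw k i j"
proof -
  have "(\<Sum>a\<in>UNIV. jw (Suc k) (a # i) (a # j)) =
      of_real N * jw k i j - of_real (s k) * (\<Sum>a\<in>UNIV. \<Sum>m\<in>idxp k. jw k i (a # m) * jw k (a # m) j)"
    by (simp add: sum_subtractf sum_distrib_left of_real_N)
  also have "\<dots> = of_real N * jw k i j - of_real (s k) * jw k i j"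
    by (simp only: sum_idxp[of k "\<lambda>l. jw k i l * jw k l j"] idemD[OF assms])
  finally show ?thesis by (simp add: left_diff_distrib)
qed

text \<open>Contracting the first two letters produces p_{k+1} once from the identity term and s (k
  + 1) * (N - s k) times from the correction. The recursion for \<open>s\<close> is chosen to make
  this factor 1.\<close>

lemma jw_cap_aux:
  assumes "idem k" "idem (Suc k)"
  shows "(\<Sum>a\<in>UNIV. jw (Suc (Suc k)) x (a # a # m)) = 0"
proof (cases x)
  case (Cons b y)
  have "(\<Sum>a\<in>UNIV. jw (Suc (Suc k)) x (a # a # m)) =
     (\<Sum>a\<in>UNIV. of_bool (b = a) * jw (Suc k) y (a # m))
     - of_real (s (Suc k)) * (\<Sum>a\<in>UNIV. \<Sum>m'\<in>idx k. jw (Suc k) y (b # m') * jw (Suc k) (a # m') (a # m))"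
    by (simp add: Cons sum_subtractf sum_distrib_left del: jw.simps(2) add: jw.simps(2)[of "Suc k"])
  also have "(\<Sum>a\<in>UNIV. \<Sum>m'\<in>idx k. jw (Suc k) y (b # m') * jw (Suc k) (a # m') (a # m)) =
      of_real (N - s k) * (\<Sum>m'\<in>idx k. jw (Suc k) y (b # m') * jw k m' m)"
    by (subst sum.swap)
      (simp only: sum_distrib_left[symmetric] jw_ptrace_aux[OF assms(1)],
        simp add: sum_distrib_left mult_ac)
  also have "(\<Sum>m'\<in>idx k. jw (Suc k) y (b # m') * jw k m' m) = jw (Suc k) y (b # m)"
    by (rule jw_sub_aux[OF assms(1)])
  also have "(\<Sum>a\<in>UNIV. of_bool (b = a) * jw (Suc k) y (a # m)) = (\<Sum>a\<in>UNIV. if b = a then jw (Suc k) y (a # m) else 0)"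
    by (rule sum.cong) auto
  also have "\<dots> = jw (Suc k) y (b # m)" by simp
  also have "of_real (s (Suc k)) * (of_real (N - s k) * jw (Suc k) y (b # m)) = jw (Suc k) y (b # m)"
    by (simp only: mult.assoc[symmetric] of_real_mult[symmetric] s_Suc_mult) simp
  finally show ?thesis by simp
qed simp

text \<open>Multiply p_{k+1} by the recursion for the second factor. Absorption turns the identity
  term into p_{k+1}, and in the correction term it leaves p_{k+1} contracted with a cap, which is
  0.\<close>

lemma idem: "idem k"
proof (induction k rule: less_induct)
  case (less k)
  show ?case
  proof (cases k)
    case 0 then show ?thesis by (simp add: idem_def)
  next
    case (Suc k')
    have "(\<Sum>l\<in>idx k. jw k x l * jw k l j) = jw k x j" for x j
    proof (cases j)
      case (Cons b j')
      have "(\<Sum>l\<in>idx k. jw k x l * jw k l j) =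
         (\<Sum>a\<in>UNIV. of_bool (a = b) * (\<Sum>l\<in>idx k'. jw k x (a # l) * jw k' l j'))
         - of_real (s k') * (\<Sum>a\<in>UNIV. \<Sum>l\<in>idx k'. \<Sum>m\<in>idxp k'. jw k x (a # l) * jw k' l (a # m) * jw k' (b # m) j')"
        unfolding Suc sum_idx_Suc
        by (simp add: Cons right_diff_distrib sum_subtractf sum_distrib_left sum_distrib_right mult_ac
            del: jw.simps(2) add: jw.simps(2)[of k' _ _ b j'])
      also have "(\<Sum>a\<in>UNIV. of_bool (a = b) * (\<Sum>l\<in>idx k'. jw k x (a # l) * jw k' l j')) =
          (\<Sum>a\<in>UNIV. if a = b then (\<Sum>l\<in>idx k'. jw k x (a # l) * jw k' l j') else 0)"
        by (rule sum.cong) auto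
      also have "\<dots> = jw k x (b # j')"
        unfolding Suc using jw_sub_aux[OF less[of k']] Suc by simp
      also have "of_real (s k') * (\<Sum>a\<in>UNIV. \<Sum>l\<in>idx k'. \<Sum>m\<in>idxp k'. jw k x (a # l) * jw k' l (a # m) * jw k' (b # m) j') = 0"
      proof (cases k')
        case S2: (Suc q)
        have "(\<Sum>a\<in>UNIV. \<Sum>l\<in>idx k'. \<Sum>m\<in>idxp k'. jw k x (a # l) * jw k' l (a # m) * jw k' (b # m) j')
            = (\<Sum>a\<in>UNIV. \<Sum>m\<in>idxp k'. (\<Sum>l\<in>idx k'. jw k x (a # l) * jw k' l (a # m)) * jw k' (b # m) j')"
          by (rule sum.cong[OF refl]) (subst sum.swap, simp add: sum_distrib_right)
        also have "\<dots> = (\<Sum>a\<in>UNIV. \<Sum>m\<in>idxp k'. jw k x (a # a # m) * jw k' (b # m) j')"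
          unfolding Suc using jw_sub_aux[OF less[of k']] Suc by simp
        also have "\<dots> = (\<Sum>m\<in>idxp k'. (\<Sum>a\<in>UNIV. jw k x (a # a # m)) * jw k' (b # m) j')"
          by (subst sum.swap) (simp add: sum_distrib_right)
        also have "\<dots> = 0"
        proof -
          have "idem q" "idem (Suc q)" using less Suc S2 by auto
          from jw_cap_aux[OF this] show ?thesis unfolding Suc S2 by (intro sum.neutral ballI) simp
        qed
        finally show ?thesis by simp
      qed simp
      finally show ?thesis by (simp add: Cons)
    qed (simp add: Suc jw_outside idx_def)
    then show ?thesis by (simp add: idem_def)
  qed
qed

lemmas jw_idem = idemD[OF idem]
lemmas jw_sub = jw_sub_aux[OF idem]
lemmas jw_ptrace = jw_ptrace_aux[OF idem]
lemmas jw_cap = jw_cap_aux[OF idem idem]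

lemma jw_sub': "(\<Sum>l\<in>idx k. jw k i l * jw (Suc k) (b # l) x) = jw (Suc k) (b # i) x"
  using jw_sub[where x = x and b = b and k = k and j = i] by (simp add: jw_sym[of k i] jw_sym[of "Suc k" _ x] mult.commute)

text \<open>Inserting X = p_{k+1} X reduces the claim to absorption of p_k by p_{k+1}. The index i
  is listed separately because it may lie outside \<open>idx k\<close>.\<close>

lemma jw_absorb:
  assumes "\<And>l. l \<in> insert i (idx k) \<Longrightarrow> (\<Sum>z\<in>idx (Suc k). jw (Suc k) (a # l) z * X z) = X (a # l)"
  shows "(\<Sum>l\<in>idx k. jw k i l * X (a # l)) = X (a # i)"
proof -
  have "(\<Sum>l\<in>idx k. jw k i l * X (a # l)) =
     (\<Sum>l\<in>idx k. \<Sum>z\<in>idx (Suc k). jw k i l * jw (Suc k) (a # l) z * X z)"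
    by (rule sum.cong[OF refl]) (simp add: assms[symmetric] sum_distrib_left mult.assoc del: jw.simps)
  also have "\<dots> = (\<Sum>z\<in>idx (Suc k). (\<Sum>l\<in>idx k. jw k i l * jw (Suc k) (a # l) z) * X z)"
    by (subst sum.swap) (simp add: sum_distrib_right del: jw.simps)
  also have "\<dots> = X (a # i)" by (simp only: jw_sub' assms insertI1)
  finally show ?thesis .
qed

lemma jw_cap': "(\<Sum>a\<in>UNIV. jw (Suc (Suc k)) (a # a # m) x) = 0"
  using jw_cap[of k x m] by (simp only: jw_sym[of _ x])

lemma jw_ptrace_s: "of_real (s (Suc k)) * (\<Sum>a\<in>UNIV. jw (Suc k) (a # i) (a # j)) = jw k i j"
  by (simp only: jw_ptrace mult.assoc[symmetric] of_real_mult[symmetric] s_Suc_mult) simp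

text \<open>Coefficients of the tensor powers of the fundamental corepresentation. A new letter is
  multiplied from the right, so the letters of the product come in reverse order.\<close>

fun U :: "'n list \<Rightarrow> 'n list \<Rightarrow> 'n Ao" where
  "U [] [] = 1"
| "U (a # i) (b # j) = U i j * u_gen a b"
| "U _ _ = 0"

lemma U_length: "length i \<noteq> length j \<Longrightarrow> U i j = 0"
  by (induction i j rule: U.induct) auto

definition v :: "nat \<Rightarrow> 'n list \<Rightarrow> 'n list \<Rightarrow> 'n Ao" where
  "v k i j = (\<Sum>l\<in>idx k. jw k i l *\<^sub>C U l j)"

lemma v_outside: "i \<notin> idx k \<or> j \<notin> idx k \<Longrightarrow> v k i j = 0"
  unfolding v_def by (intro sum.neutral ballI) (auto simp: jw_outside U_length idx_def)

text \<open>Wenzl's recursion carried over to coefficients. \<open>W\<close> is \<open>U\<close>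
  with either its row or its column fixed, so one statement serves projections applied from both
  sides.\<close>

lemma sum_jw_Suc:
  assumes W: "\<And>c l. W (c # l) = V l * (g c :: 'n Ao)"
  shows "(\<Sum>l\<in>idx (Suc k). jw (Suc k) (a # i) l *\<^sub>C W l) = (\<Sum>l\<in>idx k. jw k i l *\<^sub>C V l) * g a
   - of_real (s k) *\<^sub>C (\<Sum>m\<in>idxp k. jw k i (a # m) *\<^sub>C (\<Sum>c\<in>UNIV. (\<Sum>l\<in>idx k. jw k (c # m) l *\<^sub>C V l) * g c))"
proof -
  have "(\<Sum>l\<in>idx (Suc k). jw (Suc k) (a # i) l *\<^sub>C W l) =
      (\<Sum>c\<in>UNIV. \<Sum>l\<in>idx k. (of_bool (a = c) * jw k i l) *\<^sub>C (V l * g c))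
      - (\<Sum>c\<in>UNIV. \<Sum>l\<in>idx k. (of_real (s k) * (\<Sum>m\<in>idxp k. jw k i (a # m) * jw k (c # m) l)) *\<^sub>C (V l * g c))"
    unfolding sum_idx_Suc by (simp add: W complex_vector.scale_left_diff_distrib sum_subtractf)
  also have "(\<Sum>c\<in>UNIV. \<Sum>l\<in>idx k. (of_bool (a = c) * jw k i l) *\<^sub>C (V l * g c)) =
      (\<Sum>c\<in>UNIV. if a = c then \<Sum>l\<in>idx k. jw k i l *\<^sub>C (V l * g c) else 0)"
    by (rule sum.cong) auto
  also have "\<dots> = (\<Sum>l\<in>idx k. jw k i l *\<^sub>C V l) * g a"
    by (simp add: sum_distrib_right mult_scaleC_left)
  also have "(\<Sum>c\<in>UNIV. \<Sum>l\<in>idx k. (of_real (s k) * (\<Sum>m\<in>idxp k. jw k i (a # m) * jw k (c # m) l)) *\<^sub>C (V l * g c))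
     = (\<Sum>c\<in>UNIV. \<Sum>l\<in>idx k. \<Sum>m\<in>idxp k. of_real (s k) *\<^sub>C jw k i (a # m) *\<^sub>C jw k (c # m) l *\<^sub>C (V l * g c))"
    by (simp add: sum_distrib_left complex_vector.scale_sum_left scaleC_scaleC mult.assoc)
  also have "\<dots> = (\<Sum>c\<in>UNIV. \<Sum>m\<in>idxp k. \<Sum>l\<in>idx k. of_real (s k) *\<^sub>C jw k i (a # m) *\<^sub>C jw k (c # m) l *\<^sub>C (V l * g c))"
    by (rule sum.cong[OF refl], rule sum.swap)
  also have "\<dots> = (\<Sum>m\<in>idxp k. \<Sum>c\<in>UNIV. \<Sum>l\<in>idx k. of_real (s k) *\<^sub>C jw k i (a # m) *\<^sub>C jw k (c # m) l *\<^sub>C (V l * g c))"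
    by (rule sum.swap)
  also have "\<dots> = of_real (s k) *\<^sub>C (\<Sum>m\<in>idxp k. jw k i (a # m) *\<^sub>C (\<Sum>c\<in>UNIV. (\<Sum>l\<in>idx k. jw k (c # m) l *\<^sub>C V l) * g c))"
    by (simp add: complex_vector.scale_sum_right sum_distrib_right mult_scaleC_left)
  finally show ?thesis .
qed

text \<open>With U the matrix of the k-th tensor power, \<open>v\<close> is p_k U and
  \<open>w\<close> is U p_k. Their equality says that p_k intertwines the tensor power.\<close>

definition w :: "nat \<Rightarrow> 'n list \<Rightarrow> 'n list \<Rightarrow> 'n Ao" where
  "w k i j = (\<Sum>l\<in>idx k. jw k j l *\<^sub>C U i l)"

lemma v_Suc: "v (Suc k) (a # i) (b # j) = v k i j * u_gen a b
   - of_real (s k) *\<^sub>C (\<Sum>m\<in>idxp k. jw k i (a # m) *\<^sub>C (\<Sum>c\<in>UNIV. v k (c # m) j * u_gen c b))"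
  unfolding v_def by (rule sum_jw_Suc) simp

lemma w_Suc: "w (Suc k) (a # i) (b # j) = w k i j * u_gen a b
   - of_real (s k) *\<^sub>C (\<Sum>m\<in>idxp k. jw k j (b # m) *\<^sub>C (\<Sum>c\<in>UNIV. w k i (c # m) * u_gen a c))"
  unfolding w_def by (rule sum_jw_Suc) simp

text \<open>The first letter of an index belongs to the rightmost factor of \<open>U\<close>, so it
  is adjacent to the extra generator and orthogonality contracts the two.\<close>

lemma sum_orthogonal_cap:
  assumes W: "\<And>c e l. W c (e # l) = V l * g e c" and g: "\<And>e. (\<Sum>c\<in>UNIV. g e c * g b c) = (if e = b then 1 else 0 :: 'n Ao)"
  shows "(\<Sum>c\<in>UNIV. (\<Sum>l\<in>idx (Suc k). r l *\<^sub>C W c l) * g b c) = (\<Sum>l\<in>idx k. r (b # l) *\<^sub>C V l)"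
proof -
  have "(\<Sum>c\<in>UNIV. (\<Sum>l\<in>idx (Suc k). r l *\<^sub>C W c l) * g b c) =
     (\<Sum>c\<in>UNIV. \<Sum>e\<in>UNIV. \<Sum>l\<in>idx k. r (e # l) *\<^sub>C (V l * (g e c * g b c)))"
    by (simp add: W sum_idx_Suc sum_distrib_right mult_scaleC_left mult.assoc)
  also have "\<dots> = (\<Sum>e\<in>UNIV. \<Sum>l\<in>idx k. \<Sum>c\<in>UNIV. r (e # l) *\<^sub>C (V l * (g e c * g b c)))"
    by (subst sum.swap) (rule sum.cong[OF refl], rule sum.swap)
  also have "\<dots> = (\<Sum>e\<in>UNIV. \<Sum>l\<in>idx k. r (e # l) *\<^sub>C (V l * (\<Sum>c\<in>UNIV. g e c * g b c)))"
    by (simp add: complex_vector.scale_sum_right sum_distrib_left)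
  also have "\<dots> = (\<Sum>e\<in>UNIV. if e = b then \<Sum>l\<in>idx k. r (e # l) *\<^sub>C V l else 0)"
    by (rule sum.cong) (auto simp: g)
  finally show ?thesis by simp
qed

lemma w_cap:
  "(\<Sum>c\<in>UNIV. w (Suc k) (c # m) j * u_gen c b) = (\<Sum>l\<in>idx k. jw (Suc k) j (b # l) *\<^sub>C U m l)"
  unfolding w_def by (rule sum_orthogonal_cap) (simp_all add: u_orthogonal)

lemma v_cap:
  "(\<Sum>c\<in>UNIV. v (Suc k) i (c # m) * u_gen a c) = (\<Sum>l\<in>idx k. jw (Suc k) i (a # l) *\<^sub>C U l m)"
  unfolding v_def by (rule sum_orthogonal_cap) (simp_all add: u_orthogonal)

text \<open>The two recursions differ only in the correction term. By the induction hypothesis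
  \<open>v\<close> and \<open>w\<close> may be exchanged there, after which both corrections
  contract to the same double sum of p_k, U and p_k.\<close>

lemma v_eq_w: "i \<in> idx k \<Longrightarrow> j \<in> idx k \<Longrightarrow> v k i j = w k i j"
proof (induction k arbitrary: i j)
  case 0 then show ?case by (simp add: v_def w_def)
next
  case (Suc k)
  obtain a i' b j' where ij: "i = a # i'" "i' \<in> idx k" "j = b # j'" "j' \<in> idx k"
    using Suc.prems by (metis idx_SucE)
  show ?case
  proof (cases k)
    case 0 then show ?thesis using ij by (simp add: v_Suc w_Suc) (simp add: v_def w_def)
  next
    case k: (Suc q)
    have "(\<Sum>m\<in>idx q. jw k i' (a # m) *\<^sub>C (\<Sum>c\<in>UNIV. v k (c # m) j' * u_gen c b)) =
       (\<Sum>m\<in>idx q. jw k i' (a # m) *\<^sub>C (\<Sum>l\<in>idx q. jw k j' (b # l) *\<^sub>C U m l))"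
      using Suc.IH ij by (intro sum.cong refl arg_cong2[where f = scaleC]) (simp add: k w_cap[symmetric])
    also have "\<dots> = (\<Sum>m\<in>idx q. jw k j' (b # m) *\<^sub>C (\<Sum>l\<in>idx q. jw k i' (a # l) *\<^sub>C U l m))"
      by (simp only: complex_vector.scale_sum_right, subst sum.swap)
        (simp add: scaleC_scaleC mult.commute)
    also have "\<dots> = (\<Sum>m\<in>idx q. jw k j' (b # m) *\<^sub>C (\<Sum>c\<in>UNIV. w k i' (c # m) * u_gen a c))"
      using Suc.IH ij by (intro sum.cong refl arg_cong2[where f = scaleC]) (simp add: k v_cap[symmetric])
    finally show ?thesis using Suc.IH[OF ij(2,4)] by (simp add: ij(1,3) v_Suc w_Suc) (simp add: k)
  qed
qed

lemma v_alt: "i \<in> idx k \<Longrightarrow> v k i j = (\<Sum>l\<in>idx k. jw k l j *\<^sub>C U i l)"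
  using v_eq_w[of i k j] by (cases "j \<in> idx k") (auto simp: w_def v_outside jw_outside jw_sym[of k j])

lemma v_jw_left: "(\<Sum>l\<in>idx k. jw k i l *\<^sub>C v k l j) = v k i j"
proof -
  have "(\<Sum>l\<in>idx k. jw k i l *\<^sub>C v k l j) = (\<Sum>m\<in>idx k. (\<Sum>l\<in>idx k. jw k i l * jw k l m) *\<^sub>C U m j)"
    unfolding v_def by (simp only: complex_vector.scale_sum_right complex_vector.scale_sum_left scaleC_scaleC) (rule sum.swap)
  then show ?thesis by (simp add: jw_idem v_def)
qed

lemma v_jw_right: "(\<Sum>l\<in>idx k. jw k l j *\<^sub>C v k i l) = v k i j"
proof (cases "i \<in> idx k")
  case True
  have "(\<Sum>l\<in>idx k. jw k l j *\<^sub>C v k i l) = (\<Sum>m\<in>idx k. (\<Sum>l\<in>idx k. jw k m l * jw k l j) *\<^sub>C U i m)"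
    unfolding v_alt[OF True] by (simp only: complex_vector.scale_sum_right complex_vector.scale_sum_left scaleC_scaleC, subst sum.swap) (simp only: mult.commute)
  then show ?thesis by (simp add: jw_idem v_alt[OF True])
qed (simp add: v_outside)

text \<open>The fusion rule \<open>V\<^sub>k \<otimes> V\<^sub>1 = V\<^sub>k\<^sub>+\<^sub>1 \<oplus> V\<^sub>k\<^sub>-\<^sub>1\<close> in terms of coefficients.\<close>

lemma v_mult_u:
  assumes "j \<in> idx k"
  shows "v k i j * u_gen a b = v (Suc k) (a # i) (b # j)
    + of_real (s k) *\<^sub>C (\<Sum>m\<in>idxp k. \<Sum>m'\<in>idxp k. (jw k i (a # m) * jw k (b # m') j) *\<^sub>C v (k - 1) m m')"
proof (cases k)
  case 0 then show ?thesis by (simp add: v_Suc)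
next
  case (Suc q)
  have "(\<Sum>m\<in>idx q. jw k i (a # m) *\<^sub>C (\<Sum>c\<in>UNIV. v k (c # m) j * u_gen c b)) =
      (\<Sum>m\<in>idx q. \<Sum>m'\<in>idx q. (jw k i (a # m) * jw k (b # m') j) *\<^sub>C v q m m')"
  proof -
    have "(\<Sum>m\<in>idx q. jw k i (a # m) *\<^sub>C (\<Sum>c\<in>UNIV. v k (c # m) j * u_gen c b)) =
       (\<Sum>m\<in>idx q. jw k i (a # m) *\<^sub>C (\<Sum>l\<in>idx q. jw k (b # l) j *\<^sub>C U m l))"
      using assms by (intro sum.cong refl arg_cong2[where f = scaleC]) (simp add: Suc v_eq_w w_cap jw_sym[of "Suc q" j])
    \<comment> \<open>Absorption inserts p_q next to p_k; applied to \<open>U\<close> this p_q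
      produces \<open>v q\<close>.\<close>
    also have "\<dots> = (\<Sum>m\<in>idx q. \<Sum>l\<in>idx q. jw k (b # l) j *\<^sub>C (\<Sum>m'\<in>idx q. (jw k i (a # m') * jw q m' m) *\<^sub>C U m l))"
      by (simp add: Suc jw_sub complex_vector.scale_sum_left[symmetric])
        (simp add: complex_vector.scale_sum_right scaleC_scaleC mult.commute)
    also have "\<dots> = (\<Sum>l\<in>idx q. \<Sum>m'\<in>idx q. \<Sum>m\<in>idx q. jw k (b # l) j *\<^sub>C (jw k i (a # m') * jw q m' m) *\<^sub>C U m l)"
      unfolding complex_vector.scale_sum_right by (subst sum.swap, rule sum.cong[OF refl], rule sum.swap)
    also have "\<dots> = (\<Sum>m'\<in>idx q. \<Sum>l\<in>idx q. \<Sum>m\<in>idx q. jw k (b # l) j *\<^sub>C (jw k i (a # m') * jw q m' m) *\<^sub>C U m l)"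
      by (rule sum.swap)
    also have "\<dots> = (\<Sum>m\<in>idx q. \<Sum>m'\<in>idx q. (jw k i (a # m) * jw k (b # m') j) *\<^sub>C v q m m')"
      by (simp add: v_def complex_vector.scale_sum_right scaleC_scaleC mult_ac)
    finally show ?thesis .
  qed
  then show ?thesis by (simp add: v_Suc[of k]) (simp add: Suc)
qed

end

section \<open>A Fock space model\<close>

text \<open>Words are built by appending on the right, which matches \<open>U\<close> and the fusion
  rule.\<close>

lemma Ao_induct [case_names one mult add scale]:
  fixes x :: "'n::finite Ao"
  assumes one: "P 1" and mult: "\<And>x a b. P x \<Longrightarrow> P (x * u_gen a b)"
    and add: "\<And>x y. P x \<Longrightarrow> P y \<Longrightarrow> P (x + y)" and scale: "\<And>c x. P x \<Longrightarrow> P (c *\<^sub>C x)"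
  shows "P x"
proof -
  have word: "P (abs_Ao (Poly_Mapping.single (Word xs) 1))" for xs :: "('n \<times> 'n) list"
  proof (induction xs rule: rev_induct)
    case Nil
    then show ?case using one by (simp add: one_Ao_def zero_word_def[symmetric])
  next
    case (snoc y ys)
    have "Poly_Mapping.single (Word (ys @ [y])) 1 = Poly_Mapping.single (Word ys) 1 * (free_gen y :: ('n \<times> 'n) free_algebra)"
      by (simp add: mult_single plus_word_def)
    then have "abs_Ao (Poly_Mapping.single (Word (ys @ [y])) 1) =
        abs_Ao (Poly_Mapping.single (Word ys) 1) * u_gen (fst y) (snd y)"
      by (simp add: times_Ao.abs_eq u_gen.abs_eq)
    then show ?case using mult[OF snoc] by simp
  qed
  obtain f where x: "x = abs_Ao f" by (metis Quotient_abs_rep[OF Quotient_Ao])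
  have "P (abs_Ao f)"
  proof (induction f rule: free_induct)
    case (single q c)
    have "abs_Ao (Poly_Mapping.single q c) = c *\<^sub>C abs_Ao (Poly_Mapping.single (Word (letters q)) 1)"
      by (simp add: scaleC_Ao.abs_eq scaleC_single scaleC_complex_def)
    then show ?case using scale[OF word, of c "letters q"] by simp
  next
    case (add f g)
    then show ?case using assms(3) by (simp add: plus_Ao.abs_eq[symmetric])
  qed
  then show ?thesis by (simp add: x)
qed

context large_Ao begin

text \<open>The span of the \<open>v k i j\<close> contains 1 and is closed under right
  multiplication by generators, by the fusion rule; hence it is the whole algebra.\<close>

lemma v_induct [case_names v zero add scale]:
  assumes v: "\<And>k i j. i \<in> idx k \<Longrightarrow> j \<in> idx k \<Longrightarrow> P (v k i j)" and zero: "P 0"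
    and add: "\<And>x y. P x \<Longrightarrow> P y \<Longrightarrow> P (x + y)" and scale: "\<And>c x. P x \<Longrightarrow> P (c *\<^sub>C x)"
  shows "P x"
proof -
  let ?V = "{v k i j | k i j. i \<in> idx k \<and> j \<in> idx k}"
  have vV: "v k i j \<in> complex_vector.span ?V" for k i j
  proof (cases "i \<in> idx k \<and> j \<in> idx k")
    case True then show ?thesis by (blast intro: complex_vector.span_base)
  next
    case False then have "v k i j = 0" using v_outside by blast
    then show ?thesis by (simp add: complex_vector.span_zero)
  qed
  have "x \<in> complex_vector.span ?V"
  proof (induction x rule: Ao_induct)
    case one
    have "v 0 [] [] = 1" by (simp add: v_def scaleC_one)
    then show ?case using vV[of 0 "[]" "[]"] by simp
  next
    case (mult x a b)
    then show ?case
    proof (induction rule: complex_vector.span_induct)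
      case base
      show ?case
        by (auto simp: complex_vector.subspace_def distrib_right mult_scaleC_left
            complex_vector.span_add complex_vector.span_scale complex_vector.span_zero)
    next
      case (step x)
      then obtain k i j where "x = v k i j" "j \<in> idx k" by blast
      then show ?case
        by (auto simp: v_mult_u intro!: complex_vector.span_add complex_vector.span_scale
            complex_vector.span_sum vV)
    qed
  next
    case (add x y) then show ?case by (rule complex_vector.span_add)
  next
    case (scale c x) then show ?case by (rule complex_vector.span_scale)
  qed
  then show ?thesis
  proof (induction rule: complex_vector.span_induct_alt)
    case base show ?case by (rule zero)
  next
    case (step c x y)
    then show ?case using add scale v by blast
  qed
qed

text \<open>Functionals on \<open>\<Oplus>\<^sub>k V\<^sub>k \<otimes> V\<^sub>k\<close> are functions of two lists, on which
  \<open>act a b\<close> is the transpose of right multiplication by \<open>u_gen a b\<close> as given by the fusion rule.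
  It provides a functional on the algebra that separates \<open>1\<close> from all \<open>v k\<close> with \<open>k > 0\<close>.\<close>

definition act :: "'n \<Rightarrow> 'n \<Rightarrow> ('n list \<Rightarrow> 'n list \<Rightarrow> complex) \<Rightarrow> 'n list \<Rightarrow> 'n list \<Rightarrow> complex" where
  "act a b F i j = (let k = length i in F (a # i) (b # j)
     + of_real (s k) * (\<Sum>m\<in>idxp k. \<Sum>m'\<in>idxp k. jw k i (a # m) * jw k (b # m') j * F m m'))"

lemma act_idx: "i \<in> idx k \<Longrightarrow> act a b F i j = F (a # i) (b # j)
     + of_real (s k) * (\<Sum>m\<in>idxp k. \<Sum>m'\<in>idxp k. jw k i (a # m) * jw k (b # m') j * F m m')"
  by (simp add: act_def Let_def idx_def)

text \<open>The constraints satisfied by any family f (v k i j) with f linear: equal lengths, and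
  invariance under p_k on both sides. Conversely \<open>ev\<close> below realizes every such
  family.\<close>

definition valid :: "('n list \<Rightarrow> 'n list \<Rightarrow> complex) \<Rightarrow> bool" where
  "valid F \<longleftrightarrow> (\<forall>i j. length i \<noteq> length j \<longrightarrow> F i j = 0) \<and>
    (\<forall>k i j. i \<in> idx k \<longrightarrow> (\<Sum>l\<in>idx k. jw k i l * F l j) = F i j) \<and>
    (\<forall>k i j. j \<in> idx k \<longrightarrow> (\<Sum>l\<in>idx k. jw k l j * F i l) = F i j)"

lemma validD:
  assumes "valid F"
  shows "length i \<noteq> length j \<Longrightarrow> F i j = 0"
    "i \<in> idx k \<Longrightarrow> (\<Sum>l\<in>idx k. jw k i l * F l j) = F i j"
    "j \<in> idx k \<Longrightarrow> (\<Sum>l\<in>idx k. jw k l j * F i l) = F i j"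
  using assms by (auto simp: valid_def)

text \<open>Transposition turns \<open>act a b\<close> into \<open>act b a\<close>, so that
  statements about columns follow from those about rows.\<close>

definition tr :: "('n list \<Rightarrow> 'n list \<Rightarrow> complex) \<Rightarrow> 'n list \<Rightarrow> 'n list \<Rightarrow> complex" where
  "tr F i j = F j i"

lemma valid_tr: "valid F \<Longrightarrow> valid (tr F)"
  unfolding valid_def tr_def by (metis (no_types, lifting) jw_sym sum.cong)

lemma act_length: "valid F \<Longrightarrow> length i \<noteq> length j \<Longrightarrow> act a b F i j = 0"
  by (auto simp: act_def Let_def validD jw_outside[of _ _ j] idx_def)

lemma act_tr: "valid F \<Longrightarrow> act a b F = tr (act b a (tr F))"
proof (intro ext)
  fix i j assume F: "valid F"
  show "act a b F i j = tr (act b a (tr F)) i j"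
  proof (cases "length i = length j")
    case True
    define k where "k = length j"
    have "(\<Sum>m\<in>idxp k. \<Sum>m'\<in>idxp k. jw k i (a # m) * jw k (b # m') j * F m m')
       = (\<Sum>m\<in>idxp k. \<Sum>m'\<in>idxp k. jw k j (b # m) * jw k (a # m') i * F m' m)"
      by (subst sum.swap) (simp add: jw_sym[of k j] jw_sym[of k _ i] mult_ac)
    then show ?thesis using True by (simp add: act_def tr_def Let_def k_def)
  next
    case False
    then show ?thesis using act_length[OF F] act_length[OF valid_tr[OF F]] by (simp add: tr_def)
  qed
qed

lemma valid_act_left:
  assumes F: "valid F" and i: "i \<in> idx k"
  shows "(\<Sum>l\<in>idx k. jw k i l * act a b F l j) = act a b F i j"
proof -
  have 1: "(\<Sum>l\<in>idx k. jw k i l * F (a # l) (b # j)) = F (a # i) (b # j)"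
    using i by (intro jw_absorb validD(2)[OF F]) auto
  have 2: "(\<Sum>l\<in>idx k. jw k i l * (\<Sum>m\<in>idxp k. \<Sum>m'\<in>idxp k. jw k l (a # m) * jw k (b # m') j * F m m'))
    = (\<Sum>m\<in>idxp k. \<Sum>m'\<in>idxp k. jw k i (a # m) * jw k (b # m') j * F m m')"
  proof -
    have "(\<Sum>l\<in>idx k. jw k i l * (\<Sum>m\<in>idxp k. \<Sum>m'\<in>idxp k. jw k l (a # m) * jw k (b # m') j * F m m'))
      = (\<Sum>l\<in>idx k. \<Sum>m\<in>idxp k. (jw k i l * jw k l (a # m)) * (\<Sum>m'\<in>idxp k. jw k (b # m') j * F m m'))"
      by (simp add: sum_distrib_left mult.assoc)
    also have "\<dots> = (\<Sum>m\<in>idxp k. (\<Sum>l\<in>idx k. jw k i l * jw k l (a # m)) * (\<Sum>m'\<in>idxp k. jw k (b # m') j * F m m'))"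
      by (subst sum.swap) (simp add: sum_distrib_right)
    finally show ?thesis by (simp add: jw_idem sum_distrib_left mult.assoc)
  qed
  have "(\<Sum>l\<in>idx k. jw k i l * act a b F l j) = (\<Sum>l\<in>idx k. jw k i l * F (a # l) (b # j))
    + of_real (s k) * (\<Sum>l\<in>idx k. jw k i l * (\<Sum>m\<in>idxp k. \<Sum>m'\<in>idxp k. jw k l (a # m) * jw k (b # m') j * F m m'))"
    by (simp add: act_idx distrib_left sum.distrib sum_distrib_left mult_ac)
  then show ?thesis by (simp only: 1 2 act_idx[OF i])
qed

lemma valid_act: assumes "valid F" shows "valid (act a b F)"
proof -
  have r: "(\<Sum>l\<in>idx k. jw k l j * act a b F i l) = act a b F i j" if "j \<in> idx k" for k i j
    using valid_act_left[OF valid_tr[OF assms] that, of b a i]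
    by (simp add: act_tr[OF assms] tr_def jw_sym[of k _ j])
  show ?thesis
    unfolding valid_def using act_length[OF assms] valid_act_left[OF assms] r by auto
qed

text \<open>Each of the two actions moves one level up or down. Up-up (\<open>t1\<close>) and
  down-down (\<open>t4\<close>) vanish because caps kill p. In \<open>t2\<close> the partial trace
  leaves p_{k+1} applied to F; Wenzl's recursion splits it into the desired identity term and a term
  that cancels \<open>t3\<close>.\<close>

lemma act_orthogonal_row:
  assumes F: "valid F"
  shows "(\<Sum>b\<in>UNIV. act a b (act c b F) i j) = of_bool (a = c) * F i j"
proof (cases "length i = length j")
  case False
  then show ?thesis by (simp add: act_length[OF valid_act[OF F]] validD(1)[OF F])
next
  case True
  define k where "k = length j"
  have i: "i \<in> idx k" and j: "j \<in> idx k" using True by (auto simp: idx_def k_def)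
  have t1: "(\<Sum>b\<in>UNIV. F (c # a # i) (b # b # j)) = 0"
  proof -
    have "(\<Sum>b\<in>UNIV. F (c # a # i) (b # b # j)) =
       (\<Sum>b\<in>UNIV. \<Sum>l\<in>idx (Suc (Suc k)). jw (Suc (Suc k)) l (b # b # j) * F (c # a # i) l)"
      using j by (simp add: validD(3)[OF F])
    also have "\<dots> = (\<Sum>l\<in>idx (Suc (Suc k)). (\<Sum>b\<in>UNIV. jw (Suc (Suc k)) l (b # b # j)) * F (c # a # i) l)"
      by (subst sum.swap) (simp add: sum_distrib_right)
    finally show ?thesis by (simp add: jw_cap)
  qed
  have t2: "(\<Sum>b\<in>UNIV. of_real (s (Suc k)) * (\<Sum>m\<in>idx k. \<Sum>m'\<in>idx k.
        jw (Suc k) (a # i) (c # m) * jw (Suc k) (b # m') (b # j) * F m m'))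
     = (\<Sum>m\<in>idx k. jw (Suc k) (a # i) (c # m) * F m j)"
  proof -
    have "(\<Sum>b\<in>UNIV. of_real (s (Suc k)) * (\<Sum>m\<in>idx k. \<Sum>m'\<in>idx k.
        jw (Suc k) (a # i) (c # m) * jw (Suc k) (b # m') (b # j) * F m m'))
      = (\<Sum>m\<in>idx k. \<Sum>m'\<in>idx k. \<Sum>b\<in>UNIV. of_real (s (Suc k)) * (jw (Suc k) (a # i) (c # m) * jw (Suc k) (b # m') (b # j) * F m m'))"
      unfolding sum_distrib_left by (subst sum.swap, rule sum.cong[OF refl], rule sum.swap)
    also have "\<dots> = (\<Sum>m\<in>idx k. \<Sum>m'\<in>idx k. jw (Suc k) (a # i) (c # m) * F m m' *
         (of_real (s (Suc k)) * (\<Sum>b\<in>UNIV. jw (Suc k) (b # m') (b # j))))"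
      by (simp add: sum_distrib_left mult_ac del: jw.simps)
    also have "\<dots> = (\<Sum>m\<in>idx k. jw (Suc k) (a # i) (c # m) * (\<Sum>m'\<in>idx k. jw k m' j * F m m'))"
      by (simp only: jw_ptrace_s) (simp add: sum_distrib_left mult_ac del: jw.simps)
    finally show ?thesis using j by (simp add: validD(3)[OF F])
  qed
  have t3: "(\<Sum>b\<in>UNIV. of_real (s k) * (\<Sum>m\<in>idxp k. \<Sum>m'\<in>idxp k.
      jw k i (a # m) * jw k (b # m') j * F (c # m) (b # m')))
      = of_real (s k) * (\<Sum>m\<in>idxp k. jw k i (a # m) * F (c # m) j)"
  proof -
    have "(\<Sum>b\<in>UNIV. of_real (s k) * (\<Sum>m\<in>idxp k. \<Sum>m'\<in>idxp k.
        jw k i (a # m) * jw k (b # m') j * F (c # m) (b # m')))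
       = (\<Sum>m\<in>idxp k. jw k i (a # m) * (of_real (s k) * (\<Sum>b\<in>UNIV. \<Sum>m'\<in>idxp k. jw k (b # m') j * F (c # m) (b # m'))))"
      unfolding sum_distrib_left by (subst sum.swap) (simp add: mult_ac)
    also have "\<dots> = (\<Sum>m\<in>idxp k. jw k i (a # m) * (of_real (s k) * F (c # m) j))"
      by (simp only: sum_idxp[of k "\<lambda>l. jw k l j * F (c # _) l"] validD(3)[OF F j])
    finally show ?thesis by (simp add: sum_distrib_left mult_ac)
  qed
  have t4: "(\<Sum>b\<in>UNIV. \<Sum>m\<in>idxp k. \<Sum>m'\<in>idxp k. jw k i (a # m) * jw k (b # m') j *
      (\<Sum>r\<in>idxp (k - 1). \<Sum>r'\<in>idxp (k - 1). jw (k - 1) m (c # r) * jw (k - 1) (b # r') m' * F r r')) = 0"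
  proof (cases "k \<le> 1")
    case True
    \<comment> \<open>Truncated subtraction covers k = 0 as well; there is nothing below level
      0.\<close>
    then have "k - 1 = 0" by simp
    then show ?thesis by (simp only: idxp_0) simp
  next
    case False
    then obtain q where q: "k = Suc (Suc q)" by (metis One_nat_def Suc_le_eq gr0_implies_Suc le_0_eq not_less_eq_eq not0_implies_Suc)
    have "(\<Sum>b\<in>UNIV. \<Sum>m\<in>idxp k. \<Sum>m'\<in>idxp k. jw k i (a # m) * jw k (b # m') j *
      (\<Sum>r\<in>idxp (k - 1). \<Sum>r'\<in>idxp (k - 1). jw (k - 1) m (c # r) * jw (k - 1) (b # r') m' * F r r'))
      = (\<Sum>b\<in>UNIV. \<Sum>m\<in>idx (Suc q). \<Sum>m'\<in>idx (Suc q). \<Sum>r\<in>idx q. \<Sum>r'\<in>idx q.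
          (jw k i (a # m) * jw (Suc q) m (c # r) * F r r') * (jw (Suc q) (b # r') m' * jw k (b # m') j))"
      by (simp add: q sum_distrib_left mult_ac)
    also have "\<dots> = (\<Sum>m\<in>idx (Suc q). \<Sum>r\<in>idx q. \<Sum>r'\<in>idx q. \<Sum>b\<in>UNIV. \<Sum>m'\<in>idx (Suc q).
          (jw k i (a # m) * jw (Suc q) m (c # r) * F r r') * (jw (Suc q) (b # r') m' * jw k (b # m') j))"
    proof -
      have sw: "(\<Sum>b\<in>UNIV. \<Sum>m\<in>A. \<Sum>m'\<in>B. \<Sum>r\<in>C. \<Sum>r'\<in>D. f b m m' r r') =
          (\<Sum>m\<in>A. \<Sum>r\<in>C. \<Sum>r'\<in>D. \<Sum>b\<in>UNIV. \<Sum>m'\<in>B. f b m m' r r')"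
        for A B C D and f :: "'n \<Rightarrow> _ \<Rightarrow> _ \<Rightarrow> _ \<Rightarrow> _ \<Rightarrow> complex"
      proof -
        have "(\<Sum>b\<in>UNIV. \<Sum>m\<in>A. \<Sum>m'\<in>B. \<Sum>r\<in>C. \<Sum>r'\<in>D. f b m m' r r')
          = (\<Sum>m\<in>A. \<Sum>b\<in>UNIV. \<Sum>m'\<in>B. \<Sum>r\<in>C. \<Sum>r'\<in>D. f b m m' r r')" by (rule sum.swap)
        also have "\<dots> = (\<Sum>m\<in>A. \<Sum>b\<in>UNIV. \<Sum>r\<in>C. \<Sum>m'\<in>B. \<Sum>r'\<in>D. f b m m' r r')"
          by (intro sum.cong[OF refl] sum.swap)
        also have "\<dots> = (\<Sum>m\<in>A. \<Sum>r\<in>C. \<Sum>b\<in>UNIV. \<Sum>m'\<in>B. \<Sum>r'\<in>D. f b m m' r r')"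
          by (intro sum.cong[OF refl] sum.swap)
        also have "\<dots> = (\<Sum>m\<in>A. \<Sum>r\<in>C. \<Sum>b\<in>UNIV. \<Sum>r'\<in>D. \<Sum>m'\<in>B. f b m m' r r')"
          by (intro sum.cong[OF refl] sum.swap)
        also have "\<dots> = (\<Sum>m\<in>A. \<Sum>r\<in>C. \<Sum>r'\<in>D. \<Sum>b\<in>UNIV. \<Sum>m'\<in>B. f b m m' r r')"
          by (intro sum.cong[OF refl] sum.swap)
        finally show ?thesis .
      qed
      show ?thesis by (rule sw)
    qed
    also have "\<dots> = (\<Sum>m\<in>idx (Suc q). \<Sum>r\<in>idx q. \<Sum>r'\<in>idx q.
          (jw k i (a # m) * jw (Suc q) m (c # r) * F r r') * (\<Sum>b\<in>UNIV. jw k (b # b # r') j))"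
      by (simp add: q sum_distrib_left[symmetric] jw_sub')
    finally show ?thesis by (simp add: q jw_cap')
  qed
  have "(\<Sum>b\<in>UNIV. act a b (act c b F) i j) =
     (\<Sum>b\<in>UNIV. F (c # a # i) (b # b # j))
     + (\<Sum>b\<in>UNIV. of_real (s (Suc k)) * (\<Sum>m\<in>idx k. \<Sum>m'\<in>idx k.
        jw (Suc k) (a # i) (c # m) * jw (Suc k) (b # m') (b # j) * F m m'))
     + (\<Sum>b\<in>UNIV. of_real (s k) * (\<Sum>m\<in>idxp k. \<Sum>m'\<in>idxp k.
      jw k i (a # m) * jw k (b # m') j * F (c # m) (b # m')))
     + of_real (s k) * of_real (s (k - 1)) * (\<Sum>b\<in>UNIV. \<Sum>m\<in>idxp k. \<Sum>m'\<in>idxp k. jw k i (a # m) * jw k (b # m') j *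
      (\<Sum>r\<in>idxp (k - 1). \<Sum>r'\<in>idxp (k - 1). jw (k - 1) m (c # r) * jw (k - 1) (b # r') m' * F r r'))"
  proof -
    have m: "act c b F m m' = F (c # m) (b # m') + of_real (s (k - 1)) *
       (\<Sum>r\<in>idxp (k - 1). \<Sum>r'\<in>idxp (k - 1). jw (k - 1) m (c # r) * jw (k - 1) (b # r') m' * F r r')"
      if "m \<in> idxp k" for b m m'
      using that by (intro act_idx) (auto simp: idx_def idxp_def)
    show ?thesis
      using i by (simp add: act_idx[of i k] act_idx[of "a # i" "Suc k"] m sum.distrib distrib_left sum_distrib_left mult_ac
          cong: sum.cong)
  qed
  also have "\<dots> = (\<Sum>m\<in>idx k. jw (Suc k) (a # i) (c # m) * F m j)
      + of_real (s k) * (\<Sum>m\<in>idxp k. jw k i (a # m) * F (c # m) j)"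
    by (simp only: t1 t2 t3 t4) simp
  also have "(\<Sum>m\<in>idx k. jw (Suc k) (a # i) (c # m) * F m j) =
     of_bool (a = c) * (\<Sum>m\<in>idx k. jw k i m * F m j)
     - of_real (s k) * (\<Sum>m\<in>idx k. \<Sum>r\<in>idxp k. jw k i (a # r) * (jw k (c # r) m * F m j))"
    by (simp only: jw.simps(2) left_diff_distrib sum_subtractf)
      (simp only: sum_distrib_left sum_distrib_right mult.assoc)
  also have "(\<Sum>m\<in>idx k. \<Sum>r\<in>idxp k. jw k i (a # r) * (jw k (c # r) m * F m j))
     = (\<Sum>r\<in>idxp k. jw k i (a # r) * (\<Sum>m\<in>idx k. jw k (c # r) m * F m j))"
    by (subst sum.swap) (simp add: sum_distrib_left)
  also have "\<dots> = (\<Sum>r\<in>idxp k. jw k i (a # r) * F (c # r) j)"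
    by (rule sum.cong[OF refl]) (subst validD(2)[OF F], auto simp: idxp_def idx_def)
  also have "(\<Sum>m\<in>idx k. jw k i m * F m j) = F i j" by (rule validD(2)[OF F i])
  finally show ?thesis by simp
qed

lemma act_orthogonal_column:
  assumes F: "valid F"
  shows "(\<Sum>a\<in>UNIV. act a b (act a c F) i j) = of_bool (b = c) * F i j"
proof -
  have "act a b (act a c F) i j = act b a (act c a (tr F)) j i" for a
  proof -
    have "act a b (act a c F) = tr (act b a (tr (act a c F)))"
      by (rule act_tr[OF valid_act[OF F]])
    also have "tr (act a c F) = act c a (tr F)"
      by (simp add: act_tr[OF F] tr_def fun_eq_iff)
    finally show ?thesis by (simp add: tr_def)
  qed
  then show ?thesis
    using act_orthogonal_row[OF valid_tr[OF F], of b c j i] by (simp add: tr_def)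
qed

section \<open>From the action of words to functionals on the quotient algebra\<close>

definition Act :: "('n \<times> 'n) list \<Rightarrow> ('n list \<Rightarrow> 'n list \<Rightarrow> complex) \<Rightarrow> 'n list \<Rightarrow> 'n list \<Rightarrow> complex" where
  "Act xs = foldr (\<lambda>(a, b). act a b) xs"

lemma Act_simps: "Act [] F = F" "Act ((a, b) # xs) F = act a b (Act xs F)"
  "Act (xs @ ys) F = Act xs (Act ys F)"
  by (simp_all add: Act_def)

lemma act_add: "act a b (\<lambda>i j. F i j + F' i j) = (\<lambda>i j. act a b F i j + act a b F' i j)"
  by (intro ext) (simp add: act_def Let_def distrib_left sum.distrib)

lemma act_scale: "act a b (\<lambda>i j. c * F i j) = (\<lambda>i j. c * act a b F i j)"
  by (intro ext) (simp add: act_def Let_def distrib_left sum_distrib_left mult_ac)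

lemma Act_add: "Act xs (\<lambda>i j. F i j + F' i j) = (\<lambda>i j. Act xs F i j + Act xs F' i j)"
  by (induction xs) (auto simp: Act_simps act_add)

lemma Act_scale: "Act xs (\<lambda>i j. c * F i j) = (\<lambda>i j. c * Act xs F i j)"
  by (induction xs) (auto simp: Act_simps act_scale)

lemma valid_Act: "valid F \<Longrightarrow> valid (Act xs F)"
  by (induction xs) (auto simp: Act_simps valid_act)

definition free_act :: "('n \<times> 'n) free_algebra \<Rightarrow> ('n list \<Rightarrow> 'n list \<Rightarrow> complex) \<Rightarrow> 'n list \<Rightarrow> 'n list \<Rightarrow> complex" where
  "free_act f F i j = linear_ext (\<lambda>w. Act (letters w) F i j) f"

lemma free_act_plus: "free_act (f + g) F i j = free_act f F i j + free_act g F i j"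
  by (simp add: free_act_def linear_ext_add)

lemma free_act_diff: "free_act (f - g) F i j = free_act f F i j - free_act g F i j"
  by (simp add: free_act_def linear_ext_diff)

lemma free_act_scale: "free_act (c *\<^sub>C f) F i j = c * free_act f F i j"
  by (simp add: free_act_def linear_ext_scaleC scaleC_complex_def)

lemma free_act_sum: "free_act (\<Sum>x\<in>A. f x) F i j = (\<Sum>x\<in>A. free_act (f x) F i j)"
  by (induction A rule: infinite_finite_induct) (simp_all add: free_act_plus, simp_all add: free_act_def)

lemma free_act_single: "free_act (Poly_Mapping.single q c) F = (\<lambda>i j. c * Act (letters q) F i j)"
  by (intro ext) (simp add: free_act_def scaleC_complex_def)

lemma free_act_add: "free_act f (\<lambda>i j. F i j + F' i j) i j = free_act f F i j + free_act f F' i j"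
  by (simp add: free_act_def Act_add linear_ext_fun_add)

text \<open>Since \<open>act\<close> is the transpose of a right multiplication, the last letter of
  a word acts first; concatenation therefore becomes composition in the same order.\<close>

lemma free_act_mult: "free_act (f * g) F i j = free_act f (free_act g F) i j"
proof (induction f rule: free_induct)
  case (single q c)
  show ?case
  proof (induction g rule: free_induct)
    case (single q' c')
    show ?case by (simp add: mult_single free_act_single plus_word_def Act_simps Act_scale)
  next
    case (add g g')
    have "free_act (g + g') F = (\<lambda>i j. free_act g F i j + free_act g' F i j)"
      by (intro ext) (rule free_act_plus)
    then show ?case using add by (simp add: distrib_left free_act_plus free_act_add)
  qed
next
  case (add f f')
  then show ?case by (simp add: distrib_right free_act_plus)
qed

lemma valid_free_act: "valid F \<Longrightarrow> valid (free_act f F)"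
proof (induction f rule: free_induct)
  case (single q c)
  then have "valid (Act (letters q) F)" by (rule valid_Act)
  then show ?case
    by (simp add: valid_def free_act_single mult.left_commute sum_distrib_left[symmetric])
next
  case (add f g)
  then show ?case by (simp add: valid_def free_act_plus distrib_left sum.distrib)
qed

lemma free_act_zero: "free_act f (\<lambda>i j. 0) i j = 0"
  using free_act_add[of f "\<lambda>_ _. 0" "\<lambda>_ _. 0" i j] by simp

lemma free_act_one: "free_act 1 F = F"
proof -
  have "free_act (Poly_Mapping.single 0 1) F = F"
    unfolding free_act_single by (simp add: zero_word_def Act_simps)
  then show ?thesis by simp
qed

lemma free_act_gen: "free_act (free_gen (a, b)) F = act a b F"
  by (simp add: free_act_single Act_simps)

lemma free_act_relations:
  assumes F: "valid F" and "r \<in> Ao_relations"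
  shows "free_act r F i j = 0"
proof -
  have b: "free_act (of_bool P) F i j = of_bool P * F i j" for P
    by (cases P) (simp_all add: free_act_one, simp add: free_act_def)
  show ?thesis
    using assms(2) unfolding Ao_relations_def
    by (auto simp del: of_bool_eq_1_iff simp: free_act_diff free_act_sum free_act_mult b free_star_single free_act_gen
        act_orthogonal_row[OF F] act_orthogonal_column[OF F])
qed

lemma free_act_ideal:
  assumes F: "valid F" and "f \<in> Ao_ideal"
  shows "free_act f F i j = 0"
  using assms(2) unfolding Ao_ideal_def
proof (induction rule: complex_vector.span_induct)
  case base
  show ?case
    by (auto simp: complex_vector.subspace_def free_act_plus free_act_scale) (simp add: free_act_def)
next
  case (step x)
  then obtain f r g where x: "x = f * r * g" "r \<in> Ao_relations" by blast
  have "free_act r (free_act g F) = (\<lambda>_ _. 0)"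
    by (intro ext free_act_relations valid_free_act F x(2))
  moreover have "free_act x F i j = free_act f (free_act r (free_act g F)) i j"
  proof -
    have "free_act (r * g) F = free_act r (free_act g F)" by (intro ext free_act_mult)
    then show ?thesis by (simp only: x(1) mult.assoc free_act_mult[of f])
  qed
  ultimately show ?case by (simp add: free_act_zero)
qed

text \<open>The functional with values \<open>F i j\<close> on \<open>v k i j\<close>, read off at
  the empty lists. For valid F the choice of representative is harmless, as the ideal acts by
  zero.\<close>

definition ev :: "('n list \<Rightarrow> 'n list \<Rightarrow> complex) \<Rightarrow> 'n Ao \<Rightarrow> complex" where
  "ev F x = free_act (rep_Ao x) F [] []"

lemma ev_abs: assumes "valid F" shows "ev F (abs_Ao f) = free_act f F [] []"
proof -
  have "Ao_eq (rep_Ao (abs_Ao f)) f"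
    by (rule Quotient_rep_abs[OF Quotient_Ao equivp_reflp[OF Ao_equivp]])
  then have "free_act (rep_Ao (abs_Ao f) - f) F [] [] = 0"
    by (intro free_act_ideal assms) (simp add: Ao_eq_def)
  then show ?thesis by (simp add: ev_def free_act_diff)
qed

lemma ev_linear:
  assumes "valid F"
  shows "ev F (x + y) = ev F x + ev F y" "ev F (c *\<^sub>C x) = c * ev F x" "ev F 1 = F [] []"
    "ev F (x * u_gen a b) = ev (act a b F) x"
proof -
  obtain f g where xy: "x = abs_Ao f" "y = abs_Ao g" by (metis Quotient_abs_rep[OF Quotient_Ao])
  show "ev F (x + y) = ev F x + ev F y"
    by (simp add: xy plus_Ao.abs_eq ev_abs[OF assms] free_act_plus)
  show "ev F (c *\<^sub>C x) = c * ev F x"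
    by (simp add: xy scaleC_Ao.abs_eq ev_abs[OF assms] free_act_scale)
  show "ev F 1 = F [] []" by (simp add: one_Ao_def ev_abs[OF assms] free_act_one)
  show "ev F (x * u_gen a b) = ev (act a b F) x"
    by (simp add: xy u_gen.abs_eq times_Ao.abs_eq ev_abs[OF assms] ev_abs[OF valid_act[OF assms]]
        free_act_mult free_act_gen)
qed

lemma ev_sum: "valid F \<Longrightarrow> ev F (\<Sum>x\<in>A. f x) = (\<Sum>x\<in>A. ev F (f x))"
proof (induction A rule: infinite_finite_induct)
  case empty
  then show ?case using ev_linear(2)[of F 0 0] by simp
next
  case (infinite A)
  then show ?case using ev_linear(2)[of F 0 0] by simp
qed (simp_all add: ev_linear)

text \<open>Solve the fusion rule for the highest coefficient. Its lower term sits two levels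
  further down, hence the strong induction, and it cancels the second summand of
  \<open>act\<close>.\<close>

lemma ev_v: "valid F \<Longrightarrow> i \<in> idx k \<Longrightarrow> j \<in> idx k \<Longrightarrow> ev F (v k i j) = F i j"
proof (induction k arbitrary: F i j rule: less_induct)
  case (less k)
  show ?case
  proof (cases k)
    case 0
    then show ?thesis using less.prems by (simp add: v_def scaleC_one ev_linear)
  next
    case (Suc q)
    obtain a i' b j' where ij: "i = a # i'" "i' \<in> idx q" "j = b # j'" "j' \<in> idx q"
      using less.prems(2,3) Suc by (metis idx_SucE)
    have "v k i j = v q i' j' * u_gen a b + (- of_real (s q)) *\<^sub>C
       (\<Sum>m\<in>idxp q. \<Sum>m'\<in>idxp q. (jw q i' (a # m) * jw q (b # m') j') *\<^sub>C v (q - 1) m m')"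
      by (simp add: Suc ij(1,3) v_mult_u[OF ij(4)])
    then have "ev F (v k i j) = ev (act a b F) (v q i' j') - of_real (s q) *
       (\<Sum>m\<in>idxp q. \<Sum>m'\<in>idxp q. jw q i' (a # m) * jw q (b # m') j' * ev F (v (q - 1) m m'))"
      by (simp only: ev_linear[OF less.prems(1)] ev_sum[OF less.prems(1)]) simp
    also have "ev (act a b F) (v q i' j') = act a b F i' j'"
      using less.IH[of q] Suc ij valid_act[OF less.prems(1)] by simp
    also have "(\<Sum>m\<in>idxp q. \<Sum>m'\<in>idxp q. jw q i' (a # m) * jw q (b # m') j' * ev F (v (q - 1) m m')) =
       (\<Sum>m\<in>idxp q. \<Sum>m'\<in>idxp q. jw q i' (a # m) * jw q (b # m') j' * F m m')"
    proof (cases q)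
      case q: (Suc p)
      then have p: "p < k" using Suc by simp
      show ?thesis
        by (intro sum.cong refl arg_cong2[where f = "(*)"]) (use less.IH[OF p less.prems(1)] q in auto)
    qed simp
    finally show ?thesis by (simp add: act_idx[OF ij(2)] ij(1,3))
  qed
qed

definition vacuum :: "'n list \<Rightarrow> 'n list \<Rightarrow> complex" where
  "vacuum i j = of_bool (i = [] \<and> j = [])"

lemma valid_vacuum: "valid vacuum"
proof -
  have *: "i \<in> idx k \<Longrightarrow> (\<Sum>l\<in>idx k. jw k i l * vacuum l j) = vacuum i j"
    "j \<in> idx k \<Longrightarrow> (\<Sum>l\<in>idx k. jw k l j * vacuum i l) = vacuum i j" for k i j
    by (cases k; auto simp: vacuum_def idx_def intro!: sum.neutral)+
  show ?thesis unfolding valid_def using * by (auto simp: vacuum_def)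
qed

end

section \<open>Partial traces and a spectral gap\<close>

lemma cnj_mult_self: "cnj z * z = (complex_of_real (cmod z))\<^sup>2"
  using complex_norm_square[of z] by (simp add: mult.commute)

text \<open>Iterating the inequality towards infinity gives d k * y k \<le> c k, where c is the
  convolution of \<gamma> with powers of 1/2; such a convolution preserves square
  summability.\<close>

lemma summable_weighted_decay:
  fixes y \<gamma> d :: "nat \<Rightarrow> real"
  assumes d: "\<And>k. d k > 0" "\<And>k. d (Suc k) \<ge> 2 * d k"
    and \<gamma>: "\<And>k. \<gamma> k \<ge> 0" "summable (\<lambda>k. (\<gamma> k)\<^sup>2)"
    and y: "\<And>k. y k \<ge> 0" "y \<longlonglongrightarrow> 0" "\<And>k. y k \<le> \<gamma> (Suc k) / d k + y (Suc k)"
  shows "summable (\<lambda>k. (d k * y k)\<^sup>2)"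
proof -
  define \<Gamma> where "\<Gamma> = suminf (\<lambda>k. (\<gamma> k)\<^sup>2)"
  have \<Gamma>: "sum (\<lambda>k. (\<gamma> k)\<^sup>2) A \<le> \<Gamma>" if "finite A" for A
    unfolding \<Gamma>_def using that by (intro sum_le_suminf \<gamma>) auto
  define B where "B = sqrt \<Gamma>"
  have \<gamma>B: "\<gamma> k \<le> B" for k
    using \<Gamma>[of "{k}"] \<gamma>(1)[of k] by (simp add: B_def real_le_rsqrt)
  have B0: "B \<ge> 0" using \<gamma>(1)[of 0] \<gamma>B[of 0] by linarith
  \<comment> \<open>The solution of c k = \<gamma> (k + 1) + c (k + 1) / 2, the extremal case of the
    inequality for d k * y k when d exactly doubles.\<close>
  define c where "c k = suminf (\<lambda>j. (1/2) ^ j * \<gamma> (Suc k + j))" for k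
  have geo: "summable (\<lambda>j. (1/2) ^ j * B)" by (intro summable_mult2 summable_geometric) simp
  have sm: "summable (\<lambda>j. (1/2) ^ j * \<gamma> (Suc k + j))" for k
    by (rule summable_comparison_test'[OF geo, of 0]) (use \<gamma> \<gamma>B in \<open>simp add: abs_mult mult_left_mono\<close>)
  have c0: "c k \<ge> 0" for k unfolding c_def by (intro suminf_nonneg sm) (simp add: \<gamma>)
  have cB: "c k \<le> 2 * B" for k
  proof -
    have "c k \<le> suminf (\<lambda>j. (1/2) ^ j * B)"
      unfolding c_def by (intro suminf_le sm geo) (use \<gamma>B in \<open>simp add: mult_left_mono\<close>)
    also have "\<dots> = 2 * B"
      using suminf_mult2[OF summable_geometric[of "1/2::real"], of B] suminf_geometric[of "1/2::real"] by simp
    finally show ?thesis .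
  qed
  have cS: "c k = \<gamma> (Suc k) + c (Suc k) / 2" for k
  proof -
    have "c k = (1/2) ^ 0 * \<gamma> (Suc k + 0) + suminf (\<lambda>j. (1/2) ^ Suc j * \<gamma> (Suc k + Suc j))"
      unfolding c_def using suminf_split_head[OF sm, of k] by simp
    also have "suminf (\<lambda>j. (1/2) ^ Suc j * \<gamma> (Suc k + Suc j)) = suminf (\<lambda>j. (1/2) * ((1/2) ^ j * \<gamma> (Suc (Suc k) + j)))"
      by (simp add: mult.assoc)
    also have "\<dots> = (1/2) * c (Suc k)"
      unfolding c_def by (rule suminf_mult[OF sm])
    finally show ?thesis by simp
  qed
  have dpow: "d k \<ge> 2 ^ k * d 0" for k
  proof (induction k)
    case (Suc k) then show ?case using d(2)[of k] by simp
  qed simp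
  have lim: "(\<lambda>k. y k - c k / d k) \<longlonglongrightarrow> 0 - 0"
  proof (intro tendsto_diff y(2))
    have "(\<lambda>k. (2 * B / d 0) * (1/2) ^ k) \<longlonglongrightarrow> (2 * B / d 0) * 0"
      by (intro tendsto_intros LIMSEQ_realpow_zero) auto
    then have z: "(\<lambda>k. (2 * B / d 0) * (1/2) ^ k) \<longlonglongrightarrow> 0" by simp
    have le: "c k / d k \<le> (2 * B / d 0) * (1/2) ^ k" for k
    proof -
      have "c k / d k \<le> 2 * B / (2 ^ k * d 0)"
        by (rule frac_le) (use cB[of k] B0 dpow[of k] d(1)[of 0] in auto)
      then show ?thesis by (simp add: power_divide field_simps)
    qed
    show "(\<lambda>k. c k / d k) \<longlonglongrightarrow> 0"
      by (rule real_tendsto_sandwich[OF _ _ tendsto_const z])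
        (use le c0 d(1) in \<open>auto intro!: always_eventually divide_nonneg_pos\<close>)
  qed
  \<comment> \<open>An increasing sequence with limit 0 is nonpositive; this replaces the iteration
    of the inequality.\<close>
  have "incseq (\<lambda>k. y k - c k / d k)"
  proof (rule incseq_SucI)
    fix k
    have "c (Suc k) / d (Suc k) \<le> c (Suc k) / (2 * d k)"
      by (rule divide_left_mono) (use d c0 in auto)
    moreover have "c k / d k = \<gamma> (Suc k) / d k + c (Suc k) / (2 * d k)"
      by (simp add: cS[of k] add_divide_distrib)
    ultimately show "y k - c k / d k \<le> y (Suc k) - c (Suc k) / d (Suc k)" using y(3)[of k] by linarith
  qed
  then have neg: "y k - c k / d k \<le> 0" for k
    using lim by (intro incseq_le) simp_all
  have yc: "d k * y k \<le> c k" for k using neg[of k] d(1)[of k] by (simp add: field_simps)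
  have csq: "(c k)\<^sup>2 \<le> 2 * (\<gamma> (Suc k))\<^sup>2 + (c (Suc k))\<^sup>2 / 2" for k
  proof -
    have "0 \<le> (\<gamma> (Suc k) - c (Suc k) / 2)\<^sup>2" by simp
    then show ?thesis unfolding cS[of k] by (simp add: power2_eq_square algebra_simps)
  qed
  have bound: "(\<Sum>k<n. (c k)\<^sup>2) \<le> 4 * \<Gamma> + 4 * B\<^sup>2" for n
  proof -
    have "(\<Sum>k<n. (c k)\<^sup>2) \<le> (\<Sum>k<n. 2 * (\<gamma> (Suc k))\<^sup>2 + (c (Suc k))\<^sup>2 / 2)"
      by (intro sum_mono csq)
    also have "\<dots> = 2 * (\<Sum>k\<in>{1..n}. (\<gamma> k)\<^sup>2) + (\<Sum>k<n. (c (Suc k))\<^sup>2) / 2"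
      by (simp add: sum.distrib sum_distrib_left sum_divide_distrib sum.atLeast1_atMost_eq)
    also have "(\<Sum>k<n. (c (Suc k))\<^sup>2) \<le> (\<Sum>k<n. (c k)\<^sup>2) + (c n)\<^sup>2"
      using sum.lessThan_Suc_shift[of "\<lambda>k. (c k)\<^sup>2" n] by simp
    also have "(c n)\<^sup>2 \<le> (2 * B)\<^sup>2" by (intro power_mono cB c0)
    finally have *: "(\<Sum>k<n. (c k)\<^sup>2) \<le> 2 * (\<Sum>k\<in>{1..n}. (\<gamma> k)\<^sup>2) + ((\<Sum>k<n. (c k)\<^sup>2) + (2 * B)\<^sup>2) / 2"
      by simp
    \<comment> \<open>The sum of squares reappears on the right with factor 1/2 and is absorbed into
      the left side.\<close>
    have "x \<le> 4 * g + 4 * b" if "x \<le> 2 * a + (x + 4 * b) / 2" "a \<le> g" for x a b g :: real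
      using that by (simp add: field_simps)
    from this[OF _ \<Gamma>[of "{1..n}"]] show ?thesis using * by (simp add: power_mult_distrib)
  qed
  have "summable (\<lambda>k. (c k)\<^sup>2)"
    by (rule summableI_nonneg_bounded[OF _ bound]) simp
  then show ?thesis
    by (rule summable_comparison_test'[of _ 0])
      (use yc y(1) d(1) in \<open>simp add: power_mono less_imp_le\<close>)
qed

context large_Ao begin

text \<open>X = p_k X = X p_k, i.e. X is an endomorphism of V_k. As p_k vanishes outside
  \<open>idx k\<close>, so does X.\<close>

definition pinv :: "nat \<Rightarrow> ('n list \<Rightarrow> 'n list \<Rightarrow> complex) \<Rightarrow> bool" where
  "pinv k X \<longleftrightarrow> (\<forall>i j. (\<Sum>l\<in>idx k. jw k i l * X l j) = X i j) \<and> (\<forall>i j. (\<Sum>l\<in>idx k. jw k l j * X i l) = X i j)"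

lemma pinvD:
  assumes "pinv k X"
  shows "(\<Sum>l\<in>idx k. jw k i l * X l j) = X i j" "(\<Sum>l\<in>idx k. jw k l j * X i l) = X i j"
  using assms by (auto simp: pinv_def)

lemma pinv_linear_v:
  assumes "\<And>x y. f (x + y) = f x + f y" "\<And>c x. f (c *\<^sub>C x) = c * f x"
  shows "pinv k (\<lambda>i j. f (v k i j))"
proof -
  have f0: "f 0 = 0" using assms(2)[of 0 0] by simp
  have "f (\<Sum>l\<in>A. g l) = (\<Sum>l\<in>A. f (g l))" for A and g :: "'n list \<Rightarrow> 'n Ao"
    by (induction A rule: infinite_finite_induct) (simp_all add: assms f0)
  then have "f (\<Sum>l\<in>A. c l *\<^sub>C g l) = (\<Sum>l\<in>A. c l * f (g l))" for A c and g :: "'n list \<Rightarrow> 'n Ao"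
    by (simp add: assms)
  from this[symmetric] show ?thesis by (simp add: pinv_def v_jw_left v_jw_right)
qed

text \<open>The square of the Hilbert-Schmidt norm, without a square root.\<close>

definition hs :: "nat \<Rightarrow> ('n list \<Rightarrow> 'n list \<Rightarrow> complex) \<Rightarrow> real" where
  "hs k X = (\<Sum>i\<in>idx k. \<Sum>j\<in>idx k. (cmod (X i j))\<^sup>2)"

definition ip :: "nat \<Rightarrow> ('n list \<Rightarrow> 'n list \<Rightarrow> complex) \<Rightarrow> ('n list \<Rightarrow> 'n list \<Rightarrow> complex) \<Rightarrow> complex" where
  "ip k X Y = (\<Sum>i\<in>idx k. \<Sum>j\<in>idx k. cnj (X i j) * Y i j)"

lemma ip_self: "ip k X X = of_real (hs k X)"
  by (simp add: ip_def hs_def cnj_mult_self)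

lemma hs_nonneg: "0 \<le> hs k X"
  by (simp add: hs_def sum_nonneg)

lemma ip_commute: "ip k X Y = cnj (ip k Y X)"
  by (simp add: ip_def mult.commute)

lemma ip_add_right: "ip k X (\<lambda>i j. Y i j + Z i j) = ip k X Y + ip k X Z"
  by (simp add: ip_def distrib_left sum.distrib)

lemma ip_scale_right: "ip k X (\<lambda>i j. c * Y i j) = c * ip k X Y"
  by (simp add: ip_def sum_distrib_left mult_ac)

lemma hs_add: "hs k (\<lambda>i j. X i j + c * Y i j) = hs k X + 2 * Re (c * ip k X Y) + (cmod c)\<^sup>2 * hs k Y"
proof -
  have "(cmod (x + c * y))\<^sup>2 = (cmod x)\<^sup>2 + 2 * Re (c * (cnj x * y)) + (cmod c)\<^sup>2 * (cmod y)\<^sup>2" for x y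
    unfolding cmod_power2 by (simp add: algebra_simps power2_eq_square)
  then show ?thesis
    by (simp add: hs_def ip_def sum.distrib sum_distrib_left)
qed

lemma ip_Cauchy_Schwarz: "(cmod (ip k X Y))\<^sup>2 \<le> hs k X * hs k Y"
proof (cases "hs k Y = 0")
  case True
  have "cmod (Y i j) = 0" if "i \<in> idx k" "j \<in> idx k" for i j
  proof -
    have "(\<Sum>j\<in>idx k. (cmod (Y i j))\<^sup>2) = 0"
      using True that(1) by (simp add: hs_def sum_nonneg_eq_0_iff sum_nonneg)
    then show ?thesis using that(2) by (simp add: sum_nonneg_eq_0_iff)
  qed
  then have "ip k X Y = 0" by (simp add: ip_def)
  then show ?thesis using True by simp
next
  case False
  then have y: "hs k Y > 0" using hs_nonneg[of k Y] by simp
  define c where "c = - cnj (ip k X Y) / of_real (hs k Y)"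
  have r: "Re (c * ip k X Y) = - (cmod (ip k X Y))\<^sup>2 / hs k Y"
    by (simp add: c_def cnj_mult_self flip: of_real_power)
  have c2: "(cmod c)\<^sup>2 * hs k Y = (cmod (ip k X Y))\<^sup>2 / hs k Y"
    using y by (simp add: c_def norm_divide power_divide power2_eq_square)
  have "0 \<le> hs k (\<lambda>i j. X i j + c * Y i j)" by (rule hs_nonneg)
  then have "0 \<le> hs k X - (cmod (ip k X Y))\<^sup>2 / hs k Y" unfolding hs_add r c2 by simp
  then show ?thesis using y by (simp add: field_simps)
qed

lemma hs_triangle: "sqrt (hs k (\<lambda>i j. X i j + c * Y i j)) \<le> sqrt (hs k X) + cmod c * sqrt (hs k Y)"
proof (rule real_le_lsqrt)
  have "cmod (ip k X Y) \<le> sqrt (hs k X) * sqrt (hs k Y)"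
    using ip_Cauchy_Schwarz[of k X Y] by (metis abs_norm_cancel real_sqrt_abs real_sqrt_le_iff real_sqrt_mult)
  then have "Re (c * ip k X Y) \<le> cmod c * (sqrt (hs k X) * sqrt (hs k Y))"
    by (metis complex_Re_le_cmod mult_left_mono norm_ge_zero norm_mult order_trans)
  then show "hs k (\<lambda>i j. X i j + c * Y i j) \<le> (sqrt (hs k X) + cmod c * sqrt (hs k Y))\<^sup>2"
  proof -
    have "(sqrt (hs k X) + cmod c * sqrt (hs k Y))\<^sup>2 =
        hs k X + 2 * (cmod c * (sqrt (hs k X) * sqrt (hs k Y))) + (cmod c)\<^sup>2 * hs k Y"
      by (simp add: power2_sum power_mult_distrib hs_nonneg)
    then show ?thesis unfolding hs_add using \<open>Re (c * ip k X Y) \<le> _\<close> by linarith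
  qed
qed (simp add: hs_nonneg)

lemma pinv_sub:
  assumes "pinv (Suc k) X"
  shows "(\<Sum>l\<in>idx k. jw k i l * X (a # l) y) = X (a # i) y"
    "(\<Sum>l\<in>idx k. jw k l j * X x (a # l)) = X x (a # j)"
proof -
  show "(\<Sum>l\<in>idx k. jw k i l * X (a # l) y) = X (a # i) y"
    by (rule jw_absorb) (rule pinvD(1)[OF assms])
  show "(\<Sum>l\<in>idx k. jw k l j * X x (a # l)) = X x (a # j)"
    unfolding jw_sym[of k _ j]
    by (rule jw_absorb) (simp only: jw_sym[of "Suc k" "a # _"] pinvD(2)[OF assms])
qed

lemma pinv_cap:
  assumes "pinv (Suc (Suc k)) X"
  shows "(\<Sum>a\<in>UNIV. X (a # a # m) y) = 0"
proof -
  have "(\<Sum>a\<in>UNIV. X (a # a # m) y) = (\<Sum>a\<in>UNIV. \<Sum>l\<in>idx (Suc (Suc k)). jw (Suc (Suc k)) (a # a # m) l * X l y)"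
    by (simp only: pinvD(1)[OF assms])
  also have "\<dots> = (\<Sum>l\<in>idx (Suc (Suc k)). (\<Sum>a\<in>UNIV. jw (Suc (Suc k)) (a # a # m) l) * X l y)"
    by (subst sum.swap) (simp only: sum_distrib_right)
  finally show ?thesis by (simp only: jw_cap') simp
qed

lemma pinv_jw: "pinv k (jw k)"
  by (simp add: pinv_def jw_idem) (simp add: mult.commute jw_idem)

lemma pinv_add: "pinv k X \<Longrightarrow> pinv k Y \<Longrightarrow> pinv k (\<lambda>i j. X i j + c * Y i j)"
  by (simp add: pinv_def distrib_left sum.distrib mult.left_commute[of _ c] sum_distrib_left[symmetric])

section \<open>The partial trace over the first letter, its adjoint and the gap\<close>

definition E :: "('n list \<Rightarrow> 'n list \<Rightarrow> complex) \<Rightarrow> 'n list \<Rightarrow> 'n list \<Rightarrow> complex" where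
  "E X i j = (\<Sum>a\<in>UNIV. X (a # i) (a # j))"

lemma E_add: "E (\<lambda>i j. X i j + c * Y i j) = (\<lambda>i j. E X i j + c * E Y i j)"
  by (intro ext) (simp add: E_def sum.distrib sum_distrib_left)

lemma E_jw: "E (jw (Suc k)) = (\<lambda>i j. of_real (N - s k) * jw k i j)"
  by (intro ext) (simp only: E_def jw_ptrace)

lemma pinv_E:
  assumes "pinv (Suc k) X"
  shows "pinv k (E X)"
proof -
  have "(\<Sum>l\<in>idx k. jw k i l * E X l j) = E X i j" "(\<Sum>l\<in>idx k. jw k l j * E X i l) = E X i j" for i j
    unfolding E_def sum_distrib_left by (subst sum.swap, simp add: pinv_sub[OF assms])+
  then show ?thesis by (simp add: pinv_def)
qed

text \<open>The map Y \<mapsto> p_{k+1} (1 \<otimes> Y) p_{k+1}, which is the adjoint of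
  \<open>E\<close> for the Hilbert-Schmidt inner product on endomorphisms of V_k and
  V_{k+1}.\<close>

definition Tm :: "nat \<Rightarrow> ('n list \<Rightarrow> 'n list \<Rightarrow> complex) \<Rightarrow> 'n list \<Rightarrow> 'n list \<Rightarrow> complex" where
  "Tm k Y x y = (\<Sum>a\<in>UNIV. \<Sum>m\<in>idx k. \<Sum>m'\<in>idx k. jw (Suc k) x (a # m) * Y m m' * jw (Suc k) (a # m') y)"

lemma sum_swap3:
  "(\<Sum>l\<in>A. \<Sum>a\<in>B. \<Sum>m\<in>C. \<Sum>m'\<in>D. f l a m m') = (\<Sum>a\<in>B. \<Sum>m\<in>C. \<Sum>m'\<in>D. \<Sum>l\<in>A. f l a m m')"
  by (subst sum.swap, rule sum.cong[OF refl], subst sum.swap, rule sum.cong[OF refl], rule sum.swap)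

lemma pinv_Tm: "pinv (Suc k) (Tm k Y)"
proof -
  have sw: "(\<Sum>l\<in>A. \<Sum>a\<in>B. \<Sum>m\<in>C. \<Sum>m'\<in>D. f l a m m') = (\<Sum>a\<in>B. \<Sum>m\<in>C. \<Sum>m'\<in>D. \<Sum>l\<in>A. f l a m m')"
    for A B C D and f :: "'n list \<Rightarrow> 'n \<Rightarrow> 'n list \<Rightarrow> 'n list \<Rightarrow> complex"
    by (rule sum_swap3)
  have "(\<Sum>l\<in>idx (Suc k). jw (Suc k) i l * Tm k Y l j) = Tm k Y i j" for i j
  proof -
    have "(\<Sum>l\<in>idx (Suc k). jw (Suc k) i l * Tm k Y l j) =
      (\<Sum>a\<in>UNIV. \<Sum>m\<in>idx k. \<Sum>m'\<in>idx k. \<Sum>l\<in>idx (Suc k). (jw (Suc k) i l * jw (Suc k) l (a # m)) * (Y m m' * jw (Suc k) (a # m') j))"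
      unfolding Tm_def sum_distrib_left sw by (simp only: mult.assoc)
    then show ?thesis by (simp only: sum_distrib_right[symmetric] jw_idem) (simp only: Tm_def mult.assoc)
  qed
  moreover have "(\<Sum>l\<in>idx (Suc k). jw (Suc k) l j * Tm k Y i l) = Tm k Y i j" for i j
  proof -
    have "(\<Sum>l\<in>idx (Suc k). jw (Suc k) l j * Tm k Y i l) =
      (\<Sum>a\<in>UNIV. \<Sum>m\<in>idx k. \<Sum>m'\<in>idx k. \<Sum>l\<in>idx (Suc k). (jw (Suc k) i (a # m) * Y m m') * (jw (Suc k) (a # m') l * jw (Suc k) l j))"
      unfolding Tm_def sum_distrib_left sw by (simp only: mult_ac)
    then show ?thesis by (simp only: sum_distrib_left[symmetric] jw_idem) (simp only: Tm_def)
  qed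
  ultimately show ?thesis by (simp add: pinv_def)
qed

lemma ip_Tm:
  assumes "pinv (Suc k) Z"
  shows "ip (Suc k) (Tm k Y) Z = ip k Y (E Z)"
proof -
  have sw: "(\<Sum>x\<in>A. \<Sum>y\<in>A'. \<Sum>a\<in>B. \<Sum>m\<in>C. \<Sum>m'\<in>D. f x y a m m') = (\<Sum>a\<in>B. \<Sum>m\<in>C. \<Sum>m'\<in>D. \<Sum>x\<in>A. \<Sum>y\<in>A'. f x y a m m')"
    for A A' B C D and f :: "'n list \<Rightarrow> 'n list \<Rightarrow> 'n \<Rightarrow> 'n list \<Rightarrow> 'n list \<Rightarrow> complex"
  proof -
    have "(\<Sum>y\<in>A'. \<Sum>a\<in>B. \<Sum>m\<in>C. \<Sum>m'\<in>D. g y a m m') = (\<Sum>a\<in>B. \<Sum>m\<in>C. \<Sum>m'\<in>D. \<Sum>y\<in>A'. g y a m m')"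
      for A' and g :: "'n list \<Rightarrow> 'n \<Rightarrow> 'n list \<Rightarrow> 'n list \<Rightarrow> complex"
      by (rule sum_swap3)
    then show ?thesis by simp
  qed
  have "ip (Suc k) (Tm k Y) Z = (\<Sum>a\<in>UNIV. \<Sum>m\<in>idx k. \<Sum>m'\<in>idx k. cnj (Y m m') *
     (\<Sum>x\<in>idx (Suc k). jw (Suc k) (a # m) x * (\<Sum>y\<in>idx (Suc k). jw (Suc k) y (a # m') * Z x y)))"
    unfolding ip_def Tm_def cnj_sum complex_cnj_mult cnj_jw sum_distrib_left sum_distrib_right sw
    by (simp only: jw_sym[of "Suc k" _ "_ # _"] mult_ac)
  also have "\<dots> = (\<Sum>a\<in>UNIV. \<Sum>m\<in>idx k. \<Sum>m'\<in>idx k. cnj (Y m m') * Z (a # m) (a # m'))"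
    by (simp only: pinvD[OF assms])
  also have "\<dots> = (\<Sum>m\<in>idx k. \<Sum>m'\<in>idx k. \<Sum>a\<in>UNIV. cnj (Y m m') * Z (a # m) (a # m'))"
    by (subst sum.swap, rule sum.cong[OF refl], rule sum.swap)
  finally show ?thesis by (simp add: ip_def E_def sum_distrib_left)
qed

lemma sum_of_bool_left: "(\<Sum>c\<in>UNIV. of_bool (a = c) * f c) = (f (a::'n) :: complex)"
proof -
  have "(\<Sum>c\<in>UNIV. of_bool (a = c) * f c) = (\<Sum>c\<in>UNIV. if a = c then f c else 0)"
    by (rule sum.cong) auto
  then show ?thesis by simp
qed

lemma jw_mult_left:
  assumes "pinv k Y"
  shows "(\<Sum>l\<in>idx k. jw (Suc k) (a # i) (c # l) * Y l j) =
     of_bool (a = c) * Y i j - of_real (s k) * (\<Sum>m\<in>idxp k. jw k i (a # m) * Y (c # m) j)"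
proof -
  have "(\<Sum>l\<in>idx k. jw (Suc k) (a # i) (c # l) * Y l j) = of_bool (a = c) * (\<Sum>l\<in>idx k. jw k i l * Y l j)
     - (\<Sum>l\<in>idx k. \<Sum>m\<in>idxp k. of_real (s k) * (jw k i (a # m) * (jw k (c # m) l * Y l j)))"
    by (simp only: jw.simps(2) left_diff_distrib sum_subtractf)
      (simp only: sum_distrib_left sum_distrib_right mult.assoc)
  also have "(\<Sum>l\<in>idx k. \<Sum>m\<in>idxp k. of_real (s k) * (jw k i (a # m) * (jw k (c # m) l * Y l j)))
    = of_real (s k) * (\<Sum>m\<in>idxp k. jw k i (a # m) * (\<Sum>l\<in>idx k. jw k (c # m) l * Y l j))"
    by (subst sum.swap) (simp only: sum_distrib_left)
  finally show ?thesis by (simp only: pinvD(1)[OF assms])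
qed

lemma jw_mult_right:
  assumes "pinv k Y"
  shows "(\<Sum>l\<in>idx k. Y i l * jw (Suc k) (c # l) (b # j)) =
     of_bool (c = b) * Y i j - of_real (s k) * (\<Sum>m\<in>idxp k. Y i (c # m) * jw k (b # m) j)"
proof -
  have "(\<Sum>l\<in>idx k. Y i l * jw (Suc k) (c # l) (b # j)) = of_bool (c = b) * (\<Sum>l\<in>idx k. jw k l j * Y i l)
     - (\<Sum>l\<in>idx k. \<Sum>m\<in>idxp k. of_real (s k) * ((jw k l (c # m) * Y i l) * jw k (b # m) j))"
    by (simp only: jw.simps(2) right_diff_distrib sum_subtractf)
      (simp only: sum_distrib_left sum_distrib_right mult_ac)
  also have "(\<Sum>l\<in>idx k. \<Sum>m\<in>idxp k. of_real (s k) * ((jw k l (c # m) * Y i l) * jw k (b # m) j))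
    = of_real (s k) * (\<Sum>m\<in>idxp k. (\<Sum>l\<in>idx k. jw k l (c # m) * Y i l) * jw k (b # m) j)"
    by (subst sum.swap) (simp only: sum_distrib_left sum_distrib_right)
  finally show ?thesis by (simp only: pinvD(2)[OF assms])
qed

text \<open>Expand both factors p_{k+1} by Wenzl's recursion and trace. The identity terms give N Y,
  each mixed term gives - s k Y because Y = p_k Y = Y p_k, and the product of the corrections gives
  the same construction one level lower.\<close>

lemma E_Tm:
  assumes Y: "pinv (Suc q) Y"
  defines "k \<equiv> Suc q"
  shows "E (Tm k Y) i j = of_real (N - 2 * s k) * Y i j + (of_real (s k))\<^sup>2 * Tm q (E Y) i j"
proof -
  have Yk: "pinv k Y" using Y by (simp add: k_def)
  have t: "Tm k Y (a # i) (b # j) = of_bool (a = b) * Y i j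
      - of_real (s k) * (\<Sum>m\<in>idx q. jw k i (a # m) * Y (b # m) j)
      - of_real (s k) * (\<Sum>m\<in>idx q. Y i (a # m) * jw k (b # m) j)
      + (of_real (s k))\<^sup>2 * (\<Sum>m\<in>idx q. \<Sum>m'\<in>idx q. jw k i (a # m') * E Y m' m * jw k (b # m) j)" for a b
  proof -
    have "Tm k Y (a # i) (b # j) =
       (\<Sum>c\<in>UNIV. \<Sum>l\<in>idx k. jw (Suc k) (a # i) (c # l) * (\<Sum>l'\<in>idx k. Y l l' * jw (Suc k) (c # l') (b # j)))"
      unfolding Tm_def sum_distrib_left by (simp only: mult.assoc)
    also have "\<dots> = (\<Sum>c\<in>UNIV. of_bool (b = c) * (\<Sum>l\<in>idx k. jw (Suc k) (a # i) (c # l) * Y l j))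
      - of_real (s k) * (\<Sum>c\<in>UNIV. \<Sum>l\<in>idx k. \<Sum>m\<in>idx q. (jw (Suc k) (a # i) (c # l) * Y l (c # m)) * jw k (b # m) j)"
      unfolding jw_mult_right[OF Yk] right_diff_distrib sum_subtractf
      by (simp only: sum_distrib_left eq_commute[of b] k_def idxp_Suc mult_ac)
    also have "(\<Sum>c\<in>UNIV. of_bool (b = c) * (\<Sum>l\<in>idx k. jw (Suc k) (a # i) (c # l) * Y l j)) =
       of_bool (a = b) * Y i j - of_real (s k) * (\<Sum>m\<in>idx q. jw k i (a # m) * Y (b # m) j)"
      by (simp only: sum_of_bool_left jw_mult_left[OF Yk]) (simp only: k_def idxp_Suc)
    also have "(\<Sum>c\<in>UNIV. \<Sum>l\<in>idx k. \<Sum>m\<in>idx q. (jw (Suc k) (a # i) (c # l) * Y l (c # m)) * jw k (b # m) j)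
       = (\<Sum>c\<in>UNIV. \<Sum>m\<in>idx q. (\<Sum>l\<in>idx k. jw (Suc k) (a # i) (c # l) * Y l (c # m)) * jw k (b # m) j)"
      by (rule sum.cong[OF refl], subst sum.swap) (simp only: sum_distrib_right)
    also have "\<dots> = (\<Sum>m\<in>idx q. \<Sum>c\<in>UNIV. (of_bool (a = c) * Y i (c # m)) * jw k (b # m) j)
       - of_real (s k) * (\<Sum>m\<in>idx q. \<Sum>c\<in>UNIV. \<Sum>m'\<in>idx q. jw k i (a # m') * Y (c # m') (c # m) * jw k (b # m) j)"
      unfolding jw_mult_left[OF Yk] left_diff_distrib sum_subtractf
      by (subst (1 2) sum.swap) (simp only: sum_distrib_left sum_distrib_right k_def idxp_Suc mult_ac)
    also have "(\<Sum>m\<in>idx q. \<Sum>c\<in>UNIV. (of_bool (a = c) * Y i (c # m)) * jw k (b # m) j) =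
       (\<Sum>m\<in>idx q. Y i (a # m) * jw k (b # m) j)"
      by (simp only: mult.assoc sum_of_bool_left)
    also have "(\<Sum>m\<in>idx q. \<Sum>c\<in>UNIV. \<Sum>m'\<in>idx q. jw k i (a # m') * Y (c # m') (c # m) * jw k (b # m) j)
      = (\<Sum>m\<in>idx q. \<Sum>m'\<in>idx q. jw k i (a # m') * E Y m' m * jw k (b # m) j)"
      by (rule sum.cong[OF refl], subst sum.swap) (simp only: E_def sum_distrib_left sum_distrib_right)
    finally show ?thesis by (simp add: algebra_simps power2_eq_square)
  qed
  have 1: "(\<Sum>a\<in>UNIV. \<Sum>m\<in>idx q. jw k i (a # m) * Y (a # m) j) = Y i j"
    using pinvD(1)[OF Y, of i j] by (simp only: sum_idx_Suc k_def)
  have 2: "(\<Sum>a\<in>UNIV. \<Sum>m\<in>idx q. Y i (a # m) * jw k (a # m) j) = Y i j"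
    using pinvD(2)[OF Y, of j i] by (simp only: sum_idx_Suc k_def mult.commute)
  have 3: "(\<Sum>a\<in>UNIV. \<Sum>m\<in>idx q. \<Sum>m'\<in>idx q. jw k i (a # m') * E Y m' m * jw k (a # m) j) = Tm q (E Y) i j"
    unfolding Tm_def k_def by (rule sum.cong[OF refl], rule sum.swap)
  have "E (Tm k Y) i j = of_real N * Y i j - of_real (s k) * (\<Sum>a\<in>UNIV. \<Sum>m\<in>idx q. jw k i (a # m) * Y (a # m) j)
      - of_real (s k) * (\<Sum>a\<in>UNIV. \<Sum>m\<in>idx q. Y i (a # m) * jw k (a # m) j)
      + (of_real (s k))\<^sup>2 * (\<Sum>a\<in>UNIV. \<Sum>m\<in>idx q. \<Sum>m'\<in>idx q. jw k i (a # m') * E Y m' m * jw k (a # m) j)"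
    unfolding E_def[of "Tm k Y"] t
    by (simp add: sum.distrib sum_subtractf sum_distrib_left[symmetric] of_real_N)
  then show ?thesis unfolding 1 2 3 by (simp add: algebra_simps)
qed

text \<open>Pair the commutation relation \<open>E_Tm\<close> with Y and use adjointness on both
  sides. This recursion for norms drives the induction for the gap.\<close>

lemma hs_Tm:
  assumes Y: "pinv (Suc q) Y"
  shows "hs (Suc (Suc q)) (Tm (Suc q) Y) = (N - 2 * s (Suc q)) * hs (Suc q) Y + (s (Suc q))\<^sup>2 * hs q (E Y)"
proof -
  let ?k = "Suc q"
  have "ip (Suc ?k) (Tm ?k Y) (Tm ?k Y) = ip ?k Y (E (Tm ?k Y))"
    by (rule ip_Tm[OF pinv_Tm])
  also have "E (Tm ?k Y) = (\<lambda>i j. of_real (N - 2 * s ?k) * Y i j + (of_real (s ?k))\<^sup>2 * Tm q (E Y) i j)"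
    by (intro ext E_Tm Y)
  also have "ip ?k Y \<dots> = of_real (N - 2 * s ?k) * ip ?k Y Y + (of_real (s ?k))\<^sup>2 * ip ?k Y (Tm q (E Y))"
    by (simp only: ip_add_right ip_scale_right)
  also have "ip ?k Y (Tm q (E Y)) = of_real (hs q (E Y))"
    using ip_commute[of ?k Y "Tm q (E Y)"] by (simp add: ip_Tm[OF Y] ip_self)
  also have "of_real (N - 2 * s ?k) * ip ?k Y Y + (of_real (s ?k))\<^sup>2 * complex_of_real (hs q (E Y))
     = of_real ((N - 2 * s ?k) * hs ?k Y + (s ?k)\<^sup>2 * hs q (E Y))"
    by (simp only: ip_self of_real_add of_real_mult of_real_power)
  finally show ?thesis by (simp only: ip_self of_real_eq_iff)
qed

definition tra :: "nat \<Rightarrow> ('n list \<Rightarrow> 'n list \<Rightarrow> complex) \<Rightarrow> complex" where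
  "tra k X = (\<Sum>i\<in>idx k. X i i)"

lemma tra_E: "tra k (E X) = tra (Suc k) X"
  unfolding tra_def E_def sum_idx_Suc by (rule sum.swap)

lemma tra_add: "tra k (\<lambda>i j. X i j + c * Y i j) = tra k X + c * tra k Y"
  by (simp add: tra_def sum.distrib sum_distrib_left)

lemma tra_jw: "tra k (jw k) = of_real (d k)"
proof (induction k)
  case (Suc k)
  have "tra (Suc k) (jw (Suc k)) = (\<Sum>i\<in>idx k. of_real (N - s k) * jw k i i)"
    unfolding tra_E[symmetric] E_jw by (simp only: tra_def)
  also have "\<dots> = of_real (N - s k) * tra k (jw k)" by (simp only: tra_def sum_distrib_left)
  finally show ?case by (simp only: Suc d.simps(2) of_real_mult mult.commute)
qed (simp add: tra_def)

lemma ip_jw: "pinv k X \<Longrightarrow> ip k (jw k) X = tra k X"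
proof -
  assume X: "pinv k X"
  have "(\<Sum>i\<in>idx k. jw k i j * X i j) = X j j" for j
    using pinvD(1)[OF X, of j j] by (simp add: jw_sym[of k j])
  then show ?thesis unfolding ip_def tra_def cnj_jw by (subst sum.swap) simp
qed

lemma hs_jw: "hs k (jw k) = d k"
  using ip_self[of k "jw k"] ip_jw[OF pinv_jw, of k] by (simp add: tra_jw)

text \<open>The origin of the constant N / (d k)^2: since s (q + 1) = d q / d (q + 1), the factor
  s^2 carries this term from level q to level q + 1 unchanged in form.\<close>

lemma s2_gap: "(s (Suc q))\<^sup>2 * (N - s q - N / (d q)\<^sup>2) = s (Suc q) - N / (d (Suc q))\<^sup>2"
proof -
  have "(s (Suc q))\<^sup>2 * (N - s q) = s (Suc q)"
    by (simp only: power2_eq_square mult.assoc s_Suc_mult mult_1_right)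
  moreover have "(s (Suc q))\<^sup>2 * (N / (d q)\<^sup>2) = N / (d (Suc q))\<^sup>2"
    using d_pos[of q] by (simp add: s_Suc_eq power_divide)
  ultimately show ?thesis by (simp add: right_diff_distrib)
qed

text \<open>Without the subtracted term the bound is attained at p_{k+1}. With \<alpha> the constant
  at k, the norm recursion and the induction hypothesis bound the adjoint at E X by (N - 2 s) + (s -
  N / d^2) = \<alpha>; Cauchy-Schwarz for <T E X, X> = hs (E X) then gives the claim. At k = 0 the
  constant is 0 and E X is just the trace.\<close>

lemma gap:
  "pinv (Suc k) X \<Longrightarrow> tra (Suc k) X = 0 \<Longrightarrow> hs k (E X) \<le> (N - s k - N / (d k)\<^sup>2) * hs (Suc k) X"
proof (induction k arbitrary: X)
  case 0
  then have "tra 0 (E X) = 0" by (simp add: tra_E)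
  then have "E X [] [] = 0" by (simp add: tra_def)
  then show ?case by (simp add: hs_def)
next
  case (Suc q)
  let ?k = "Suc q" and ?\<alpha> = "N - s (Suc q) - N / (d (Suc q))\<^sup>2"
  have Y: "pinv ?k (E X)" by (rule pinv_E[OF Suc.prems(1)])
  have tY: "tra ?k (E X) = 0" using Suc.prems(2) by (simp add: tra_E)
  have "hs q (E (E X)) \<le> (N - s q - N / (d q)\<^sup>2) * hs ?k (E X)" by (rule Suc.IH[OF Y tY])
  then have "(s ?k)\<^sup>2 * hs q (E (E X)) \<le> (s ?k)\<^sup>2 * ((N - s q - N / (d q)\<^sup>2) * hs ?k (E X))"
    by (intro mult_left_mono) auto
  also have "\<dots> = (s ?k - N / (d ?k)\<^sup>2) * hs ?k (E X)"
    by (simp only: mult.assoc[symmetric] s2_gap)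
  finally have T: "hs (Suc ?k) (Tm ?k (E X)) \<le> ?\<alpha> * hs ?k (E X)"
    unfolding hs_Tm[OF Y] by (simp add: algebra_simps)
  have "ip (Suc ?k) (Tm ?k (E X)) X = of_real (hs ?k (E X))"
    by (simp only: ip_Tm[OF Suc.prems(1)] ip_self)
  then have "(hs ?k (E X))\<^sup>2 \<le> hs (Suc ?k) (Tm ?k (E X)) * hs (Suc ?k) X"
    using ip_Cauchy_Schwarz[of "Suc ?k" "Tm ?k (E X)" X] by simp
  also have "\<dots> \<le> ?\<alpha> * hs ?k (E X) * hs (Suc ?k) X"
    by (intro mult_right_mono T hs_nonneg)
  finally have *: "hs ?k (E X) * hs ?k (E X) \<le> (?\<alpha> * hs (Suc ?k) X) * hs ?k (E X)"
    by (simp only: power2_eq_square mult_ac)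
  show ?case
  proof (cases "hs ?k (E X) = 0")
    case True
    \<comment> \<open>The factor hs (E X) cannot be cancelled when it is 0; then it is enough that
      the constant is nonnegative, which follows from d \<ge> 2.\<close>
    have "N / (d ?k)\<^sup>2 \<le> N / 2\<^sup>2"
    proof (rule divide_left_mono)
      have "d ?k \<ge> 2"
        by (induction q) (use d_Suc_ge[of 0] d_Suc_ge in \<open>auto intro: order_trans simp: d.simps(1)\<close>, smt (verit) d_Suc_ge)
      then show "2\<^sup>2 \<le> (d ?k)\<^sup>2" by (intro power_mono) auto
    qed (use N_ge d_pos[of ?k] in auto)
    then have "N / (d ?k)\<^sup>2 \<le> N / 4" by simp
    then have "?\<alpha> \<ge> 0" using s_bounds[of ?k] N_ge by linarith
    then show ?thesis using True hs_nonneg by simp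
  next
    case False
    then have "hs ?k (E X) > 0" using hs_nonneg[of ?k "E X"] by linarith
    then show ?thesis using * by simp
  qed
qed

section \<open>Traceless parts and the energy of a sequence of matrices\<close>

definition traceless :: "nat \<Rightarrow> ('n list \<Rightarrow> 'n list \<Rightarrow> complex) \<Rightarrow> 'n list \<Rightarrow> 'n list \<Rightarrow> complex" where
  "traceless k X = (\<lambda>i j. X i j + (- tra k X / of_real (d k)) * jw k i j)"

text \<open>Pythagoras: traceless endomorphisms are orthogonal to p_k, whose squared norm is d
  k.\<close>

lemma hs_traceless:
  assumes "pinv k X"
  shows "hs k (\<lambda>i j. X i j + c * jw k i j) = hs k (traceless k X) + (cmod (tra k X / of_real (d k) + c))\<^sup>2 * d k"
proof -
  have c: "hs k (\<lambda>i j. X i j + c * jw k i j) = hs k X + 2 * Re (c * cnj (tra k X)) + (cmod c)\<^sup>2 * d k" for c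
    unfolding hs_add hs_jw ip_commute[of k X "jw k"] ip_jw[OF assms] ..
  have "2 * Re (c * cnj t) + (cmod c)\<^sup>2 * r =
     2 * Re ((- t / of_real r) * cnj t) + (cmod (- t / of_real r))\<^sup>2 * r + (cmod (t / of_real r + c))\<^sup>2 * r"
    if "r > 0" for r t
    unfolding cmod_power2 using that by (simp add: field_simps power2_eq_square)
  from this[OF d_pos, of "tra k X" k] show ?thesis unfolding traceless_def c by simp
qed

text \<open>For multiples of p_k the two terms on the left cancel exactly, and the splitting is
  orthogonal before and after \<open>E\<close>. Only the traceless part remains, and there the gap
  applies.\<close>

lemma traceless_props:
  assumes "pinv (Suc q) X"
  shows "s (Suc q) * hs (Suc q) X - (s (Suc q))\<^sup>2 * hs q (E X) \<ge> N / (d (Suc q))\<^sup>2 * hs (Suc q) (traceless (Suc q) X)"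
proof -
  let ?k = "Suc q"
  define t where "t = tra ?k X / of_real (d ?k)"
  have p: "pinv ?k (traceless ?k X)" unfolding traceless_def by (intro pinv_add assms pinv_jw)
  have tr0: "tra ?k (traceless ?k X) = 0"
    using d_pos[of ?k] unfolding traceless_def tra_add tra_jw by simp
  have hX: "hs ?k X = hs ?k (traceless ?k X) + (cmod t)\<^sup>2 * d ?k"
    using hs_traceless[OF assms, of 0] by (simp add: t_def)
  have EX: "E X = (\<lambda>i j. E (traceless ?k X) i j + (t * of_real (N - s q)) * jw q i j)"
  proof -
    have "X = (\<lambda>i j. traceless ?k X i j + t * jw ?k i j)"
      by (simp add: traceless_def t_def)
    then have "E X = (\<lambda>i j. E (traceless ?k X) i j + t * E (jw ?k) i j)"
      by (metis E_add)
    then show ?thesis by (simp only: E_jw mult.assoc)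
  qed
  have "tra q (E (traceless ?k X)) = 0" using tr0 by (simp add: tra_E)
  then have "ip q (E (traceless ?k X)) (jw q) = 0"
    using ip_jw[OF pinv_E[OF p]] ip_commute[of q _ "jw q"] by simp
  then have f1: "hs q (E X) = hs q (E (traceless ?k X)) + (cmod t)\<^sup>2 * (N - s q)\<^sup>2 * d q"
    unfolding EX hs_add hs_jw using N_minus_s[of q]
    by (simp add: norm_mult power_mult_distrib del: of_real_diff)
  have f2: "(s ?k)\<^sup>2 * ((cmod t)\<^sup>2 * (N - s q)\<^sup>2 * d q) = (cmod t)\<^sup>2 * d q"
  proof -
    have "(s ?k)\<^sup>2 * (N - s q)\<^sup>2 = 1" by (simp only: power_mult_distrib[symmetric] s_Suc_mult one_power2)
    then show ?thesis by (metis (no_types, lifting) mult.assoc mult.commute mult.right_neutral)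
  qed
  have f3: "s ?k * ((cmod t)\<^sup>2 * d ?k) = (cmod t)\<^sup>2 * d q"
    using d_pos[of ?k] by (simp add: s_Suc_eq)
  have "(s ?k)\<^sup>2 * hs q (E (traceless ?k X)) \<le> (s ?k - N / (d ?k)\<^sup>2) * hs ?k (traceless ?k X)"
    using mult_left_mono[OF gap[OF p tr0], of "(s ?k)\<^sup>2"] by (simp only: mult.assoc[symmetric] s2_gap) simp
  then have f4: "(s ?k)\<^sup>2 * hs q (E (traceless ?k X)) \<le>
      s ?k * hs ?k (traceless ?k X) - N / (d ?k)\<^sup>2 * hs ?k (traceless ?k X)"
    by (simp only: left_diff_distrib)
  have "s ?k * hs ?k X - (s ?k)\<^sup>2 * hs q (E X) =
      s ?k * hs ?k (traceless ?k X) - (s ?k)\<^sup>2 * hs q (E (traceless ?k X))"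
    unfolding hX f1 distrib_left f2 f3 by simp
  then show ?thesis using f4 by linarith
qed

lemma hs_E_le:
  assumes "pinv (Suc q) X"
  shows "s (Suc q) * hs q (E X) \<le> hs (Suc q) X"
proof -
  have "0 \<le> N / (d (Suc q))\<^sup>2 * hs (Suc q) (traceless (Suc q) X)"
    using N_ge hs_nonneg by simp
  then have "s (Suc q) * (s (Suc q) * hs q (E X)) \<le> s (Suc q) * hs (Suc q) X"
    using traceless_props[OF assms] by (simp add: power2_eq_square mult.assoc)
  then show ?thesis using s_Suc_pos[of q] by (simp only: mult_le_cancel_left_pos)
qed

text \<open>If \<phi> k i j = f (v k i j) with f linear and j in \<open>idx k\<close>, this is f
  applied to v k i j * u_ab - \<delta>_ab v k i j, expanded by the fusion rule.\<close>

definition grad :: "nat \<Rightarrow> (nat \<Rightarrow> 'n list \<Rightarrow> 'n list \<Rightarrow> complex) \<Rightarrow> 'n \<Rightarrow> 'n list \<Rightarrow> 'n \<Rightarrow> 'n list \<Rightarrow> complex" where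
  "grad k \<phi> a i b j = \<phi> (Suc k) (a # i) (b # j)
     + of_real (s k) * (\<Sum>m\<in>idxp k. \<Sum>m'\<in>idxp k. jw k i (a # m) * jw k (b # m') j * \<phi> (k - 1) m m')
     - of_bool (a = b) * \<phi> k i j"

text \<open>Regroups the four indices of a gradient into a matrix at level k + 1, so that
  \<open>hs\<close> and \<open>ip\<close> apply to it.\<close>

definition of_blocks :: "('n \<Rightarrow> 'n list \<Rightarrow> 'n \<Rightarrow> 'n list \<Rightarrow> complex) \<Rightarrow> 'n list \<Rightarrow> 'n list \<Rightarrow> complex" where
  "of_blocks F x y = (case (x, y) of (a # i, b # j) \<Rightarrow> F a i b j | _ \<Rightarrow> 0)"

lemma of_blocks_Cons [simp]: "of_blocks F (a # i) (b # j) = F a i b j" by (simp add: of_blocks_def)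

lemma ip_Suc: "ip (Suc k) X Y = (\<Sum>a\<in>UNIV. \<Sum>i\<in>idx k. \<Sum>b\<in>UNIV. \<Sum>j\<in>idx k. cnj (X (a # i) (b # j)) * Y (a # i) (b # j))"
  by (simp add: ip_def sum_idx_Suc)

text \<open>The gradient is A + s k * B - C, from the levels above, below and at k. A and B are
  orthogonal because caps kill p. Of N * hs k (\<phi> k), the norm of C, a share N - s k completes a
  square with A. The remaining share s k pays for the square with level q, and what it leaves over
  is bounded below by the gap.\<close>

lemma energy:
  fixes q :: nat
  assumes p: "\<And>k. pinv k (\<phi> k)"
  defines "k \<equiv> Suc q"
  shows "hs q (\<lambda>i j. \<phi> q i j + (- of_real (s k)) * E (\<phi> k) i j) + N / (d k)\<^sup>2 * hs k (traceless k (\<phi> k))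
    \<le> hs (Suc k) (of_blocks (grad k \<phi>))"
proof -
  define A where "A = \<phi> (Suc k)"
  define B where "B = of_blocks (\<lambda>a i b j. \<Sum>m\<in>idx q. \<Sum>m'\<in>idx q. jw k i (a # m) * jw k (b # m') j * \<phi> q m m')"
  define C where "C = of_blocks (\<lambda>a i b j. of_bool (a = b) * \<phi> k i j)"
  have pk: "pinv (Suc q) (\<phi> k)" unfolding k_def by (rule p)
  have sw: "(\<Sum>a\<in>P. \<Sum>i\<in>Q. \<Sum>b\<in>R. \<Sum>j\<in>S. \<Sum>m\<in>M. \<Sum>m'\<in>M'. f a i b j m m') =
     (\<Sum>m\<in>M. \<Sum>m'\<in>M'. \<Sum>a\<in>P. \<Sum>b\<in>R. \<Sum>i\<in>Q. \<Sum>j\<in>S. f a i b j m m')"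
    for P Q R S M M' and f :: "'n \<Rightarrow> 'n list \<Rightarrow> 'n \<Rightarrow> 'n list \<Rightarrow> 'n list \<Rightarrow> 'n list \<Rightarrow> complex"
  proof -
    have "(\<Sum>a\<in>P. \<Sum>i\<in>Q. \<Sum>b\<in>R. \<Sum>j\<in>S. \<Sum>m\<in>M. \<Sum>m'\<in>M'. f a i b j m m') =
      (\<Sum>a\<in>P. \<Sum>b\<in>R. \<Sum>i\<in>Q. \<Sum>j\<in>S. \<Sum>m\<in>M. \<Sum>m'\<in>M'. f a i b j m m')"
      by (rule sum.cong[OF refl], rule sum.swap)
    also have "\<dots> = (\<Sum>a\<in>P. \<Sum>b\<in>R. \<Sum>i\<in>Q. \<Sum>m\<in>M. \<Sum>m'\<in>M'. \<Sum>j\<in>S. f a i b j m m')"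
      by (intro sum.cong[OF refl]) (subst sum.swap, rule sum.cong[OF refl], rule sum.swap)
    also have "\<dots> = (\<Sum>a\<in>P. \<Sum>b\<in>R. \<Sum>m\<in>M. \<Sum>m'\<in>M'. \<Sum>i\<in>Q. \<Sum>j\<in>S. f a i b j m m')"
      by (intro sum.cong[OF refl]) (subst sum.swap, rule sum.cong[OF refl], rule sum.swap)
    also have "\<dots> = (\<Sum>a\<in>P. \<Sum>m\<in>M. \<Sum>m'\<in>M'. \<Sum>b\<in>R. \<Sum>i\<in>Q. \<Sum>j\<in>S. f a i b j m m')"
      by (intro sum.cong[OF refl]) (subst sum.swap, rule sum.cong[OF refl], rule sum.swap)
    also have "\<dots> = (\<Sum>m\<in>M. \<Sum>m'\<in>M'. \<Sum>a\<in>P. \<Sum>b\<in>R. \<Sum>i\<in>Q. \<Sum>j\<in>S. f a i b j m m')"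
      by (subst sum.swap, rule sum.cong[OF refl], rule sum.swap)
    finally show ?thesis .
  qed
  have BX: "ip (Suc k) B X = (\<Sum>m\<in>idx q. \<Sum>m'\<in>idx q. cnj (\<phi> q m m') *
     (\<Sum>a\<in>UNIV. \<Sum>b\<in>UNIV. \<Sum>i\<in>idx k. jw k i (a # m) * (\<Sum>j\<in>idx k. jw k (b # m') j * X (a # i) (b # j))))" for X
    unfolding ip_Suc B_def of_blocks_Cons cnj_sum complex_cnj_mult cnj_jw sum_distrib_right sw
    by (simp only: sum_distrib_left mult_ac)
  have AA: "ip (Suc k) A A = of_real (hs (Suc k) A)" by (rule ip_self)
  have CC: "ip (Suc k) C C = of_real (N * hs k (\<phi> k))"
  proof -
    have "ip (Suc k) C C = (\<Sum>a::'n\<in>UNIV. \<Sum>i\<in>idx k. \<Sum>j\<in>idx k. cnj (\<phi> k i j) * \<phi> k i j)"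
    proof -
      have "(\<Sum>b\<in>UNIV. \<Sum>j\<in>idx k. cnj (of_bool (a = b) * \<phi> k i j) * (of_bool (a = b) * \<phi> k i j)) =
         (\<Sum>j\<in>idx k. cnj (\<phi> k i j) * \<phi> k i j)" for a :: 'n and i
      proof -
        have "cnj (of_bool P * z) * (of_bool P * z) = of_bool P * (cnj z * z)" for P z
          by (cases P) simp_all
        then show ?thesis
          using sum_of_bool_left[of a "\<lambda>b. \<Sum>j\<in>idx k. cnj (\<phi> k i j) * \<phi> k i j"]
          by (simp only: sum_distrib_left)
      qed
      then show ?thesis unfolding ip_Suc C_def of_blocks_Cons by simp
    qed
    also have "\<dots> = of_nat CARD('n) * ip k (\<phi> k) (\<phi> k)" by (simp add: ip_def)
    finally show ?thesis by (simp add: ip_self of_real_N)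
  qed
  have collapse: "(\<Sum>b\<in>UNIV. \<Sum>j\<in>idx k. F b j * (of_bool (a = b) * G j)) = (\<Sum>j\<in>idx k. F a j * G j)"
    for a :: 'n and F and G :: "'n list \<Rightarrow> complex"
    using sum_of_bool_left[of a "\<lambda>b. \<Sum>j\<in>idx k. F b j * G j"]
    by (simp only: sum_distrib_left mult_ac)
  have AC: "ip (Suc k) A C = ip k (E A) (\<phi> k)"
  proof -
    have "ip (Suc k) A C = (\<Sum>a\<in>UNIV. \<Sum>i\<in>idx k. \<Sum>j\<in>idx k. cnj (A (a # i) (a # j)) * \<phi> k i j)"
      unfolding ip_Suc C_def of_blocks_Cons collapse ..
    also have "\<dots> = (\<Sum>i\<in>idx k. \<Sum>j\<in>idx k. \<Sum>a\<in>UNIV. cnj (A (a # i) (a # j)) * \<phi> k i j)"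
      by (subst sum.swap, rule sum.cong[OF refl], rule sum.swap)
    finally show ?thesis by (simp only: ip_def E_def cnj_sum sum_distrib_right)
  qed
  have BA: "ip (Suc k) B A = 0"
  proof -
    have "(\<Sum>j\<in>idx k. jw k (b # m') j * A x (b # j)) = A x (b # b # m')" for b m' x
      using pinv_sub(2)[OF p[of "Suc k"], of "b # m'" x b] by (simp only: A_def jw_sym[of k "_ # _"])
    moreover have "(\<Sum>i\<in>idx k. jw k i (a # m) * A (a # i) y) = A (a # a # m) y" for a m y
      using pinv_sub(1)[OF p[of "Suc k"], of "a # m" a y] by (simp only: A_def jw_sym[of k "_ # _"])
    ultimately have "ip (Suc k) B A = (\<Sum>m\<in>idx q. \<Sum>m'\<in>idx q. cnj (\<phi> q m m') *
      (\<Sum>a\<in>UNIV. \<Sum>b\<in>UNIV. A (a # a # m) (b # b # m')))"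
      unfolding BX by simp
    also have "\<dots> = (\<Sum>m\<in>idx q. \<Sum>m'\<in>idx q. cnj (\<phi> q m m') *
      (\<Sum>b\<in>UNIV. \<Sum>a\<in>UNIV. A (a # a # m) (b # b # m')))"
      by (intro sum.cong refl arg_cong2[where f = "(*)"] sum.swap)
    finally show ?thesis using pinv_cap[OF p[of "Suc (Suc q)"]] by (simp add: A_def k_def)
  qed
  have BC: "ip (Suc k) B C = ip q (\<phi> q) (E (\<phi> k))"
  proof -
    have "(\<Sum>a\<in>UNIV. \<Sum>b\<in>UNIV. \<Sum>i\<in>idx k. jw k i (a # m) * (\<Sum>j\<in>idx k. jw k (b # m') j * C (a # i) (b # j))) = E (\<phi> k) m m'" for m m'
    proof -
      have "(\<Sum>b\<in>UNIV. \<Sum>i\<in>idx k. jw k i (a # m) * (\<Sum>j\<in>idx k. jw k (b # m') j * C (a # i) (b # j))) = \<phi> k (a # m) (a # m')" for a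
      proof -
        have "(\<Sum>b\<in>UNIV. \<Sum>i\<in>idx k. jw k i (a # m) * (\<Sum>j\<in>idx k. jw k (b # m') j * C (a # i) (b # j)))
          = (\<Sum>b\<in>UNIV. of_bool (a = b) * (\<Sum>i\<in>idx k. jw k i (a # m) * (\<Sum>j\<in>idx k. jw k (b # m') j * \<phi> k i j)))"
          unfolding C_def of_blocks_Cons by (simp only: sum_distrib_left mult_ac)
        also have "\<dots> = (\<Sum>i\<in>idx k. jw k i (a # m) * (\<Sum>j\<in>idx k. jw k (a # m') j * \<phi> k i j))"
          by (rule sum_of_bool_left)
        also have "\<dots> = \<phi> k (a # m) (a # m')"
          using pinvD(1)[OF p[of k], of "a # m" "a # m'"] pinvD(2)[OF p[of k], of "a # m'"]
          by (simp only: jw_sym[of k "_ # _"])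
        finally show ?thesis .
      qed
      then show ?thesis by (simp add: E_def)
    qed
    then show ?thesis unfolding BX ip_def[of q] by simp
  qed
  have BB: "(s k)\<^sup>2 * hs (Suc k) B = hs q (\<phi> q)"
  proof -
    have "(\<Sum>a\<in>UNIV. \<Sum>b\<in>UNIV. \<Sum>i\<in>idx k. jw k i (a # m) * (\<Sum>j\<in>idx k. jw k (b # m') j * B (a # i) (b # j)))
       = (of_real (N - s q))\<^sup>2 * \<phi> q m m'" for m m'
    proof -
      have "(\<Sum>a\<in>UNIV. \<Sum>b\<in>UNIV. \<Sum>i\<in>idx k. jw k i (a # m) * (\<Sum>j\<in>idx k. jw k (b # m') j * B (a # i) (b # j)))
        = (\<Sum>a\<in>UNIV. \<Sum>b\<in>UNIV. \<Sum>i\<in>idx k. \<Sum>j\<in>idx k. \<Sum>r\<in>idx q. \<Sum>r'\<in>idx q.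
            (jw k (a # m) i * jw k i (a # r)) * ((jw k (b # r') j * jw k j (b # m')) * \<phi> q r r'))"
        unfolding B_def of_blocks_Cons sum_distrib_left by (simp only: jw_sym[of k "a # m" for a :: 'n] jw_sym[of k _ "b # m'" for b :: 'n] mult_ac)
      also have "\<dots> = (\<Sum>r\<in>idx q. \<Sum>r'\<in>idx q. \<Sum>a\<in>UNIV. \<Sum>b\<in>UNIV. \<Sum>i\<in>idx k. \<Sum>j\<in>idx k.
            (jw k (a # m) i * jw k i (a # r)) * ((jw k (b # r') j * jw k j (b # m')) * \<phi> q r r'))"
        by (subst sw[symmetric], rule sum.cong[OF refl], rule sum.swap)
      also have "\<dots> = (\<Sum>r\<in>idx q. \<Sum>r'\<in>idx q. (\<Sum>a\<in>UNIV. jw k (a # m) (a # r)) * ((\<Sum>b\<in>UNIV. jw k (b # r') (b # m')) * \<phi> q r r'))"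
        by (simp only: sum_distrib_left[symmetric] sum_distrib_right[symmetric] jw_idem)
      also have "\<dots> = (of_real (N - s q))\<^sup>2 * (\<Sum>r\<in>idx q. jw q m r * (\<Sum>r'\<in>idx q. jw q r' m' * \<phi> q r r'))"
        unfolding k_def jw_ptrace by (simp only: sum_distrib_left power2_eq_square mult_ac)
      finally show ?thesis by (simp only: pinvD[OF p[of q]])
    qed
    then have "ip (Suc k) B B = (of_real (N - s q))\<^sup>2 * ip q (\<phi> q) (\<phi> q)"
      unfolding BX ip_def[of q] by (simp add: sum_distrib_left mult_ac)
    then have "complex_of_real (hs (Suc k) B) = of_real ((N - s q)\<^sup>2 * hs q (\<phi> q))"
      by (simp only: ip_self of_real_mult of_real_power)
    then have "hs (Suc k) B = (N - s q)\<^sup>2 * hs q (\<phi> q)" by (simp only: of_real_eq_iff)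
    moreover have "(s k)\<^sup>2 * (N - s q)\<^sup>2 = 1"
      unfolding k_def by (simp only: power_mult_distrib[symmetric] s_Suc_mult one_power2)
    ultimately show ?thesis by (simp only: mult.assoc[symmetric] mult_1_left)
  qed
  have hsC: "hs (Suc k) C = N * hs k (\<phi> k)" using CC unfolding ip_self of_real_eq_iff .
  have AB: "ip (Suc k) A B = 0" using BA ip_commute[of "Suc k" A B] by simp
  let ?G = "of_blocks (grad k \<phi>)"
  have "hs (Suc k) ?G = hs (Suc k) (\<lambda>x y. (A x y + of_real (s k) * B x y) + (-1) * C x y)"
    unfolding hs_def sum_idx_Suc by (simp add: A_def B_def C_def grad_def k_def)
  also have "\<dots> = hs (Suc k) A + (s k)\<^sup>2 * hs (Suc k) B + N * hs k (\<phi> k)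
      - 2 * Re (ip (Suc k) (\<lambda>x y. A x y + of_real (s k) * B x y) C)"
    unfolding hs_add[of _ _ "-1"] hs_add[of _ A] AB hsC by simp
  also have "ip (Suc k) (\<lambda>x y. A x y + of_real (s k) * B x y) C = ip (Suc k) A C + of_real (s k) * ip (Suc k) B C"
    by (simp add: ip_def distrib_right distrib_left sum.distrib sum_distrib_left mult_ac)
  finally have G: "hs (Suc k) ?G = hs (Suc k) A + hs q (\<phi> q) + N * hs k (\<phi> k)
      - 2 * Re (ip k (E A) (\<phi> k)) - 2 * s k * Re (ip q (\<phi> q) (E (\<phi> k)))"
    unfolding AC BC BB by simp
  have b2: "hs q (\<lambda>i j. \<phi> q i j + (- of_real (s k)) * E (\<phi> k) i j) =
      hs q (\<phi> q) - 2 * s k * Re (ip q (\<phi> q) (E (\<phi> k))) + (s k)\<^sup>2 * hs q (E (\<phi> k))"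
    unfolding hs_add by simp
  \<comment> \<open>Multiply the square of \<phi> k - s (k + 1) * E A by N - s k = 1 / s (k + 1),
    after bounding s (k + 1) * hs (E A) by hs A.\<close>
  have b1: "0 \<le> hs (Suc k) A + (N - s k) * hs k (\<phi> k) - 2 * Re (ip k (E A) (\<phi> k))"
  proof -
    have "0 \<le> hs k (\<lambda>i j. \<phi> k i j + (- of_real (s (Suc k))) * E A i j)" by (rule hs_nonneg)
    then have "0 \<le> hs k (\<phi> k) - 2 * s (Suc k) * Re (ip k (E A) (\<phi> k)) + s (Suc k) * (s (Suc k) * hs k (E A))"
      unfolding hs_add using ip_commute[of k "E A" "\<phi> k"] by (simp add: power2_eq_square mult.assoc)
    also have "\<dots> \<le> hs k (\<phi> k) - 2 * s (Suc k) * Re (ip k (E A) (\<phi> k)) + s (Suc k) * hs (Suc k) A"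
      using hs_E_le[OF p[of "Suc k"]] s_Suc_pos[of k] by (simp add: A_def)
    finally have "0 \<le> (N - s k) * (hs k (\<phi> k) - 2 * s (Suc k) * Re (ip k (E A) (\<phi> k)) + s (Suc k) * hs (Suc k) A)"
      using N_minus_s[of k] by (intro mult_nonneg_nonneg) auto
    also have "\<dots> = (N - s k) * hs k (\<phi> k) - 2 * (s (Suc k) * (N - s k)) * Re (ip k (E A) (\<phi> k)) + (s (Suc k) * (N - s k)) * hs (Suc k) A"
      by (simp add: algebra_simps)
    finally show ?thesis unfolding s_Suc_mult by simp
  qed
  show ?thesis
    using b1 b2 G traceless_props[OF pk] unfolding k_def[symmetric] by (simp add: left_diff_distrib)
qed

text \<open>The term \<open>N / (d k)\<^sup>2\<close> in the energy estimate is just large enough to force the normalized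
  traceless parts of \<open>\<phi> k\<close> to \<open>0\<close>; the other term then transports this decay from infinity inwards.\<close>

lemma finite_energy_imp_constant:
  fixes G :: "nat \<Rightarrow> real"
  assumes p: "\<And>k. pinv k (\<phi> k)"
    and G: "\<And>q. hs (Suc (Suc q)) (of_blocks (grad (Suc q) \<phi>)) \<le> G (Suc q)"
    and G0: "\<And>q. G q \<ge> 0" and sumG: "summable (\<lambda>k. d k * G k)"
  shows "\<exists>\<tau>. summable (\<lambda>k. d k * hs k (\<lambda>i j. \<phi> k i j + (- \<tau>) * jw k i j))"
proof -
  \<comment> \<open>The factor s (q + 1) normalizes \<open>E\<close> so that it sends p_{q+1} to p_q
    and preserves normalized traces. Z is the resulting defect between neighbouring levels.\<close>
  define Z where "Z q = (\<lambda>i j. \<phi> q i j + (- of_real (s (Suc q))) * E (\<phi> (Suc q)) i j)" for q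
  define t where "t k = tra k (\<phi> k) / of_real (d k)" for k
  define \<gamma> where "\<gamma> k = sqrt (d k * G k)" for k
  have \<gamma>0: "\<gamma> k \<ge> 0" for k by (simp add: \<gamma>_def G0 d_pos less_imp_le)
  have \<gamma>2: "(\<gamma> k)\<^sup>2 = d k * G k" for k by (simp add: \<gamma>_def G0 d_pos less_imp_le)
  have en: "hs q (Z q) + N / (d (Suc q))\<^sup>2 * hs (Suc q) (traceless (Suc q) (\<phi> (Suc q))) \<le> G (Suc q)" for q
    using energy[of \<phi> q, OF p] G[of q] by (simp add: Z_def)
  have N0: "0 \<le> N / (d (Suc q))\<^sup>2 * hs (Suc q) (traceless (Suc q) (\<phi> (Suc q)))" for q
    using N_ge hs_nonneg by simp
  have hsZ: "hs q (Z q) \<le> G (Suc q)" for q using en[of q] N0[of q] by linarith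
  have Gd: "sqrt (G (Suc q) / d q) \<le> \<gamma> (Suc q) / d q" for q
  proof -
    have "d q \<le> d (Suc q)" using d_Suc_ge[of q] d_pos[of q] by linarith
    then have "d q * G (Suc q) \<le> d (Suc q) * G (Suc q)" by (intro mult_right_mono G0)
    then have "G (Suc q) / d q \<le> (\<gamma> (Suc q) / d q)\<^sup>2"
      using d_pos[of q] by (simp add: power_divide \<gamma>2) (simp add: field_simps power2_eq_square)
    then show ?thesis using \<gamma>0 d_pos[of q] by (intro real_le_lsqrt) (auto simp: less_imp_le)
  qed
  have zZ: "sqrt (hs q (Z q) / d q) \<le> \<gamma> (Suc q) / d q" for q
    by (rule order_trans[OF _ Gd]) (use hsZ d_pos[of q] in \<open>simp add: divide_right_mono less_imp_le\<close>)
  have tstep: "cmod (t q - t (Suc q)) \<le> \<gamma> (Suc q) / d q" for q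
  proof -
    have "tra q (Z q) = tra q (\<phi> q) - of_real (s (Suc q)) * tra (Suc q) (\<phi> (Suc q))"
      unfolding Z_def tra_add tra_E by simp
    then have "of_real (d q) * (t q - t (Suc q)) = tra q (Z q)"
      using d_pos[of q] d_pos[of "Suc q"]
      by (simp add: t_def s_Suc_eq right_diff_distrib)
    moreover have "(cmod (tra q (Z q)))\<^sup>2 \<le> d q * hs q (Z q)"
    proof -
      have "pinv q (Z q)" unfolding Z_def by (intro pinv_add p pinv_E)
      then show ?thesis using ip_Cauchy_Schwarz[of q "jw q" "Z q"] by (simp add: ip_jw hs_jw)
    qed
    ultimately have "(d q)\<^sup>2 * (cmod (t q - t (Suc q)))\<^sup>2 \<le> d q * hs q (Z q)"
      by (metis norm_mult norm_of_real power2_abs power_mult_distrib)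
    then have "(cmod (t q - t (Suc q)))\<^sup>2 \<le> hs q (Z q) / d q"
      using d_pos[of q] by (simp add: field_simps power2_eq_square)
    then show ?thesis by (intro order_trans[OF _ zZ] real_le_rsqrt)
  qed
  have s\<gamma>: "summable (\<lambda>k. (\<gamma> k)\<^sup>2)" unfolding \<gamma>2 by (rule sumG)
  have dpow: "d k \<ge> 2 ^ k" for k
  proof (induction k)
    case (Suc k) then show ?case using d_Suc_ge[of k] by simp
  qed simp
  \<comment> \<open>The increments are at most \<gamma> / d, a product of two square summable
    sequences, so the normalized traces t converge. Their limit is \<tau>.\<close>
  have "summable (\<lambda>q. t (Suc q) - t q)"
  proof (rule summable_comparison_test'[of "\<lambda>q. (\<gamma> (Suc q))\<^sup>2 + (1/4) ^ q" 0])
    show "summable (\<lambda>q. (\<gamma> (Suc q))\<^sup>2 + (1 / 4) ^ q)"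
      by (intro summable_add summable_geometric)
        (use summable_Suc_iff[of "\<lambda>k. (\<gamma> k)\<^sup>2"] s\<gamma> in auto)
    fix q :: nat
    have "(1 / d q)\<^sup>2 \<le> (1 / 2 ^ q)\<^sup>2"
      using dpow[of q] d_pos[of q] by (intro power_mono divide_left_mono) auto
    also have "\<dots> = (1/4) ^ q" by (simp add: power_divide power2_eq_square flip: power_mult_distrib)
    finally have "(1 / d q)\<^sup>2 \<le> (1/4) ^ q" .
    moreover have "\<gamma> (Suc q) * (1 / d q) \<le> (\<gamma> (Suc q))\<^sup>2 + (1 / d q)\<^sup>2"
      using sum_squares_bound[of "\<gamma> (Suc q)" "1 / d q"] zero_le_power2[of "\<gamma> (Suc q)"] zero_le_power2[of "1 / d q"]
        mult_nonneg_nonneg[OF \<gamma>0[of "Suc q"], of "1 / d q"] d_pos[of q] by (simp add: power2_eq_square)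
    ultimately show "norm (t (Suc q) - t q) \<le> (\<gamma> (Suc q))\<^sup>2 + (1 / 4) ^ q"
      using tstep[of q] by (simp add: norm_minus_commute)
  qed
  then have "convergent (\<lambda>n. \<Sum>q<n. t (Suc q) - t q)" by (simp add: summable_iff_convergent)
  then have "convergent (\<lambda>n. t n - t 0)" by (simp add: sum_lessThan_telescope)
  then obtain l where "(\<lambda>n. t n - t 0) \<longlonglongrightarrow> l" unfolding convergent_def by blast
  then have "(\<lambda>n. (t n - t 0) + t 0) \<longlonglongrightarrow> l + t 0" by (intro tendsto_intros)
  then have tl: "t \<longlonglongrightarrow> l + t 0" by simp
  define \<tau> where "\<tau> = l + t 0"
  define Y where "Y k = (\<lambda>i j. \<phi> k i j + (- \<tau>) * jw k i j)" for k
  have pY: "pinv k (Y k)" for k unfolding Y_def by (intro pinv_add p pinv_jw)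
  have hsY: "hs k (Y k) = hs k (traceless k (\<phi> k)) + (cmod (t k - \<tau>))\<^sup>2 * d k" for k
    using hs_traceless[OF p, of k "- \<tau>"] by (simp add: Y_def t_def)
  define y where "y k = sqrt (hs k (Y k) / d k)" for k
  \<comment> \<open>The gap bounds the traceless part by (d k)^2 * G k. After division by d k this
    is the general term of the given summable series.\<close>
  have "(\<lambda>k. hs (Suc k) (traceless (Suc k) (\<phi> (Suc k))) / d (Suc k)) \<longlonglongrightarrow> 0"
  proof (rule real_tendsto_sandwich[OF _ _ tendsto_const])
    have "(\<lambda>k. d (Suc k) * G (Suc k)) \<longlonglongrightarrow> 0"
      using summable_LIMSEQ_zero[OF sumG] by (rule LIMSEQ_Suc)
    then show "(\<lambda>k. d (Suc k) * G (Suc k)) \<longlonglongrightarrow> 0" .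
    show "\<forall>\<^sub>F k in sequentially. 0 \<le> hs (Suc k) (traceless (Suc k) (\<phi> (Suc k))) / d (Suc k)"
      by (intro always_eventually allI divide_nonneg_pos hs_nonneg d_pos)
    have "hs (Suc k) (traceless (Suc k) (\<phi> (Suc k))) / d (Suc k) \<le> d (Suc k) * G (Suc k)" for k
    proof -
      let ?x = "hs (Suc k) (traceless (Suc k) (\<phi> (Suc k)))"
      have "1 * ?x / (d (Suc k))\<^sup>2 \<le> N * ?x / (d (Suc k))\<^sup>2"
        using N_ge by (intro divide_right_mono mult_right_mono hs_nonneg) auto
      then have "?x / (d (Suc k))\<^sup>2 \<le> G (Suc k)" using en[of k] hs_nonneg[of k "Z k"] by simp
      then have "d (Suc k) * (?x / (d (Suc k))\<^sup>2) \<le> d (Suc k) * G (Suc k)"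
        using d_pos[of "Suc k"] by (intro mult_left_mono) auto
      then show ?thesis using d_pos[of "Suc k"] by (simp add: power2_eq_square split: if_splits)
    qed
    then show "\<forall>\<^sub>F k in sequentially. hs (Suc k) (traceless (Suc k) (\<phi> (Suc k))) / d (Suc k) \<le> d (Suc k) * G (Suc k)"
      by (intro always_eventually allI)
  qed
  then have a1: "(\<lambda>k. hs k (traceless k (\<phi> k)) / d k) \<longlonglongrightarrow> 0" by (rule LIMSEQ_imp_Suc)
  have a2: "(\<lambda>k. (cmod (t k - \<tau>))\<^sup>2) \<longlonglongrightarrow> (cmod (\<tau> - \<tau>))\<^sup>2"
    using tl unfolding \<tau>_def[symmetric] by (intro tendsto_intros)
  have "y = (\<lambda>k. sqrt (hs k (traceless k (\<phi> k)) / d k + (cmod (t k - \<tau>))\<^sup>2))"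
  proof
    show "y k = sqrt (hs k (traceless k (\<phi> k)) / d k + (cmod (t k - \<tau>))\<^sup>2)" for k
      using d_pos[of k] by (simp add: y_def hsY add_divide_distrib)
  qed
  then have y0: "y \<longlonglongrightarrow> 0" using tendsto_real_sqrt[OF tendsto_add[OF a1 a2]] by simp
  have ystep: "y q \<le> \<gamma> (Suc q) / d q + y (Suc q)" for q
  proof -
    let ?k = "Suc q"
    \<comment> \<open>Subtracting \<tau> times p_k at every level does not change Z, as normalized
      \<open>E\<close> preserves these matrices.\<close>
    have "Y q = (\<lambda>i j. Z q i j + of_real (s ?k) * E (Y ?k) i j)"
    proof (intro ext)
      fix i j
      have "complex_of_real (s ?k) * of_real (N - s q) = 1"
        by (simp only: of_real_mult[symmetric] s_Suc_mult of_real_1)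
      then have f: "of_real (s ?k) * (\<tau> * (of_real (N - s q) * jw q i j)) = \<tau> * jw q i j"
        by (metis mult.assoc mult.commute mult_1_left)
      show "Y q i j = Z q i j + of_real (s ?k) * E (Y ?k) i j"
        unfolding Y_def Z_def E_add E_jw
        by (simp only: distrib_left mult_minus_left mult_minus_right f) simp
    qed
    then have "sqrt (hs q (Y q)) \<le> sqrt (hs q (Z q)) + s ?k * sqrt (hs q (E (Y ?k)))"
      using hs_triangle[of q "Z q" "of_real (s ?k)" "E (Y ?k)"] s_bounds[of ?k] by simp
    also have "s ?k * sqrt (hs q (E (Y ?k))) = sqrt (s ?k * (s ?k * hs q (E (Y ?k))))"
      using s_bounds[of ?k] by (simp add: real_sqrt_mult)
    also have "\<dots> \<le> sqrt (s ?k * hs ?k (Y ?k))"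
      using hs_E_le[OF pY[of ?k]] s_bounds[of ?k] by (intro real_sqrt_le_mono mult_left_mono) auto
    finally have "sqrt (hs q (Y q)) / sqrt (d q) \<le> (sqrt (hs q (Z q)) + sqrt (s ?k * hs ?k (Y ?k))) / sqrt (d q)"
      by (intro divide_right_mono) (use d_pos[of q] in auto)
    also have "\<dots> = sqrt (hs q (Z q) / d q) + sqrt (s ?k * hs ?k (Y ?k) / d q)"
      by (simp add: add_divide_distrib real_sqrt_divide)
    also have "s ?k * hs ?k (Y ?k) / d q = hs ?k (Y ?k) / d ?k"
      using d_pos[of q] by (simp add: s_Suc_eq)
    finally show ?thesis using zZ[of q] by (simp add: y_def real_sqrt_divide)
  qed
  have "summable (\<lambda>k. (d k * y k)\<^sup>2)"
    by (rule summable_weighted_decay[OF d_pos d_Suc_ge \<gamma>0 s\<gamma> _ y0 ystep])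
      (simp add: y_def hs_nonneg d_pos less_imp_le)
  moreover have "(d k * y k)\<^sup>2 = d k * hs k (Y k)" for k
    using d_pos[of k] hs_nonneg[of k "Y k"] by (simp add: power_mult_distrib y_def) (simp add: power2_eq_square)
  ultimately have "summable (\<lambda>k. d k * hs k (Y k))" by simp
  then show ?thesis unfolding Y_def by blast
qed

end

section \<open>The Haar state\<close>

lemma star_one: "star (1 :: 'a::star_algebra_1) = 1"
  by (metis mult.right_neutral mult_1 star_mult star_star)

locale Ao_gns = large_Ao T N for T :: "'n::finite itself" and N :: real +
  fixes h :: "'n Ao \<Rightarrow> complex" and \<pi> :: "'n Ao \<Rightarrow> 'h::complex_hilbert_space bop" and \<xi> :: 'h
  assumes haar: "haar_state coproduct h" and gns: "gns_representation h \<pi> \<xi>"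
begin

lemma h_linear: "h (x + y) = h x + h y" "h (c *\<^sub>C x) = c * h x" "h 1 = 1"
  using haar unfolding haar_state_def is_state_def clinear_iff by (simp_all add: scaleC_complex_def)

lemma h_zero [simp]: "h 0 = 0" using h_linear(2)[of 0 0] by simp

lemma h_sum: "h (\<Sum>x\<in>A. f x) = (\<Sum>x\<in>A. h (f x))"
  by (induction A rule: infinite_finite_induct) (simp_all add: h_linear)

lemma haar_right: 
  assumes "coproduct x = (\<Sum>l\<in>A. f l \<otimes>\<^sub>t g l)"
  shows "(\<Sum>l\<in>A. h (g l) *\<^sub>C f l) = h x *\<^sub>C 1"
proof -
  have lin: "clinear (\<lambda>a. h b *\<^sub>C a)" "clinear (\<lambda>b. h b *\<^sub>C a)" for a b :: "'n Ao"
    unfolding clinear_iff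
    by (simp_all add: h_linear scaleC_add_left scaleC_add_right scaleC_scaleC mult.commute)
  have L: "clinear (tensor_lift (\<lambda>a b. h b *\<^sub>C (a :: 'n Ao)))"
    by (intro clinear_tensor_lift lin)
  have "tensor_lift (\<lambda>a b. h b *\<^sub>C a) (coproduct x) = h x *\<^sub>C 1"
    using haar unfolding haar_state_def by blast
  moreover have "tensor_lift (\<lambda>a b. h b *\<^sub>C a) (\<Sum>l\<in>A. f l \<otimes>\<^sub>t g l) = (\<Sum>l\<in>A. h (g l) *\<^sub>C f l)"
  proof -
    interpret t: Vector_Spaces.linear scaleC scaleC "tensor_lift (\<lambda>a b. h b *\<^sub>C (a :: 'n Ao))" by (rule L)
    show ?thesis by (simp add: t.sum tensor_lift_pure[OF lin])
  qed
  ultimately show ?thesis by (simp add: assms)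
qed

lemma haar_left: 
  assumes "coproduct x = (\<Sum>l\<in>A. f l \<otimes>\<^sub>t g l)"
  shows "(\<Sum>l\<in>A. h (f l) *\<^sub>C g l) = h x *\<^sub>C 1"
proof -
  have lin: "clinear (\<lambda>b. h a *\<^sub>C b)" "clinear (\<lambda>a. h a *\<^sub>C b)" for a b :: "'n Ao"
    unfolding clinear_iff
    by (simp_all add: h_linear scaleC_add_left scaleC_add_right scaleC_scaleC mult.commute)
  have L: "clinear (tensor_lift (\<lambda>a b. h a *\<^sub>C (b :: 'n Ao)))"
    by (intro clinear_tensor_lift lin)
  have "tensor_lift (\<lambda>a b. h a *\<^sub>C b) (coproduct x) = h x *\<^sub>C 1"
    using haar unfolding haar_state_def by blast
  moreover have "tensor_lift (\<lambda>a b. h a *\<^sub>C b) (\<Sum>l\<in>A. f l \<otimes>\<^sub>t g l) = (\<Sum>l\<in>A. h (f l) *\<^sub>C g l)"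
  proof -
    interpret t: Vector_Spaces.linear scaleC scaleC "tensor_lift (\<lambda>a b. h a *\<^sub>C (b :: 'n Ao))" by (rule L)
    show ?thesis by (simp add: t.sum tensor_lift_pure[OF lin(2,1)])
  qed
  ultimately show ?thesis by (simp add: assms)
qed

lemma coproduct_mult: "coproduct (x * y) = coproduct x * coproduct (y :: 'n Ao)"
  and coproduct_one: "coproduct (1 :: 'n Ao) = 1"
  using unital_algebra_hom_coproduct unfolding unital_algebra_hom_def by blast+

lemma coproduct_U: "i \<in> idx k \<Longrightarrow> j \<in> idx k \<Longrightarrow> coproduct (U i j) = (\<Sum>l\<in>idx k. U i l \<otimes>\<^sub>t U l j)"
proof (induction k arbitrary: i j)
  case 0
  then show ?case by (simp add: coproduct_one pure_tensor_one)
next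
  case (Suc k)
  obtain a i' b j' where ij: "i = a # i'" "i' \<in> idx k" "j = b # j'" "j' \<in> idx k"
    using Suc.prems by (metis idx_SucE)
  have "coproduct (U i j) = (\<Sum>l\<in>idx k. \<Sum>c\<in>UNIV. (U i' l * u_gen a c) \<otimes>\<^sub>t (U l j' * u_gen c b))"
    by (simp add: ij(1,3) coproduct_mult Suc.IH[OF ij(2,4)] coproduct_u sum_product pure_tensor_mult)
  also have "\<dots> = (\<Sum>c\<in>UNIV. \<Sum>l\<in>idx k. (U i' l * u_gen a c) \<otimes>\<^sub>t (U l j' * u_gen c b))"
    by (rule sum.swap)
  finally show ?case by (simp add: sum_idx_Suc ij(1,3))
qed

text \<open>By invariance h (v i j) 1 is a combination of the coefficients v i l of the same level k
  + 1. The vacuum functional vanishes on these and is 1 at 1.\<close>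

lemma h_v_Suc: "h (v (Suc k) i j) = 0"
proof (cases "i \<in> idx (Suc k) \<and> j \<in> idx (Suc k)")
  case True
  then have i: "i \<in> idx (Suc k)" and j: "j \<in> idx (Suc k)" by auto
  have "(\<Sum>l\<in>idx (Suc k). h (U l j) *\<^sub>C v (Suc k) i l) =
     (\<Sum>l\<in>idx (Suc k). \<Sum>i'\<in>idx (Suc k). jw (Suc k) i i' *\<^sub>C h (U l j) *\<^sub>C U i' l)"
    by (simp add: v_def complex_vector.scale_sum_right scaleC_scaleC mult.commute del: jw.simps)
  also have "\<dots> = (\<Sum>i'\<in>idx (Suc k). jw (Suc k) i i' *\<^sub>C (\<Sum>l\<in>idx (Suc k). h (U l j) *\<^sub>C U i' l))"
    by (subst sum.swap) (simp add: complex_vector.scale_sum_right del: jw.simps)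
  also have "\<dots> = (\<Sum>i'\<in>idx (Suc k). jw (Suc k) i i' *\<^sub>C h (U i' j) *\<^sub>C 1)"
    by (intro sum.cong refl arg_cong2[where f = scaleC] haar_right coproduct_U j)
  also have "\<dots> = h (v (Suc k) i j) *\<^sub>C 1"
    by (simp add: v_def h_sum h_linear complex_vector.scale_sum_left scaleC_scaleC del: jw.simps)
  finally have "ev vacuum (h (v (Suc k) i j) *\<^sub>C 1) = ev vacuum (\<Sum>l\<in>idx (Suc k). h (U l j) *\<^sub>C v (Suc k) i l)"
    by simp
  also have "\<dots> = (\<Sum>l\<in>idx (Suc k). h (U l j) * vacuum i l)"
    by (simp add: ev_sum ev_linear valid_vacuum ev_v i)
  also have "\<dots> = 0" using i by (intro sum.neutral) (auto simp: vacuum_def idx_def)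
  finally show ?thesis by (simp add: ev_linear valid_vacuum) (simp add: vacuum_def)
qed (use v_outside in auto)

lemma h_v: "i \<in> idx k \<Longrightarrow> j \<in> idx k \<Longrightarrow> h (v k i j) = of_bool (k = 0)"
  by (cases k) (simp_all add: h_v_Suc, simp add: v_def scaleC_one h_linear)

lemma sum_orth_left:
  "(\<Sum>a\<in>UNIV. u_gen a e * (\<Sum>c\<in>UNIV. u_gen a c * f c)) = f (e::'n)"
proof -
  have "(\<Sum>a\<in>UNIV. u_gen a e * (\<Sum>c\<in>UNIV. u_gen a c * f c)) =
     (\<Sum>c\<in>UNIV. (\<Sum>a\<in>UNIV. u_gen a e * u_gen a c) * f c)"
    by (simp add: sum_distrib_left sum_distrib_right mult.assoc) (rule sum.swap)
  also have "\<dots> = (\<Sum>c\<in>UNIV. if e = c then f c else 0)"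
    by (rule sum.cong) (auto simp: u_orthogonal)
  finally show ?thesis by simp
qed

lemma sum_orth_right:
  "(\<Sum>b\<in>UNIV. (\<Sum>c\<in>UNIV. f c * u_gen c b) * u_gen e b) = f (e::'n)"
proof -
  have "(\<Sum>b\<in>UNIV. (\<Sum>c\<in>UNIV. f c * u_gen c b) * u_gen e b) =
     (\<Sum>c\<in>UNIV. f c * (\<Sum>b\<in>UNIV. u_gen c b * u_gen e b))"
    by (simp add: sum_distrib_left sum_distrib_right mult.assoc) (rule sum.swap)
  also have "\<dots> = (\<Sum>c\<in>UNIV. if c = e then f c else 0)"
    by (rule sum.cong) (auto simp: u_orthogonal)
  finally show ?thesis by simp
qed

text \<open>Both \<open>h (u\<^sub>a\<^sub>b U\<^sub>i\<^sub>j)\<close> and \<open>h (U\<^sub>i\<^sub>j u\<^sub>a\<^sub>b)\<close> are matrices of idempotents onto fixed vectors. Orthogonality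
  of \<open>u\<close> allows to rotate fixed vectors, so the two idempotents have the same range and kernel.\<close>

lemma h_u_commute_U:
  assumes i: "i \<in> idx k" and j: "j \<in> idx k"
  shows "h (u_gen a b * U i j) = h (U i j * u_gen a b)"
proof -
  define W where "W a i b j = h (u_gen a b * U i j)" for a i b j
  define W' where "W' a i b j = h (U i j * u_gen a b)" for a i b j
  have 1: "(\<Sum>c\<in>UNIV. u_gen a c * (\<Sum>l\<in>idx k. W c l b j *\<^sub>C U i l)) = W a i b j *\<^sub>C 1"
    if "i \<in> idx k" "j \<in> idx k" for a i b j
  proof -
    have "coproduct (u_gen a b * U i j) =
       (\<Sum>(c, l)\<in>UNIV \<times> idx k. (u_gen a c * U i l) \<otimes>\<^sub>t (u_gen c b * U l j))"
      using that by (simp add: coproduct_mult coproduct_U coproduct_u sum_product pure_tensor_mult sum.cartesian_product)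
    then have "(\<Sum>p\<in>UNIV \<times> idx k. h (u_gen (fst p) b * U (snd p) j) *\<^sub>C (u_gen a (fst p) * U i (snd p))) = W a i b j *\<^sub>C 1"
      unfolding W_def by (intro haar_right) (simp add: case_prod_unfold)
    then show ?thesis
      by (simp add: W_def sum.cartesian_product[symmetric, where g = "\<lambda>c l. h (u_gen c b * U l j) *\<^sub>C (u_gen a c * U i l)", unfolded case_prod_unfold]
          sum_distrib_left mult_scaleC_right)
  qed
  have 2: "(\<Sum>c\<in>UNIV. (\<Sum>l\<in>idx k. W' a i c l *\<^sub>C U l j) * u_gen c b) = W' a i b j *\<^sub>C 1"
    if "i \<in> idx k" "j \<in> idx k" for a i b j
  proof -
    have "coproduct (U (a # i) (b # j)) = (\<Sum>l\<in>idx (Suc k). U (a # i) l \<otimes>\<^sub>t U l (b # j))"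
      using that by (intro coproduct_U) auto
    from haar_left[OF this] show ?thesis
      by (simp add: sum_idx_Suc W'_def sum_distrib_right mult_scaleC_left)
  qed
  have r1: "(\<Sum>l\<in>idx k. W e l b j *\<^sub>C U i l) = (\<Sum>a\<in>UNIV. W a i b j *\<^sub>C u_gen a e)" for e b
    using sum_orth_left[of e "\<lambda>c. \<Sum>l\<in>idx k. W c l b j *\<^sub>C U i l"]
    by (simp add: 1[OF i j] mult_scaleC_right)
  have r2: "(\<Sum>l\<in>idx k. W' a i e l *\<^sub>C U l j) = (\<Sum>b\<in>UNIV. W' a i b j *\<^sub>C u_gen e b)" for e a
    using sum_orth_right[of "\<lambda>c. \<Sum>l\<in>idx k. W' a i c l *\<^sub>C U l j" e]
    by (simp add: 2[OF i j] mult_scaleC_left)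
  \<comment> \<open>The columns of W are thus fixed vectors also for the product in the opposite
    order, and applying h yields W' W = W. The rows of W' yield W' W = W' in the same way.\<close>
  have "(\<Sum>e\<in>UNIV. (\<Sum>l\<in>idx k. W e l b j *\<^sub>C U i l) * u_gen a e) = W a i b j *\<^sub>C 1"
  proof -
    have "(\<Sum>e\<in>UNIV. (\<Sum>l\<in>idx k. W e l b j *\<^sub>C U i l) * u_gen a e) =
        (\<Sum>e\<in>UNIV. (\<Sum>c\<in>UNIV. (W c i b j *\<^sub>C 1) * u_gen c e) * u_gen a e)"
      by (simp add: r1 mult_scaleC_left)
    then show ?thesis by (simp only: sum_orth_right)
  qed
  then have "h (\<Sum>e\<in>UNIV. (\<Sum>l\<in>idx k. W e l b j *\<^sub>C U i l) * u_gen a e) = W a i b j"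
    by (simp add: h_linear)
  then have WW1: "(\<Sum>e\<in>UNIV. \<Sum>l\<in>idx k. W' a i e l * W e l b j) = W a i b j"
    by (simp add: sum_distrib_right h_sum mult_scaleC_left h_linear W'_def mult.commute)
  have "(\<Sum>e\<in>UNIV. u_gen e b * (\<Sum>l\<in>idx k. W' a i e l *\<^sub>C U l j)) = W' a i b j *\<^sub>C 1"
  proof -
    have "(\<Sum>e\<in>UNIV. u_gen e b * (\<Sum>l\<in>idx k. W' a i e l *\<^sub>C U l j)) =
       (\<Sum>e\<in>UNIV. u_gen e b * (\<Sum>c\<in>UNIV. u_gen e c * (W' a i c j *\<^sub>C 1)))"
      by (simp add: r2 mult_scaleC_right)
    then show ?thesis by (simp only: sum_orth_left)
  qed
  then have "h (\<Sum>e\<in>UNIV. u_gen e b * (\<Sum>l\<in>idx k. W' a i e l *\<^sub>C U l j)) = W' a i b j"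
    by (simp add: h_linear)
  then have "(\<Sum>e\<in>UNIV. \<Sum>l\<in>idx k. W' a i e l * W e l b j) = W' a i b j"
    by (simp add: sum_distrib_left h_sum mult_scaleC_right h_linear W_def mult.commute)
  with WW1 show ?thesis by (simp add: W_def W'_def)
qed

lemma h_u_commute: "h (u_gen a b * x) = h (x * u_gen a b)"
proof (induction x rule: v_induct)
  case (v k i j)
  then show ?case
    by (simp add: v_def sum_distrib_left sum_distrib_right h_sum mult_scaleC_left mult_scaleC_right h_linear h_u_commute_U)
qed (simp_all add: distrib_left distrib_right h_linear mult_scaleC_left mult_scaleC_right)

text \<open>It suffices to move one generator at a time around the product.\<close>

lemma h_trace: "h (x * y) = h (y * x)"
proof (induction y arbitrary: x rule: Ao_induct)
  case (mult y a b)
  have "h (x * (y * u_gen a b)) = h (u_gen a b * x * y)"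
    using h_u_commute[of a b "x * y"] by (simp add: mult.assoc)
  also have "\<dots> = h (y * u_gen a b * x)" using mult[of "u_gen a b * x"] by (simp add: mult.assoc)
  finally show ?case .
qed (simp_all add: distrib_left distrib_right h_linear mult_scaleC_left mult_scaleC_right)

text \<open>Transfer the letters of U one at a time to v by the fusion rule. As l \<le> k, the
  upward term never reaches level 0 and contributes nothing; the downward term shortens both sides,
  and s k / d (k - 1) = 1 / d k yields the denominator.\<close>

lemma h_v_star_U:
  "i \<in> idx k \<Longrightarrow> j \<in> idx k \<Longrightarrow> i' \<in> idx l \<Longrightarrow> j' \<in> idx l \<Longrightarrow> l \<le> k \<Longrightarrow>
    h (v k i j * star (U i' j')) = of_bool (k = l) * jw k i i' * jw k j' j / of_real (d k)"
proof (induction l arbitrary: k i j i' j')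
  case 0
  then show ?case by (cases k) (auto simp: star_one h_v)
next
  case (Suc l)
  obtain a i1 b j1 where ij: "i' = a # i1" "i1 \<in> idx l" "j' = b # j1" "j1 \<in> idx l"
    using Suc.prems by (metis idx_SucE)
  obtain q where k: "k = Suc q" using Suc.prems(5) by (cases k) auto
  have "v k i j * star (U i' j') = (v k i j * u_gen a b) * star (U i1 j1)"
    by (simp add: ij(1,3) star_mult star_u mult.assoc)
  also have "\<dots> = v (Suc k) (a # i) (b # j) * star (U i1 j1) + of_real (s k) *\<^sub>C
     (\<Sum>m\<in>idx q. \<Sum>m'\<in>idx q. (jw k i (a # m) * jw k (b # m') j) *\<^sub>C (v q m m' * star (U i1 j1)))"
    using Suc.prems(2) by (simp add: v_mult_u[of j k] distrib_right sum_distrib_right mult_scaleC_left) (simp add: k)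
  finally have "h (v k i j * star (U i' j')) = h (v (Suc k) (a # i) (b # j) * star (U i1 j1)) + of_real (s k) *
     (\<Sum>m\<in>idx q. \<Sum>m'\<in>idx q. (jw k i (a # m) * jw k (b # m') j) * h (v q m m' * star (U i1 j1)))"
    by (simp add: h_linear h_sum)
  also have "h (v (Suc k) (a # i) (b # j) * star (U i1 j1)) = 0"
    using Suc.IH[of "a # i" "Suc k" "b # j" i1 j1] Suc.prems ij by simp
  also have "(\<Sum>m\<in>idx q. \<Sum>m'\<in>idx q. (jw k i (a # m) * jw k (b # m') j) * h (v q m m' * star (U i1 j1)))
     = (\<Sum>m\<in>idx q. \<Sum>m'\<in>idx q. (jw k i (a # m) * jw k (b # m') j) * (of_bool (q = l) * jw q m i1 * jw q j1 m' / of_real (d q)))"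
    using Suc.IH[of _ q _ i1 j1] Suc.prems(5) ij k by (intro sum.cong refl arg_cong2[where f = "(*)"]) auto
  also have "\<dots> = of_bool (q = l) / of_real (d q) *
     ((\<Sum>m\<in>idx q. jw k i (a # m) * jw q m i1) * (\<Sum>m'\<in>idx q. jw q j1 m' * jw k (b # m') j))"
    by (subst sum_product) (simp add: sum_distrib_left mult_ac)
  also have "\<dots> = of_bool (q = l) / of_real (d q) * (jw k i i' * jw k j' j)"
    by (simp only: k jw_sub jw_sub' ij)
  finally show ?case using d_pos[of q] by (simp add: k s_Suc_eq)
qed

lemma h_v_star_v:
  assumes "i \<in> idx k" "j \<in> idx k" "i' \<in> idx l" "j' \<in> idx l" "l \<le> k"
  shows "h (v k i j * star (v l i' j')) = of_bool (k = l) * jw k i i' * jw k j j' / of_real (d k)"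
proof -
  have star_sum: "star (\<Sum>x\<in>A. f x) = (\<Sum>x\<in>A. star (f x))" for A and f :: "'n list \<Rightarrow> 'n Ao"
  proof (induction A rule: infinite_finite_induct)
    case (infinite A) then show ?case using star_scaleC[of 0 "0::'n Ao"] by simp
  next
    case empty then show ?case using star_scaleC[of 0 "0::'n Ao"] by simp
  qed (simp add: star_add)
  have "h (v k i j * star (v l i' j')) = (\<Sum>m\<in>idx l. jw l i' m * h (v k i j * star (U m j')))"
    by (simp add: v_def[of l] star_sum star_scaleC sum_distrib_left mult_scaleC_right h_sum h_linear)
  also have "\<dots> = (\<Sum>m\<in>idx l. jw l i' m * (of_bool (k = l) * jw k i m * jw k j' j / of_real (d k)))"
    using assms by (simp add: h_v_star_U)
  also have "\<dots> = of_bool (k = l) * (\<Sum>m\<in>idx l. jw k i m * jw l m i') * jw k j' j / of_real (d k)"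
    by (simp add: sum_distrib_left sum_distrib_right sum_divide_distrib jw_sym[of l i'] mult_ac)
  finally show ?thesis by (cases "k = l") (simp_all add: jw_idem jw_sym[of l j])
qed

section \<open>GNS vectors of the coefficients and Bessel's inequality\<close>

lemma \<pi>_hom: "\<pi> (x + y) = \<pi> x + \<pi> y" "\<pi> (c *\<^sub>C x) = c *\<^sub>C \<pi> x" "\<pi> 1 = 1" "\<pi> (x * y) = \<pi> x * \<pi> y"
  using gns unfolding gns_representation_def unital_algebra_hom_def clinear_iff by blast+

lemma op_\<pi>: "apply_op (\<pi> (x + y)) \<eta> = apply_op (\<pi> x) \<eta> + apply_op (\<pi> y) \<eta>"
  "apply_op (\<pi> (c *\<^sub>C x)) \<eta> = c *\<^sub>C apply_op (\<pi> x) \<eta>" "apply_op (\<pi> 1) \<eta> = \<eta>"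
  "apply_op (\<pi> (x * y)) \<eta> = apply_op (\<pi> x) (apply_op (\<pi> y) \<eta>)"
  by (simp_all add: \<pi>_hom plus_bop.rep_eq scaleC_bop.rep_eq one_bop.rep_eq times_bop.rep_eq)

lemma \<pi>_star: "cinner (apply_op (\<pi> (star x)) \<eta>) \<zeta> = cinner \<eta> (apply_op (\<pi> x) \<zeta>)"
  using gns unfolding gns_representation_def by blast

lemma h_eq: "h x = cinner \<xi> (apply_op (\<pi> x) \<xi>)"
  using gns unfolding gns_representation_def by blast

lemma \<xi>_cyclic: "closure (range (\<lambda>x. apply_op (\<pi> x) \<xi>)) = UNIV"
  using gns unfolding gns_representation_def by blast

lemma h_star: "h (star x) = cnj (h x)"
  unfolding h_eq by (subst cinner_commute) (simp only: \<pi>_star)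

lemma cinner_star_\<xi>: "cinner (apply_op (\<pi> (star x)) \<xi>) (apply_op (\<pi> (star y)) \<xi>) = h (x * star y)"
  by (simp add: \<pi>_star h_eq op_\<pi>)

text \<open>The star is there so that <e k i j, \<eta>> = <\<xi>, \<pi> (v k i j) \<eta>>, the
  quantity in which the gradient is expressed.\<close>

definition e :: "nat \<Rightarrow> 'n list \<Rightarrow> 'n list \<Rightarrow> 'h" where
  "e k i j = apply_op (\<pi> (star (v k i j))) \<xi>"

lemma cinner_e_e:
  "cinner (e k i j) (e l i' j') = of_bool (k = l) * jw k i i' * jw k j j' / of_real (d k)"
proof (cases "i \<in> idx k \<and> j \<in> idx k \<and> i' \<in> idx l \<and> j' \<in> idx l")
  case True
  show ?thesis
  proof (cases "l \<le> k")
    case le: True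
    then show ?thesis using True by (simp add: e_def cinner_star_\<xi> h_v_star_v)
  next
    case False
    have "h (v k i j * star (v l i' j')) = cnj (h (v l i' j' * star (v k i j)))"
      by (simp add: h_star[symmetric] star_mult star_star)
    also have "\<dots> = 0" using True False by (simp add: h_v_star_v)
    finally show ?thesis using False by (simp add: e_def cinner_star_\<xi>)
  qed
next
  case False
  have s0: "star 0 = (0 :: 'n Ao)" using star_scaleC[of 0 "0 :: 'n Ao"] by simp
  have "v k i j = 0 \<or> v l i' j' = 0" using False v_outside by blast
  then have "cinner (e k i j) (e l i' j') = 0" by (auto simp: e_def cinner_star_\<xi> s0)
  then show ?thesis using False by (auto simp: jw_outside)
qed

text \<open>The vector of block k whose inner products with \<open>e k i j\<close> are X i j, for X
  an endomorphism of V_k. The factor d k cancels the denominator in the orthogonality relations and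
  is the source of the weights d k in all norms.\<close>

definition syn :: "nat \<Rightarrow> ('n list \<Rightarrow> 'n list \<Rightarrow> complex) \<Rightarrow> 'h" where
  "syn k X = of_real (d k) *\<^sub>C (\<Sum>i\<in>idx k. \<Sum>j\<in>idx k. X i j *\<^sub>C e k i j)"

lemma cinner_e_syn:
  assumes "pinv k X"
  shows "cinner (e l i j) (syn k X) = of_bool (k = l) * X i j"
proof (cases "k = l")
  case True
  have "cinner (e l i j) (syn k X) = (\<Sum>i'\<in>idx k. jw k i i' * (\<Sum>j'\<in>idx k. jw k j' j * X i' j'))"
    using d_pos[of k] True
    by (simp add: syn_def cinner_scaleC_right cinner_sum_right cinner_e_e sum_distrib_left jw_sym[of l j] mult_ac)
  then show ?thesis using True assms by (auto simp: pinvD)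
qed (simp add: syn_def cinner_scaleC_right cinner_sum_right cinner_e_e)

lemma cinner_syn_syn:
  assumes "pinv l Y"
  shows "cinner (syn k X) (syn l Y) = of_real (d k) * of_bool (k = l) * (\<Sum>i\<in>idx k. \<Sum>j\<in>idx k. cnj (X i j) * Y i j)"
  by (simp add: syn_def[of k] cinner_scaleC_left cinner_sum_left cinner_e_syn[OF assms] sum_distrib_left mult_ac)

lemma norm_syn: "pinv k X \<Longrightarrow> (norm (syn k X))\<^sup>2 = d k * hs k X"
proof -
  assume "pinv k X"
  then have "complex_of_real ((norm (syn k X))\<^sup>2) = of_real (d k * hs k X)"
    unfolding cinner_self[symmetric] by (simp add: cinner_syn_syn hs_def cnj_mult_self)
  then show ?thesis by (simp only: of_real_eq_iff)
qed

text \<open>The sum of the \<open>syn\<close> vectors is the orthogonal projection of \<eta> to the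
  first K blocks, so its norm is at most that of \<eta>.\<close>

lemma Bessel:
  "(\<Sum>k<K. d k * hs k (\<lambda>i j. cinner (e k i j) \<eta>)) \<le> (norm \<eta>)\<^sup>2"
proof -
  let ?g = "\<lambda>k i j. cinner (e k i j) \<eta>"
  have p: "pinv k (?g k)" for k
    unfolding e_def \<pi>_star by (rule pinv_linear_v) (simp_all add: op_\<pi> cinner_add_right cinner_scaleC_right)
  let ?w = "\<Sum>k<K. syn k (?g k)"
  have a: "cinner (syn k (?g k)) \<eta> = of_real (d k * hs k (?g k))" for k
    by (simp add: syn_def cinner_scaleC_left cinner_sum_left hs_def cnj_mult_self)
  have "(norm ?w)\<^sup>2 = (\<Sum>k<K. (norm (syn k (?g k)))\<^sup>2)"
    by (rule norm_sum_orthogonal) (simp_all add: cinner_syn_syn p)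
  then have w: "(norm ?w)\<^sup>2 = (\<Sum>k<K. d k * hs k (?g k))" by (simp add: norm_syn p)
  have b: "cinner ?w \<eta> = of_real (\<Sum>k<K. d k * hs k (?g k))"
    by (simp add: cinner_sum_left a)
  then have b': "cinner \<eta> ?w = of_real (\<Sum>k<K. d k * hs k (?g k))"
    by (simp only: cinner_commute[of \<eta>] complex_cnj_complex_of_real)
  have "(norm (\<eta> - ?w))\<^sup>2 = (norm \<eta>)\<^sup>2 - (\<Sum>k<K. d k * hs k (?g k))"
    using b b' w unfolding norm_power2_cinner
    by (simp add: cinner_diff_left cinner_diff_right del: of_real_sum)
  then show ?thesis using zero_le_power2[of "norm (\<eta> - ?w)"] by linarith
qed

end

section \<open>Square-integrable cocycles are inner\<close>

context large_Ao begin

lemma counit_hom: "counit (x * y) = counit x * counit (y :: 'n Ao)" "counit (1 :: 'n Ao) = 1"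
  "counit (x + y) = counit x + counit (y :: 'n Ao)" "counit (c *\<^sub>C x) = c * counit (x :: 'n Ao)"
  using unital_algebra_hom_counit[where ?'n = 'n] unfolding unital_algebra_hom_def clinear_iff
  by (simp_all add: scaleC_complex_def)

lemma counit_sum: "counit (\<Sum>x\<in>A. f x) = (\<Sum>x\<in>A. counit (f x :: 'n Ao))"
proof (induction A rule: infinite_finite_induct)
  case (infinite A) then show ?case using counit_hom(4)[of 0 0] by simp
next
  case empty then show ?case using counit_hom(4)[of 0 0] by simp
qed (simp add: counit_hom)

lemma counit_U: "length i = length j \<Longrightarrow> counit (U i j) = of_bool (i = j)"
  by (induction i j rule: U.induct) (auto simp: counit_hom counit_u)

text \<open>The family p_k belongs to the counit; hence subtracting \<tau> p_k at all levels
  subtracts \<tau> times the counit from the functional.\<close>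

lemma counit_v: "j \<in> idx k \<Longrightarrow> counit (v k i j) = jw k i j"
proof -
  assume j: "j \<in> idx k"
  have "counit (v k i j) = (\<Sum>l\<in>idx k. if l = j then jw k i l else 0)"
    unfolding v_def counit_sum counit_hom
    by (rule sum.cong[OF refl]) (use j in \<open>auto simp: counit_U idx_def\<close>)
  then show ?thesis using j by simp
qed

end

context Ao_gns begin

lemma cocycle_inner:
  fixes \<eta> :: "'n Ao \<Rightarrow> 'h"
  assumes add: "\<And>x y. \<eta> (x + y) = \<eta> x + \<eta> y" and scale: "\<And>c x. \<eta> (c *\<^sub>C x) = c *\<^sub>C \<eta> x"
    and cocycle: "\<And>x y. \<eta> (x * y) = apply_op (\<pi> x) (\<eta> y) + counit y *\<^sub>C \<eta> x"
  shows "\<exists>\<zeta>. \<forall>x. \<eta> x = apply_op (\<pi> x) \<zeta> - counit x *\<^sub>C \<zeta>"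
proof -
  define \<phi> where "\<phi> x = cinner \<xi> (\<eta> x)" for x
  have \<phi>_add: "\<phi> (x + y) = \<phi> x + \<phi> y" and \<phi>_scale: "\<phi> (c *\<^sub>C x) = c * \<phi> x" for x y c
    by (simp_all add: \<phi>_def add scale cinner_add_right cinner_scaleC_right)
  have \<phi>0: "\<phi> 0 = 0" using \<phi>_scale[of 0 0] by simp
  have \<phi>_sum: "\<phi> (\<Sum>l\<in>A. g l) = (\<Sum>l\<in>A. \<phi> (g l))" for A and g :: "'n list \<Rightarrow> 'n Ao"
    by (induction A rule: infinite_finite_induct) (simp_all add: \<phi>_add \<phi>0)
  define F where "F k i j = \<phi> (v k i j)" for k i j
  have F: "pinv k (F k)" for k
    unfolding F_def by (rule pinv_linear_v) (simp_all add: \<phi>_add \<phi>_scale)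
  define G where "G k = (\<Sum>a\<in>UNIV. \<Sum>b\<in>UNIV. hs k (\<lambda>i j. cinner (e k i j) (\<eta> (u_gen a b))))" for k
  have \<phi>_mult: "\<phi> (x * y) = cinner \<xi> (apply_op (\<pi> x) (\<eta> y)) + counit y * \<phi> x" for x y
    by (simp add: \<phi>_def cocycle cinner_add_right cinner_scaleC_right)
  have grad: "grad k F a i b j = cinner (e k i j) (\<eta> (u_gen a b))" if "j \<in> idx k" for k a i b j
  proof -
    have "\<phi> (v k i j * u_gen a b) = F (Suc k) (a # i) (b # j)
     + of_real (s k) * (\<Sum>m\<in>idxp k. \<Sum>m'\<in>idxp k. jw k i (a # m) * jw k (b # m') j * F (k - 1) m m')"
      by (simp add: v_mult_u[OF that] \<phi>_add \<phi>_scale \<phi>_sum F_def)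
    moreover have "\<phi> (v k i j * u_gen a b) = cinner (e k i j) (\<eta> (u_gen a b)) + of_bool (a = b) * F k i j"
      by (simp add: \<phi>_mult counit_u e_def \<pi>_star F_def)
    ultimately show ?thesis unfolding grad_def by (metis add_diff_cancel_right')
  qed
  have Gk: "hs (Suc k) (of_blocks (grad k F)) \<le> G k" for k
  proof -
    have "hs (Suc k) (of_blocks (grad k F)) =
      (\<Sum>a\<in>UNIV. \<Sum>i\<in>idx k. \<Sum>b\<in>UNIV. \<Sum>j\<in>idx k. (cmod (cinner (e k i j) (\<eta> (u_gen a b))))\<^sup>2)"
      unfolding hs_def sum_idx_Suc of_blocks_Cons by (intro sum.cong refl) (simp add: grad)
    also have "\<dots> = G k"
      unfolding G_def hs_def by (rule sum.cong[OF refl], rule sum.swap)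
    finally show ?thesis by simp
  qed
  have G0: "G k \<ge> 0" for k unfolding G_def by (intro sum_nonneg hs_nonneg)
  have "summable (\<lambda>k. \<Sum>a\<in>UNIV. \<Sum>b\<in>UNIV. d k * hs k (\<lambda>i j. cinner (e k i j) (\<eta> (u_gen a b))))"
    by (intro summable_sum summableI_nonneg_bounded[OF _ Bessel] mult_nonneg_nonneg hs_nonneg less_imp_le[OF d_pos])
  then have sumG: "summable (\<lambda>k. d k * G k)" by (simp add: G_def sum_distrib_left)
  obtain \<tau> where \<tau>: "summable (\<lambda>k. d k * hs k (\<lambda>i j. F k i j + (- \<tau>) * jw k i j))"
    using finite_energy_imp_constant[of F G, OF F Gk G0 sumG] by blast
  define Y where "Y k = (\<lambda>i j. F k i j + (- \<tau>) * jw k i j)" for k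
  have pY: "pinv k (Y k)" for k unfolding Y_def by (intro pinv_add F pinv_jw)
  have sY: "summable (\<lambda>k. syn k (Y k))"
  proof (rule summable_orthogonal)
    show "cinner (syn i (Y i)) (syn j (Y j)) = 0" if "i \<noteq> j" for i j
      using that by (simp add: cinner_syn_syn[OF pY])
    show "summable (\<lambda>k. (norm (syn k (Y k)))\<^sup>2)" using \<tau> by (simp only: norm_syn[OF pY]) (simp only: Y_def)
  qed
  define \<zeta> where "\<zeta> = suminf (\<lambda>k. syn k (Y k))"
  have e\<zeta>: "cinner (e l i j) \<zeta> = Y l i j" for l i j
  proof -
    have "(\<lambda>k. cinner (e l i j) (syn k (Y k))) sums cinner (e l i j) \<zeta>"
      unfolding \<zeta>_def by (intro bounded_linear.sums[OF bounded_linear_cinner] summable_sums sY)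
    moreover have "(\<lambda>k. cinner (e l i j) (syn k (Y k))) = (\<lambda>k. if k = l then Y k i j else 0)"
      by (auto simp: cinner_e_syn[OF pY])
    ultimately show ?thesis using sums_single[of l "\<lambda>k. Y k i j"] sums_unique2 by metis
  qed
  have key: "cinner \<xi> (apply_op (\<pi> x) \<zeta>) = \<phi> x - \<tau> * counit x" for x
  proof (induction x rule: v_induct)
    case (v k i j)
    have "cinner \<xi> (apply_op (\<pi> (v k i j)) \<zeta>) = Y k i j" using e\<zeta>[of k i j] by (simp add: e_def \<pi>_star)
    then show ?case using v by (simp add: Y_def F_def counit_v)
  next
    case zero
    have "apply_op (\<pi> 0) \<zeta> = 0" using op_\<pi>(2)[of 0 0 \<zeta>] by simp
    then show ?case using counit_hom(4)[of 0 0] by (simp add: \<phi>0)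
  next
    case (add x y)
    then show ?case by (simp add: op_\<pi> cinner_add_right counit_hom \<phi>_add distrib_left)
  next
    case (scale c x)
    then show ?case by (simp add: op_\<pi> cinner_scaleC_right counit_hom \<phi>_scale right_diff_distrib)
  qed
  \<comment> \<open>Tested against \<pi> (star y) \<xi>, \<eta> x becomes \<phi> (y x) - \<epsilon>
    x * \<phi> y with \<epsilon> the counit. This expression vanishes when \<phi> is the counit, so
    \<tau> drops out.\<close>
  have "\<eta> x - (apply_op (\<pi> x) \<zeta> - counit x *\<^sub>C \<zeta>) = 0" for x
  proof (rule cinner_all_zero_dense[OF \<xi>_cyclic])
    fix w assume "w \<in> range (\<lambda>x. apply_op (\<pi> x) \<xi>)"
    then obtain y' where "w = apply_op (\<pi> y') \<xi>" by blast
    then obtain y where w: "w = apply_op (\<pi> (star y)) \<xi>" using star_star[of y'] by metis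
    have "cinner \<xi> (apply_op (\<pi> y) (\<eta> x)) = \<phi> (y * x) - counit x * \<phi> y"
      by (simp add: \<phi>_mult)
    moreover have "cinner \<xi> (apply_op (\<pi> y) (apply_op (\<pi> x) \<zeta>)) = \<phi> (y * x) - \<tau> * (counit y * counit x)"
      using key[of "y * x"] by (simp add: op_\<pi> counit_hom)
    ultimately show "cinner w (\<eta> x - (apply_op (\<pi> x) \<zeta> - counit x *\<^sub>C \<zeta>)) = 0"
      by (simp add: w \<pi>_star apply_op_diff_right cinner_diff_right apply_op_scaleC_right cinner_scaleC_right apply_op_add_right cinner_add_right key algebra_simps)
  qed
  then show ?thesis by (metis eq_iff_diff_eq_0)
qed

end

section \<open>The von Neumann algebra\<close>

text \<open>The third property characterizes the projection by its orthogonal residual; it gives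
  linearity here and commutation with the commutant later.\<close>

lemma orthogonal_projection_op:
  fixes K :: "'k::complex_hilbert_space set"
  assumes K: "closed K" "complex_vector.subspace K"
  obtains P where "\<And>x. apply_op P x \<in> K" "\<And>x k. k \<in> K \<Longrightarrow> cinner k (x - apply_op P x) = 0"
    "\<And>x q. q \<in> K \<Longrightarrow> (\<And>k. k \<in> K \<Longrightarrow> cinner k (x - q) = 0) \<Longrightarrow> apply_op P x = q"
proof -
  obtain p where p: "\<And>x. p x \<in> K" "\<And>x k. k \<in> K \<Longrightarrow> cinner k (x - p x) = 0"
    using orthogonal_projection_exists[OF K] by metis
  have uniq: "p x = q" if q: "q \<in> K" "\<And>k. k \<in> K \<Longrightarrow> cinner k (x - q) = 0" for x q
  proof -
    have d: "p x - q \<in> K" using complex_vector.subspace_diff[OF K(2) p(1) q(1)] .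
    have "cinner (p x - q) (p x - q) = cinner (p x - q) (x - q) - cinner (p x - q) (x - p x)"
      by (simp flip: cinner_diff_right)
    then show ?thesis using p(2)[OF d, of x] q(2)[OF d] by (simp add: cinner_self)
  qed
  have "clinear p"
    unfolding clinear_iff
  proof (intro conjI allI)
    fix x y c
    show "p (x + y) = p x + p y"
    proof (rule uniq)
      show "p x + p y \<in> K" by (intro complex_vector.subspace_add K p)
      show "cinner k (x + y - (p x + p y)) = 0" if "k \<in> K" for k
        using p(2)[OF that, of x] p(2)[OF that, of y] by (simp add: cinner_diff_right cinner_add_right)
    qed
    show "p (c *\<^sub>C x) = c *\<^sub>C p x"
    proof (rule uniq)
      show "c *\<^sub>C p x \<in> K" by (intro complex_vector.subspace_scale K p)
      show "cinner k (c *\<^sub>C x - c *\<^sub>C p x) = 0" if "k \<in> K" for k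
        using p(2)[OF that, of x] by (simp add: cinner_scaleC_right flip: complex_vector.scale_right_diff_distrib)
    qed
  qed
  moreover have "norm (p x) \<le> 1 * norm x" for x
  proof -
    have "cinner (p x) x = cinner (p x) (p x)" using p(2)[OF p(1), of x x] by (simp add: cinner_diff_right)
    then have "(norm (p x))\<^sup>2 \<le> norm (p x) * norm x"
      using Cauchy_Schwarz_cinner[of "p x" x] by (simp add: cinner_self norm_power)
    then show ?thesis by (cases "p x = 0") (simp_all add: power2_eq_square)
  qed
  ultimately have "apply_op (Bop p) = p" by (rule apply_op_Bop)
  then show ?thesis using that[of "Bop p"] p uniq by simp
qed

text \<open>The closure of the pairs (A x, B x) is the graph of an operator: the bound makes it
  single-valued, and density of the range of A with completeness makes it everywhere
  defined.\<close>

lemma bounded_extension: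
  fixes A B :: "'s::complex_vector \<Rightarrow> 'h::complex_hilbert_space"
  assumes A: "clinear A" and B: "clinear B" and d: "closure (range A) = UNIV"
    and K: "\<And>x. norm (B x) \<le> K * norm (A x)"
  shows "\<exists>T. \<forall>x. apply_op T (A x) = B x"
proof -
  let ?G = "closure (range (\<lambda>x. (A x, B x)))"
  have "complex_vector.subspace (range (\<lambda>x. (A x, B x)))"
  proof -
    have [simp]: "A (x + y) = A x + A y" "B (x + y) = B x + B y" "A (c *\<^sub>C x) = c *\<^sub>C A x" "B (c *\<^sub>C x) = c *\<^sub>C B x" for x y c
      using A B unfolding clinear_iff by simp_all
    have "A 0 = 0" "B 0 = 0"
      using \<open>\<And>x c. A (c *\<^sub>C x) = c *\<^sub>C A x\<close>[of 0 0] \<open>\<And>x c. B (c *\<^sub>C x) = c *\<^sub>C B x\<close>[of 0 0] by simp_all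
    then have "(0, 0) \<in> range (\<lambda>x. (A x, B x))" by (intro image_eqI[of _ _ 0]) simp_all
    moreover have "(A x, B x) + (A y, B y) \<in> range (\<lambda>x. (A x, B x))" for x y
      by (rule image_eqI[of _ _ "x + y"]) simp_all
    moreover have "c *\<^sub>C (A x, B x) \<in> range (\<lambda>x. (A x, B x))" for c x
      by (rule image_eqI[of _ _ "c *\<^sub>C x"]) (simp_all add: scaleC_prod_def)
    ultimately show ?thesis unfolding complex_vector.subspace_def zero_prod_def by blast
  qed
  then have sub: "complex_vector.subspace ?G" by (rule subspace_closure)
  have bd: "norm w \<le> \<bar>K\<bar> * norm u" if uw: "(u, w) \<in> ?G" for u w
  proof -
    obtain f where f: "\<And>n. f n \<in> range (\<lambda>x. (A x, B x))" "f \<longlonglongrightarrow> (u, w)"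
      using uw by (rule closure_seqE) blast
    have "norm (snd (f n)) \<le> \<bar>K\<bar> * norm (fst (f n))" for n
    proof -
      obtain x where x: "f n = (A x, B x)" using f(1)[of n] by blast
      have "K * norm (A x) \<le> \<bar>K\<bar> * norm (A x)" by (intro mult_right_mono) auto
      with K[of x] show ?thesis by (simp add: x)
    qed
    moreover have "(\<lambda>n. norm (snd (f n))) \<longlonglongrightarrow> norm w" "(\<lambda>n. \<bar>K\<bar> * norm (fst (f n))) \<longlonglongrightarrow> \<bar>K\<bar> * norm u"
      using tendsto_fst[OF f(2)] tendsto_snd[OF f(2)] by (auto intro!: tendsto_intros)
    ultimately show ?thesis using LIMSEQ_le by blast
  qed
  have ex: "\<exists>w. (u, w) \<in> ?G" for u
  proof -
    have "u \<in> closure (range A)" using d by simp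
    then obtain g where g: "\<And>n. g n \<in> range A" "g \<longlonglongrightarrow> u" by (rule closure_seqE) blast
    have "\<exists>x. g n = A x" for n using g(1)[of n] by blast
    then obtain x where x: "\<And>n. g n = A (x n)" by metis
    have dif: "B (x m) - B (x n) = B (x m - x n)" "A (x m) - A (x n) = A (x m - x n)" for m n
    proof -
      have "A ((x m - x n) + x n) = A (x m - x n) + A (x n)" "B ((x m - x n) + x n) = B (x m - x n) + B (x n)"
        using A B unfolding clinear_iff by blast+
      then show "B (x m) - B (x n) = B (x m - x n)" "A (x m) - A (x n) = A (x m - x n)" by simp_all
    qed
    have "Cauchy (\<lambda>n. B (x n))"
      unfolding Cauchy_def dist_norm
    proof (intro allI impI)
      fix \<epsilon> :: real assume \<epsilon>: "\<epsilon> > 0"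
      have "Cauchy g" using g(2) by (rule LIMSEQ_imp_Cauchy)
      moreover have "\<epsilon> / (\<bar>K\<bar> + 1) > 0" using \<epsilon> by (simp add: add_nonneg_pos)
      ultimately obtain m where m: "\<And>i j. i \<ge> m \<Longrightarrow> j \<ge> m \<Longrightarrow> norm (g i - g j) < \<epsilon> / (\<bar>K\<bar> + 1)"
        unfolding Cauchy_def dist_norm by blast
      have "norm (B (x i) - B (x j)) < \<epsilon>" if "i \<ge> m" "j \<ge> m" for i j
      proof -
        have "norm (B (x i) - B (x j)) \<le> K * norm (g i - g j)" using K[of "x i - x j"] by (simp add: dif x)
        also have "\<dots> \<le> (\<bar>K\<bar> + 1) * norm (g i - g j)" by (intro mult_right_mono) auto
        also have "\<dots> < (\<bar>K\<bar> + 1) * (\<epsilon> / (\<bar>K\<bar> + 1))" by (intro mult_strict_left_mono m that) auto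
        finally show ?thesis by (simp add: add_nonneg_pos split: if_splits)
      qed
      then show "\<exists>M. \<forall>m\<ge>M. \<forall>n\<ge>M. norm (B (x m) - B (x n)) < \<epsilon>" by blast
    qed
    then obtain w where w: "(\<lambda>n. B (x n)) \<longlonglongrightarrow> w" using Cauchy_convergent convergent_def by blast
    have "(\<lambda>n. (A (x n), B (x n))) \<longlonglongrightarrow> (u, w)"
      using g(2) w by (intro tendsto_Pair) (simp_all add: x[symmetric])
    then have "(u, w) \<in> ?G" by (rule closure_seqI[rotated]) blast
    then show ?thesis by blast
  qed
  then obtain t where t: "\<And>u. (u, t u) \<in> ?G" by metis
  have uniq: "w = t u" if "(u, w) \<in> ?G" for u w
  proof -
    have "(u, w) - (u, t u) \<in> ?G" by (rule complex_vector.subspace_diff[OF sub that t])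
    then have "(0, w - t u) \<in> ?G" by simp
    from bd[OF this] show ?thesis by simp
  qed
  have "clinear t"
    unfolding clinear_iff
  proof (intro conjI allI)
    show "t (x + y) = t x + t y" for x y
      using complex_vector.subspace_add[OF sub t t, of x y] by (intro uniq[symmetric]) simp
    show "t (c *\<^sub>C x) = c *\<^sub>C t x" for c x
      using complex_vector.subspace_scale[OF sub t, of c x] by (intro uniq[symmetric]) (simp add: scaleC_prod_def)
  qed
  then have T: "apply_op (Bop t) = t" using bd[OF t] by (rule apply_op_Bop)
  have "t (A x) = B x" for x
    by (rule uniq[symmetric]) (rule closure_subset[THEN subsetD], rule rangeI)
  then show ?thesis using T by metis
qed

lemma bop_eq_dense:
  assumes d: "closure D = UNIV" and eq: "\<And>x. x \<in> D \<Longrightarrow> apply_op S x = apply_op T x"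
  shows "S = T"
proof (rule bop_eqI)
  fix x
  have "x \<in> closure D" using d by simp
  then obtain f where f: "\<And>n. f n \<in> D" "f \<longlonglongrightarrow> x" by (rule closure_seqE) blast
  have "(\<lambda>n. apply_op S (f n)) \<longlonglongrightarrow> apply_op S x" by (rule tendsto_apply_op[OF f(2)])
  moreover have "(\<lambda>n. apply_op S (f n)) \<longlonglongrightarrow> apply_op T x"
    unfolding eq[OF f(1)] by (rule tendsto_apply_op[OF f(2)])
  ultimately show "apply_op S x = apply_op T x" by (rule LIMSEQ_unique)
qed

context Ao_gns begin

section \<open>The commutant \<open>R\<close> and the von Neumann algebra \<open>M\<close>\<close>

definition R :: "'h bop set" where "R = commutant (range \<pi>)"

definition M :: "'h bop set" where "M = commutant (commutant (range \<pi>))"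

lemma R_commute: "y \<in> R \<Longrightarrow> apply_op y (apply_op (\<pi> x) u) = apply_op (\<pi> x) (apply_op y u)"
  unfolding R_def commutant_def by (metis (mono_tags, lifting) mem_Collect_eq rangeI times_bop.rep_eq)

lemma R_I: "(\<And>x u. apply_op y (apply_op (\<pi> x) u) = apply_op (\<pi> x) (apply_op y u)) \<Longrightarrow> y \<in> R"
  unfolding R_def commutant_def by (auto intro!: bop_eqI simp: times_bop.rep_eq)

lemma M_commute: "c \<in> M \<Longrightarrow> y \<in> R \<Longrightarrow> apply_op c (apply_op y u) = apply_op y (apply_op c u)"
  unfolding M_def R_def[symmetric] commutant_def[of R] by (metis (mono_tags, lifting) mem_Collect_eq times_bop.rep_eq)

lemma M_I: "(\<And>y u. y \<in> R \<Longrightarrow> apply_op c (apply_op y u) = apply_op y (apply_op c u)) \<Longrightarrow> c \<in> M"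
  unfolding M_def R_def[symmetric] commutant_def[of R] by (auto intro!: bop_eqI simp: times_bop.rep_eq)

lemma M_closed:
  "1 \<in> M" "0 \<in> M" "x \<in> M \<Longrightarrow> y \<in> M \<Longrightarrow> x + y \<in> M" "x \<in> M \<Longrightarrow> y \<in> M \<Longrightarrow> x * y \<in> M" "x \<in> M \<Longrightarrow> c *\<^sub>C x \<in> M"
  by (auto intro!: M_I simp: one_bop.rep_eq zero_bop.rep_eq plus_bop.rep_eq times_bop.rep_eq scaleC_bop.rep_eq
      M_commute apply_op_add_right apply_op_scaleC_right)

text \<open>Right multiplication by elements of the algebra is bounded since the Haar state is a trace.\<close>

lemma right_mult_exists: "\<exists>r\<in>R. apply_op r \<xi> = apply_op (\<pi> x) \<xi>"
proof -
  obtain K where K: "\<And>u. norm (apply_op (\<pi> (star x)) u) \<le> K * norm u" and K0: "K \<ge> 0"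
    using apply_op_bounded by metis
  have n: "(norm (apply_op (\<pi> z) \<xi>))\<^sup>2 = Re (h (star z * z))" for z
    unfolding norm_power2_cinner h_eq op_\<pi>(4) \<pi>_star[symmetric] star_star ..
  have "norm (apply_op (\<pi> (y * x)) \<xi>) \<le> K * norm (apply_op (\<pi> y) \<xi>)" for y
  proof -
    have "(norm (apply_op (\<pi> (y * x)) \<xi>))\<^sup>2 = Re (h (star (y * x) * (y * x)))" by (rule n)
    also have "h (star (y * x) * (y * x)) = h ((y * x) * star (y * x))" by (rule h_trace)
    also have "\<dots> = h (star (star x * star y) * (star x * star y))" by (simp add: star_mult star_star)
    also have "Re \<dots> = (norm (apply_op (\<pi> (star x)) (apply_op (\<pi> (star y)) \<xi>)))\<^sup>2"
      by (simp only: n[symmetric] op_\<pi>)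
    also have "\<dots> \<le> (K * norm (apply_op (\<pi> (star y)) \<xi>))\<^sup>2" by (intro power_mono K) simp
    also have "\<dots> = K\<^sup>2 * Re (h (y * star y))" by (simp add: power_mult_distrib n star_star)
    also have "\<dots> = (K * norm (apply_op (\<pi> y) \<xi>))\<^sup>2" by (simp add: power_mult_distrib n h_trace[of y])
    finally show ?thesis by (rule power2_le_imp_le) (simp add: K0)
  qed
  moreover have "clinear (\<lambda>y. apply_op (\<pi> y) \<xi>)" unfolding clinear_iff by (simp add: op_\<pi>)
  moreover have "clinear (\<lambda>y. apply_op (\<pi> (y * x)) \<xi>)"
    unfolding clinear_iff by (simp add: distrib_right mult_scaleC_left op_\<pi>(1,2))
  ultimately obtain r where r: "\<And>y. apply_op r (apply_op (\<pi> y) \<xi>) = apply_op (\<pi> (y * x)) \<xi>"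
    using bounded_extension[of "\<lambda>y. apply_op (\<pi> y) \<xi>" "\<lambda>y. apply_op (\<pi> (y * x)) \<xi>" K] \<xi>_cyclic by blast
  have "r * \<pi> z = \<pi> z * r" for z
  proof (rule bop_eq_dense[OF \<xi>_cyclic])
    fix w assume "w \<in> range (\<lambda>x. apply_op (\<pi> x) \<xi>)"
    then obtain y where w: "w = apply_op (\<pi> y) \<xi>" by blast
    show "apply_op (r * \<pi> z) w = apply_op (\<pi> z * r) w"
      using r[of "z * y"] by (simp add: w times_bop.rep_eq r op_\<pi>(4)[of z] mult.assoc)
  qed
  then have "r \<in> R" by (intro R_I) (metis times_bop.rep_eq)
  moreover have "apply_op r \<xi> = apply_op (\<pi> x) \<xi>" using r[of 1] by (simp add: op_\<pi>(3))
  ultimately show ?thesis by blast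
qed

lemma R_adjoint:
  assumes "y \<in> R"
  obtains z where "z \<in> R" "\<And>u w. cinner (apply_op z u) w = cinner u (apply_op y w)"
proof -
  obtain z where z: "\<And>u w. cinner (apply_op z u) w = cinner u (apply_op y w)"
    using adjoint_exists[of y] by blast
  have "apply_op z (apply_op (\<pi> x) u) = apply_op (\<pi> x) (apply_op z u)" for x u
  proof -
    have "cinner (apply_op z (apply_op (\<pi> x) u)) w = cinner (apply_op (\<pi> x) (apply_op z u)) w" for w
      using \<pi>_star[of "star x"] by (simp add: z star_star R_commute[OF assms])
    then have "cinner (apply_op z (apply_op (\<pi> x) u) - apply_op (\<pi> x) (apply_op z u)) w = 0" for w
      by (simp add: cinner_diff_left)
    from this[of "apply_op z (apply_op (\<pi> x) u) - apply_op (\<pi> x) (apply_op z u)"]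
    show ?thesis by (simp add: cinner_self)
  qed
  then have "z \<in> R" by (rule R_I)
  then show ?thesis using that z by blast
qed

text \<open>The vector \<open>\<zeta>\<close> need not come from an element of \<open>M\<close>, but the projection onto the closed graph
  \<open>{(y \<xi>, y \<zeta>) | y \<in> M'}\<close> has its matrix entries in \<open>M\<close>. This bounds the cocycle up to a
  right factor \<open>a\<close> that is injective with dense range.\<close>

lemma cocycle_inner_up_to_factor:
  fixes c :: "'n Ao \<Rightarrow> 'h bop"
  assumes cM: "\<And>x. c x \<in> M"
    and add: "\<And>x y. c (x + y) = c x + c y" and scale: "\<And>\<alpha> x. c (\<alpha> *\<^sub>C x) = \<alpha> *\<^sub>C c x"
    and cocycle: "\<And>x y. c (x * y) = \<pi> x * c y + counit y *\<^sub>C c x"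
  shows "\<exists>a\<in>M. \<exists>b\<in>M. (\<forall>x. c x * a = \<pi> x * b - counit x *\<^sub>C b) \<and> (\<forall>x. x * a = 0 \<longrightarrow> x = 0)"
proof -
  obtain \<zeta> where \<zeta>: "\<And>x. apply_op (c x) \<xi> = apply_op (\<pi> x) \<zeta> - counit x *\<^sub>C \<zeta>"
    using cocycle_inner[of "\<lambda>x. apply_op (c x) \<xi>"]
    by (auto simp: add scale cocycle plus_bop.rep_eq scaleC_bop.rep_eq times_bop.rep_eq)
  define \<Gamma> where "\<Gamma> = closure ((\<lambda>y. (apply_op y \<xi>, apply_op y \<zeta>)) ` R)"
  have "complex_vector.subspace ((\<lambda>y. (apply_op y \<xi>, apply_op y \<zeta>)) ` R)" (is "complex_vector.subspace ?D")
  proof -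
    have "0 \<in> R" "\<And>S T. S \<in> R \<Longrightarrow> T \<in> R \<Longrightarrow> S + T \<in> R" "\<And>\<alpha> S. S \<in> R \<Longrightarrow> \<alpha> *\<^sub>C S \<in> R"
      by (auto intro!: R_I simp: zero_bop.rep_eq plus_bop.rep_eq scaleC_bop.rep_eq
          R_commute apply_op_add_right apply_op_scaleC_right)
    note R = this
    have "0 \<in> ?D" by (rule image_eqI[OF _ R(1)]) (simp add: zero_bop.rep_eq zero_prod_def)
    moreover have "(apply_op S \<xi>, apply_op S \<zeta>) + (apply_op T \<xi>, apply_op T \<zeta>) \<in> ?D" if "S \<in> R" "T \<in> R" for S T
      by (rule image_eqI[OF _ R(2)[OF that]]) (simp add: plus_bop.rep_eq)
    moreover have "\<alpha> *\<^sub>C (apply_op S \<xi>, apply_op S \<zeta>) \<in> ?D" if "S \<in> R" for S \<alpha>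
      by (rule image_eqI[OF _ R(3)[OF that, of \<alpha>]]) (simp add: scaleC_bop.rep_eq scaleC_prod_def)
    ultimately show ?thesis unfolding complex_vector.subspace_def by blast
  qed
  then have \<Gamma>sub: "complex_vector.subspace \<Gamma>" unfolding \<Gamma>_def by (rule subspace_closure)
  have \<Gamma>R: "(apply_op y \<xi>, apply_op y \<zeta>) \<in> \<Gamma>" if "y \<in> R" for y
    unfolding \<Gamma>_def by (rule closure_subset[THEN subsetD], rule image_eqI[OF refl that])
  have \<Gamma>inv: "(apply_op y u, apply_op y w) \<in> \<Gamma>" if uw: "(u, w) \<in> \<Gamma>" and y: "y \<in> R" for u w y
  proof -
    obtain f where f: "\<And>n. f n \<in> ?D" "f \<longlonglongrightarrow> (u, w)"
      using uw unfolding \<Gamma>_def by (rule closure_seqE) blast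
    have "(\<lambda>n. (apply_op y (fst (f n)), apply_op y (snd (f n)))) \<longlonglongrightarrow> (apply_op y u, apply_op y w)"
      using tendsto_fst[OF f(2)] tendsto_snd[OF f(2)] by (intro tendsto_Pair tendsto_apply_op) simp_all
    moreover have "(apply_op y (fst (f n)), apply_op y (snd (f n))) \<in> ?D" for n
    proof -
      obtain z where z: "z \<in> R" "f n = (apply_op z \<xi>, apply_op z \<zeta>)" using f(1)[of n] by blast
      have "y * z \<in> R" using y z(1) by (intro R_I) (simp add: times_bop.rep_eq R_commute)
      then show ?thesis by (rule image_eqI[rotated]) (simp add: z(2) times_bop.rep_eq)
    qed
    ultimately show ?thesis unfolding \<Gamma>_def by (rule closure_seqI[rotated])
  qed
  \<comment> \<open>For pairs (y \<xi>, y \<zeta>) this holds because c x lies in M and y commutes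
    with \<pi> x; boundedness carries it to the closure.\<close>
  have \<Gamma>c: "apply_op (c x) u = apply_op (\<pi> x) w - counit x *\<^sub>C w" if uw: "(u, w) \<in> \<Gamma>" for u w x
  proof -
    obtain f where f: "\<And>n. f n \<in> ?D" "f \<longlonglongrightarrow> (u, w)"
      using uw unfolding \<Gamma>_def by (rule closure_seqE) blast
    have eq: "apply_op (c x) (fst (f n)) = apply_op (\<pi> x - counit x *\<^sub>C 1) (snd (f n))" for n
    proof -
      obtain z where z: "z \<in> R" "f n = (apply_op z \<xi>, apply_op z \<zeta>)" using f(1)[of n] by blast
      show ?thesis
        using z(1) by (simp add: z(2) M_commute[OF cM z(1)] \<zeta> apply_op_diff_right apply_op_scaleC_right R_commute
            apply_op_diff_left scaleC_bop.rep_eq one_bop.rep_eq)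
    qed
    have l1: "(\<lambda>n. apply_op (c x) (fst (f n))) \<longlonglongrightarrow> apply_op (c x) u"
      using tendsto_apply_op[OF tendsto_fst[OF f(2)]] by simp
    have l2: "(\<lambda>n. apply_op (c x) (fst (f n))) \<longlonglongrightarrow> apply_op (\<pi> x - counit x *\<^sub>C 1) w"
      unfolding eq using tendsto_apply_op[OF tendsto_snd[OF f(2)]] by simp
    show ?thesis using LIMSEQ_unique[OF l1 l2]
      by (simp add: apply_op_diff_left scaleC_bop.rep_eq one_bop.rep_eq)
  qed
  have "closed \<Gamma>" by (simp add: \<Gamma>_def)
  then obtain P where P: "\<And>x. apply_op P x \<in> \<Gamma>" "\<And>x k. k \<in> \<Gamma> \<Longrightarrow> cinner k (x - apply_op P x) = 0"
    and Pu: "\<And>x q. q \<in> \<Gamma> \<Longrightarrow> (\<And>k. k \<in> \<Gamma> \<Longrightarrow> cinner k (x - q) = 0) \<Longrightarrow> apply_op P x = q"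
    using orthogonal_projection_op[OF _ \<Gamma>sub] by blast
  obtain KP where KP: "\<And>x. norm (apply_op P x) \<le> KP * norm x" using apply_op_bounded by blast
  have lin: "apply_op P (u + u', 0) = apply_op P (u, 0) + apply_op P (u', 0)"
    "apply_op P (\<alpha> *\<^sub>C u, 0) = \<alpha> *\<^sub>C apply_op P (u, 0)" for u u' \<alpha>
    using apply_op_add_right[of P "(u, 0)" "(u', 0)"] apply_op_scaleC_right[of P \<alpha> "(u, 0)"]
    by (simp_all add: scaleC_prod_def)
  have nf: "norm (fst z) \<le> norm z" "norm (snd z) \<le> norm z" for z :: "'h \<times> 'h"
    using norm_fst_le[of "fst z" "snd z"] norm_snd_le[of "snd z" "fst z"] by simp_all
  \<comment> \<open>The two entries of P in its first column: P (u, 0) = (a u, b u).\<close>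
  define a where "a = Bop (\<lambda>u. fst (apply_op P (u, 0)))"
  define b where "b = Bop (\<lambda>u. snd (apply_op P (u, 0)))"
  have a: "apply_op a u = fst (apply_op P (u, 0))" for u
  proof -
    have "apply_op a = (\<lambda>u. fst (apply_op P (u, 0)))"
      unfolding a_def
    proof (rule apply_op_Bop)
      show "clinear (\<lambda>u. fst (apply_op P (u, 0)))" unfolding clinear_iff lin by (simp add: scaleC_prod_def)
      show "norm (fst (apply_op P (u, 0))) \<le> KP * norm u" for u
        using nf(1)[of "apply_op P (u, 0)"] KP[of "(u, 0)"] by (simp add: norm_Pair)
    qed
    then show ?thesis by simp
  qed
  have b: "apply_op b u = snd (apply_op P (u, 0))" for u
  proof -
    have "apply_op b = (\<lambda>u. snd (apply_op P (u, 0)))"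
      unfolding b_def
    proof (rule apply_op_Bop)
      show "clinear (\<lambda>u. snd (apply_op P (u, 0)))" unfolding clinear_iff lin by (simp add: scaleC_prod_def)
      show "norm (snd (apply_op P (u, 0))) \<le> KP * norm u" for u
        using nf(2)[of "apply_op P (u, 0)"] KP[of "(u, 0)"] by (simp add: norm_Pair)
    qed
    then show ?thesis by simp
  qed
  have ab: "apply_op P (u, 0) = (apply_op a u, apply_op b u)" for u by (simp add: a b)
  \<comment> \<open>\<Gamma> is invariant under y and under its adjoint, so P commutes with y acting
    on both coordinates.\<close>
  have Pcomm: "apply_op P (apply_op y u, 0) = (apply_op y (apply_op a u), apply_op y (apply_op b u))"
    if y: "y \<in> R" for y u
  proof (rule Pu)
    show "(apply_op y (apply_op a u), apply_op y (apply_op b u)) \<in> \<Gamma>"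
      using \<Gamma>inv[OF _ y] P(1)[of "(u, 0)"] by (simp add: ab)
    fix k assume k: "k \<in> \<Gamma>"
    obtain k1 k2 where k12: "k = (k1, k2)" by (cases k)
    obtain z where z: "z \<in> R" "\<And>u w. cinner (apply_op z u) w = cinner u (apply_op y w)"
      using R_adjoint[OF y] by blast
    have "(apply_op z k1, apply_op z k2) \<in> \<Gamma>" using \<Gamma>inv[OF _ z(1)] k k12 by simp
    from P(2)[OF this, of "(u, 0)"]
    have "cinner (apply_op z k1) (u - apply_op a u) + cinner (apply_op z k2) (- apply_op b u) = 0"
      by (simp add: ab cinner_prod_def)
    then show "cinner k ((apply_op y u, 0) - (apply_op y (apply_op a u), apply_op y (apply_op b u))) = 0"
      by (simp add: k12 cinner_prod_def z(2) cinner_diff_right cinner_minus_right apply_op_diff_right)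
  qed
  have aM: "a \<in> M" and bM: "b \<in> M"
    by (rule M_I, simp add: Pcomm a[of "apply_op _ _"] b[of "apply_op _ _"])+
  have "c x * a = \<pi> x * b - counit x *\<^sub>C b" for x
  proof (rule bop_eqI)
    fix u
    have "(apply_op a u, apply_op b u) \<in> \<Gamma>" using P(1)[of "(u, 0)"] by (simp add: ab)
    from \<Gamma>c[OF this] show "apply_op (c x * a) u = apply_op (\<pi> x * b - counit x *\<^sub>C b) u"
      by (simp add: times_bop.rep_eq apply_op_diff_left scaleC_bop.rep_eq)
  qed
  \<comment> \<open>For u = z w with z the adjoint of x, <u, a u> = <w, x a u> = 0. Hence P kills
    (u, 0), which is then orthogonal to \<Gamma>. The first coordinates of \<Gamma> are dense as
    they contain all \<pi> y \<xi>, so u = 0.\<close>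
  moreover have "x = 0" if xa: "x * a = 0" for x
  proof (rule bop_eqI)
    fix w
    obtain z where z: "\<And>u w. cinner (apply_op z u) w = cinner u (apply_op x w)"
      using adjoint_exists[of x] by blast
    have zero: "apply_op z w = 0" for w
    proof -
      let ?u = "apply_op z w"
      have "apply_op x (apply_op a ?u) = 0" using xa by (metis times_bop.rep_eq zero_bop.rep_eq)
      then have "cinner (?u, 0) (apply_op P (?u, 0)) = 0" by (simp add: ab cinner_prod_def z)
      moreover have "cinner (apply_op P (?u, 0)) (apply_op P (?u, 0)) = cinner (apply_op P (?u, 0)) (?u, 0)"
        using P(2)[OF P(1), of "(?u, 0)" "(?u, 0)"] by (simp add: cinner_diff_right)
      ultimately have "apply_op P (?u, 0) = 0"
        using cinner_commute[of "apply_op P (?u, 0)" "(?u, 0)"] by (simp add: cinner_self)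
      then have orth: "cinner k (?u, 0) = 0" if "k \<in> \<Gamma>" for k using P(2)[OF that, of "(?u, 0)"] by simp
      show ?thesis
      proof (rule cinner_all_zero_dense[OF \<xi>_cyclic])
        fix k assume "k \<in> range (\<lambda>x. apply_op (\<pi> x) \<xi>)"
        then obtain x where "k = apply_op (\<pi> x) \<xi>" by blast
        then obtain r where "r \<in> R" "k = apply_op r \<xi>" using right_mult_exists by metis
        then show "cinner k ?u = 0" using orth[OF \<Gamma>R] by (simp add: cinner_prod_def)
      qed
    qed
    have "cinner (apply_op x w) (apply_op x w) = 0" by (simp add: z[symmetric] zero)
    then show "apply_op x w = apply_op 0 w" by (simp add: cinner_self zero_bop.rep_eq)
  qed
  ultimately show ?thesis using aM bM by blast
qed

section \<open>The first cohomology module and its dimension\<close>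

definition H1 :: "('h bop, ('n Ao list \<Rightarrow> 'h bop) set) right_module" where
  "H1 = hochschild_cohomology M (\<lambda>x m. \<pi> x * m) (\<lambda>m x. counit x *\<^sub>C m) 1"

definition Z1 :: "('n Ao list \<Rightarrow> 'h bop) set" where
  "Z1 = cocycles M (\<lambda>x m. \<pi> x * m) (\<lambda>m x. counit x *\<^sub>C m) 1"

definition B1 :: "('n Ao list \<Rightarrow> 'h bop) set" where
  "B1 = coboundaries M (\<lambda>x m. \<pi> x * m) (\<lambda>m x. counit x *\<^sub>C m) 1"

definition inner_cochain :: "'h bop \<Rightarrow> 'n Ao list \<Rightarrow> 'h bop" where
  "inner_cochain b xs = (if length xs = 1 then \<pi> (hd xs) * b - counit (hd xs) *\<^sub>C b else 0)"

text \<open>A cochain of degree 0 is supported on the empty list, so it is a single element of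
  M.\<close>

lemma B1_eq: "B1 = inner_cochain ` M"
proof -
  have cob: "coboundary (\<lambda>x m. \<pi> x * m) (\<lambda>m x. counit x *\<^sub>C m) 0 f = inner_cochain (f [])"
    if "f \<in> cochains M 0" for f :: "'n Ao list \<Rightarrow> 'h bop"
  proof
    fix xs :: "'n Ao list"
    show "coboundary (\<lambda>x m. \<pi> x * m) (\<lambda>m x. counit x *\<^sub>C m) 0 f xs = inner_cochain (f []) xs"
      by (cases xs) (auto simp: coboundary_def inner_cochain_def)
  qed
  have "\<exists>f\<in>cochains M 0. f [] = b" if "b \<in> M" for b
    using that by (intro bexI[of _ "\<lambda>xs. if xs = [] then b else 0"]) (auto simp: cochains_def)
  moreover have "f [] \<in> M" if "f \<in> cochains M 0" for f :: "'n Ao list \<Rightarrow> 'h bop"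
    using that by (simp add: cochains_def)
  ultimately show ?thesis
    unfolding B1_def coboundaries_def One_nat_def nat.case
    by (auto simp: cob image_iff)
qed

lemma B1_closed:
  "f \<in> B1 \<Longrightarrow> g \<in> B1 \<Longrightarrow> (\<lambda>xs. f xs + g xs) \<in> B1"
  "f \<in> B1 \<Longrightarrow> m \<in> M \<Longrightarrow> (\<lambda>xs. f xs * m) \<in> B1"
  "f \<in> B1 \<Longrightarrow> (\<lambda>xs. - f xs) \<in> B1"
  "(\<lambda>xs. 0) \<in> B1"
proof -
  have i: "(\<lambda>xs. inner_cochain b xs + inner_cochain b' xs) = inner_cochain (b + b')" "(\<lambda>xs. inner_cochain b xs * m) = inner_cochain (b * m)"
    "(\<lambda>xs. - inner_cochain b xs) = inner_cochain ((-1) *\<^sub>C b)" "(\<lambda>xs. 0) = inner_cochain 0" for b b' m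
    by (auto simp: inner_cochain_def fun_eq_iff distrib_left scaleC_add_right left_diff_distrib mult.assoc
        mult_scaleC_left mult_scaleC_right scaleC_scaleC)
  show "f \<in> B1 \<Longrightarrow> g \<in> B1 \<Longrightarrow> (\<lambda>xs. f xs + g xs) \<in> B1"
    "f \<in> B1 \<Longrightarrow> m \<in> M \<Longrightarrow> (\<lambda>xs. f xs * m) \<in> B1"
    "f \<in> B1 \<Longrightarrow> (\<lambda>xs. - f xs) \<in> B1" "(\<lambda>xs. 0) \<in> B1"
    unfolding B1_eq using M_closed M_closed(5)[of _ "-1"] by (auto simp: i)
qed

lemma Z1_torsion:
  assumes f: "f \<in> Z1"
  shows "\<exists>a\<in>M. (\<lambda>xs. f xs * a) \<in> B1 \<and> (\<forall>x. x * a = 0 \<longrightarrow> x = 0)"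
proof -
  have fc: "f \<in> cochains M 1" and f0: "coboundary (\<lambda>x m. \<pi> x * m) (\<lambda>m x. counit x *\<^sub>C m) 1 f [x, y] = 0" for x y
    using f by (simp_all add: Z1_def cocycles_def)
  have fM: "f [x] \<in> M" and flin: "clinear (\<lambda>x. f [x])" and fout: "length xs \<noteq> 1 \<Longrightarrow> f xs = 0" for x xs
  proof -
    show "f [x] \<in> M" "length xs \<noteq> 1 \<Longrightarrow> f xs = 0" using fc by (simp_all add: cochains_def)
    have "\<forall>xs i. length xs = 1 \<and> i < 1 \<longrightarrow> clinear (\<lambda>x. f (xs[i := x]))"
      using fc unfolding cochains_def by blast
    from this[rule_format, of "[0]" 0] show "clinear (\<lambda>x. f [x])" by simp
  qed
  have coc: "f [x * y] = \<pi> x * f [y] + counit y *\<^sub>C f [x]" for x y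
    using f0[of x y] by (simp add: coboundary_def scaleC_one algebra_simps)
  have "f [x + y] = f [x] + f [y]" "f [c *\<^sub>C x] = c *\<^sub>C f [x]" for x y c
    using flin unfolding clinear_iff by simp_all
  from cocycle_inner_up_to_factor[of "\<lambda>x. f [x]", OF fM this coc]
  obtain a b where ab: "a \<in> M" "b \<in> M" "\<And>x. f [x] * a = \<pi> x * b - counit x *\<^sub>C b" "\<And>x. x * a = 0 \<Longrightarrow> x = 0"
    by blast
  have "(\<lambda>xs. f xs * a) = inner_cochain b"
  proof
    fix xs :: "'n Ao list"
    show "f xs * a = inner_cochain b xs"
    proof (cases "length xs = 1")
      case True
      then obtain x where "xs = [x]" by (auto simp: length_Suc_conv)
      then show ?thesis by (simp add: ab(3) inner_cochain_def)
    qed (simp add: fout inner_cochain_def)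
  qed
  then show ?thesis using ab unfolding B1_eq by blast
qed

lemma H1_unfold:
  "elems H1 = {{(\<lambda>xs. f xs + b xs) | b. b \<in> B1} | f. f \<in> Z1}"
  "madd H1 = (\<lambda>X Y. {(\<lambda>xs. f xs + g xs) | f g. f \<in> X \<and> g \<in> Y})"
  "mact H1 = (\<lambda>X m. {(\<lambda>xs. f xs * m + b xs) | f b. f \<in> X \<and> b \<in> B1})"
  by (simp_all add: H1_def hochschild_cohomology_def quotient_module_def Z1_def B1_def)

text \<open>\<open>B1\<close> is the zero coset: every class is annihilated by some a in M that is
  not a zero divisor under right multiplication.\<close>

lemma H1_torsion:
  assumes X: "X \<in> elems H1"
  shows "\<exists>a\<in>M. mact H1 X a = B1 \<and> (\<forall>x. x * a = 0 \<longrightarrow> x = 0)"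
proof -
  obtain f where f: "f \<in> Z1" "X = {(\<lambda>xs. f xs + b xs) | b. b \<in> B1}"
    using X unfolding H1_unfold by blast
  obtain a where a: "a \<in> M" "(\<lambda>xs. f xs * a) \<in> B1" "\<forall>x. x * a = 0 \<longrightarrow> x = 0"
    using Z1_torsion[OF f(1)] by blast
  have "mact H1 X a = B1"
  proof (intro equalityI subsetI)
    fix g assume "g \<in> mact H1 X a"
    then obtain b b' where b: "b \<in> B1" "b' \<in> B1" "g = (\<lambda>xs. (f xs + b xs) * a + b' xs)"
      unfolding H1_unfold f(2) by blast
    have "(\<lambda>xs. (f xs * a + b xs * a) + b' xs) \<in> B1"
      by (intro B1_closed(1)[of "\<lambda>xs. f xs * a + b xs * a"] B1_closed(1)[OF a(2)] B1_closed(2) a b)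
    then show "g \<in> B1" by (simp add: b(3) distrib_right)
  next
    fix g assume g: "g \<in> B1"
    have g1: "(\<lambda>xs. - (f xs * a) + g xs) \<in> B1" by (intro B1_closed(1) B1_closed(3) a g)
    have g2: "(\<lambda>xs. f xs + 0) \<in> X"
      unfolding f(2) by (intro CollectI exI[of _ "\<lambda>xs. 0"] conjI refl B1_closed(4))
    have "g = (\<lambda>xs. (f xs + 0) * a + (- (f xs * a) + g xs))" by (simp add: fun_eq_iff)
    with g1 g2 show "g \<in> mact H1 X a"
      unfolding H1_unfold by (intro CollectI exI[of _ "\<lambda>xs. f xs + 0"] exI[of _ "\<lambda>xs. - (f xs * a) + g xs"] conjI)
  qed
  then show ?thesis using a by blast
qed

text \<open>The module record has no zero component. That B1 + B1 = B1 is what forces additive maps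
  to send B1 to 0.\<close>

lemma B1_add: "madd H1 B1 B1 = B1"
proof (intro equalityI subsetI)
  fix g assume "g \<in> madd H1 B1 B1"
  then obtain f1 f2 where "f1 \<in> B1" "f2 \<in> B1" "g = (\<lambda>xs. f1 xs + f2 xs)"
    unfolding H1_unfold by blast
  then show "g \<in> B1" using B1_closed(1)[of f1 f2] by simp
next
  fix g assume g: "g \<in> B1"
  show "g \<in> madd H1 B1 B1"
    unfolding H1_unfold by (rule CollectI, rule exI[of _ g], rule exI[of _ "\<lambda>xs. 0"]) (simp add: g B1_closed(4))
qed

text \<open>The entries of columns in p M^k have no a-torsion, so \<phi> vanishes on P. Being onto,
  it forces p M^k = 0, and the supremum runs over zeros only.\<close>

lemma l2_betti_1: "l2_betti counit \<pi> \<xi> 1 = 0"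
proof -
  let ?\<tau> = "\<lambda>T. cinner \<xi> (apply_op T \<xi>)"
  have "Re (\<Sum>i<k. ?\<tau> (p i i)) = 0"
    if P: "is_submodule M H1 P" and \<phi>: "module_iso M (H1\<lparr>elems := P\<rparr>) (matrix_range M k p) \<phi>"
    for P k p \<phi>
  proof -
    have bij: "bij_betw \<phi> P (elems (matrix_range M k p))"
      and add: "\<And>x y. x \<in> P \<Longrightarrow> y \<in> P \<Longrightarrow> \<phi> (madd H1 x y) = (\<lambda>i. \<phi> x i + \<phi> y i)"
      and act: "\<And>x m. x \<in> P \<Longrightarrow> m \<in> M \<Longrightarrow> \<phi> (mact H1 x m) = (\<lambda>i. \<phi> x i * m)"
      using \<phi> by (simp_all add: module_iso_def matrix_range_def)
    have zero: "\<phi> X i = 0" if X: "X \<in> P" for X i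
    proof -
      have XH: "X \<in> elems H1" using P X by (auto simp: is_submodule_def)
      obtain a where a: "a \<in> M" "mact H1 X a = B1" "\<forall>x. x * a = 0 \<longrightarrow> x = 0"
        using H1_torsion[OF XH] by (elim bexE conjE) (rule that)
      have "mact H1 X a \<in> P" using P X a(1) by (simp add: is_submodule_def)
      then have "B1 \<in> P" by (simp add: a(2))
      from fun_cong[OF add[OF this this], of i] have "\<phi> B1 i = 0" unfolding B1_add by simp
      then have "\<phi> X i * a = 0" using act[OF X a(1)] by (simp add: a(2))
      then show ?thesis using a(3) by simp
    qed
    have "p j j = 0" if j: "j < k" for j
    proof -
      \<comment> \<open>The j-th standard basis column, whose image under p is the j-th column of
        p.\<close>
      let ?e = "\<lambda>i. if i = j then 1 else 0 :: 'h bop"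
      have "?e \<in> columns M k" using j M_closed by (auto simp: columns_def)
      then have "(\<lambda>i. if i < k then \<Sum>l<k. p i l * ?e l else 0) \<in> elems (matrix_range M k p)"
        unfolding matrix_range_def by simp
      then have "(\<lambda>i. if i < k then \<Sum>l<k. p i l * ?e l else 0) \<in> \<phi> ` P"
        using bij_betw_imp_surj_on[OF bij] by simp
      then obtain X where X: "X \<in> P" "(\<lambda>i. if i < k then \<Sum>l<k. p i l * ?e l else 0) = \<phi> X"
        by (rule imageE) auto
      have "(if j < k then \<Sum>l<k. p j l * ?e l else 0) = 0"
        using fun_cong[OF X(2), of j] zero[OF X(1), of j] by simp
      then show ?thesis using j by (simp add: if_distrib cong: if_cong)
    qed
    then show ?thesis by (simp add: zero_bop.rep_eq)
  qed
  then have "extended_dim M ?\<tau> H1 \<le> 0"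
    unfolding extended_dim_def by (intro Sup_least) auto
  then show ?thesis unfolding l2_betti_def Let_def H1_def M_def by simp
qed

end

theorem corollary5p3:
  fixes h :: "'n::finite Ao \<Rightarrow> complex"
    and \<pi> :: "'n Ao \<Rightarrow> 'h::complex_hilbert_space bop"
    and \<xi> :: 'h
  assumes "CARD('n) \<ge> 3"
    and "haar_state coproduct h"
    and "gns_representation h \<pi> \<xi>"
  shows "l2_betti counit \<pi> \<xi> 1 = 0"
proof -
  interpret Ao_gns "TYPE('n)" "real CARD('n)" h \<pi> \<xi>
    by unfold_locales (use assms in auto)
  show ?thesis by (rule l2_betti_1)
qed

end
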